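(* Let $(U_0,\dots,U_n)$ be a Markov chain generated by the uniform distribution on $[0,1]$ and a copula with one of the following densities $c=c_\Lambda$: (1) sine: $c(u,v)=1+2\lambda_1\cos(\pi u)\cos(\pi v)+2\lambda_2\cos(2\pi u)\cos(2\pi v)$, $\Lambda=(\lambda_1,\lambda_2)$, parameter region $|\lambda_1|+|\lambda_2|\le1/2$; (2) sine-cosine: $c(u,v)=1+2\lambda_1\cos(2\pi u)\cos(2\pi v)+2\mu_1\sin(2\pi u)\sin(2\pi v)+2\lambda_2\cos(4\pi u)\cos(4\pi v)+2\mu_2\sin(4\pi u)\sin(4\pi v)$, $\Lambda=(\lambda_1,\lambda_2,\mu_1,\mu_2)$, parameter region $|\lambda_1|+|\lambda_2|+|\mu_1|+|\mu_2|\le1/2$; (3) Legendre: $c(u,v)=1+3\lambda_1(2u-1)(2v-1)+5\lambda_2(6u^2-6u+1)(6v^2-6v+1)$, $\Lambda=(\lambda_1,\lambda_2)$, parameter region $3|\lambda_1|+5|\lambda_2|\le1$. Assume the true parameter $\Lambda$ lies in the interior of the parameter region. Then there exists a consistent maximum likelihood estimator $\Lambda^{ML}$ such that $$\sqrt n(\Lambda^{ML}-\Lambda)\to N(\mathbf 0,\Sigma^{-1})\quad\text{in distribution as }n\to\infty,$$ and the (asymptotic) $(1-\alpha)100\%$ confidence interval for the $k$-th component $\Lambda_k$ of $\Lambda$ (a $\lambda_k$, or a $\mu_k$ for the sine-cosine copula) is $$\left(\Lambda_k^{ML}-z_{\alpha/2}\sqrt{\left[I_n^{-1}(\Lambda^{ML})\right]_{k,k}},\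 \ \Lambda_k^{ML}+z_{\alpha/2}\sqrt{\left[I_n^{-1}(\Lambda^{ML})\right]_{k,k}}\right),$$ i.e. the probability that this interval contains $\Lambda_k$ tends to $1-\alpha$ as $n\to\infty$.
   Context: A copula is a bivariate cumulative distribution function with uniform marginals on $[0,1]$. A Markov chain generated by a copula $C$ with density $c$ and the uniform marginal distribution is a stationary Markov chain $(U_i)_{i\ge0}$ with each $U_i$ uniform on $(0,1)$ and with $C$ the joint distribution function of $(U_i,U_{i+1})$; equivalently its transition density is $c(u,\cdot)$. The log-likelihood is $\ell(\Lambda)=\sum_{i=1}^n\ln c_\Lambda(U_{i-1},U_i)$, and a maximum likelihood estimator $\Lambda^{ML}$ is a maximizer of $\ell$ over the parameter region. With $\Lambda_1,\dots,\Lambda_s$ the components of $\Lambda$, $\Sigma=(\sigma_{i,j})$ is the matrix $$\sigma_{i,j}=\mathbb E_\Lambda\left[\frac{\partial}{\partial\Lambda_i}\ln c_\Lambda(U_0,U_1)\,\frac{\partial}{\partial\Lambda_j}\ln c_\Lambda(U_0,U_1)\right],$$ and $I_n(\Lambda)=-\left(\frac{\partial^2\ell(\Lambda)}{\partial\Lambda_k\,\partial\Lambda_j}\right)_{1\le k,j\le s}$. Here $\alpha\in(0,1)$ and $z_{\alpha/2}$ is the upper $\alpha/2$ quantile of the standard normal distribution. *)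

theory Defs
  imports "HOL-Probability.Probability"
begin

section \<open>Copulas and the Markov chains they generate\<close>

definition copula :: "(real \<Rightarrow> real \<Rightarrow> real) \<Rightarrow> bool" where
  "copula C \<longleftrightarrow>
    (\<exists>N. prob_space N \<and> sets N = sets (borel \<Otimes>\<^sub>M borel) \<and>
         distr N borel fst = uniform_measure lborel {0..1} \<and>
         distr N borel snd = uniform_measure lborel {0..1} \<and>
         (\<forall>u v. C u v = measure N ({..u} \<times> {..v})))"

text \<open>
  Densities are functions on the unit square; they are given below by formulas that make sense
  on the whole plane, and the values outside the square are irrelevant.
\<close>

definition has_copula_density ::
    "(real \<Rightarrow> real \<Rightarrow> real) \<Rightarrow> (real \<Rightarrow> real \<Rightarrow> real) \<Rightarrow> bool" where
  "has_copula_density C c \<longleftrightarrow>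
    copula C \<and>
    (\<forall>u\<in>{0..1}. \<forall>v\<in>{0..1}.
       set_integrable (lborel \<Otimes>\<^sub>M lborel) ({0..u} \<times> {0..v}) (\<lambda>(x, y). c x y) \<and>
       C u v = set_lebesgue_integral (lborel \<Otimes>\<^sub>M lborel) ({0..u} \<times> {0..v}) (\<lambda>(x, y). c x y))"

text \<open>The sample \<open>(U\<^sub>0, \<dots>, U\<^sub>n)\<close>, as an element of the space of \<open>\<Pi>\<^sub>M i\<in>{..n}. borel\<close>.\<close>

definition sample :: "(nat \<Rightarrow> 'w \<Rightarrow> real) \<Rightarrow> nat \<Rightarrow> 'w \<Rightarrow> nat \<Rightarrow> real" where
  "sample U n \<omega> = (\<lambda>i\<in>{..n}. U i \<omega>)"

text \<open>
  Markov property: the conditional law of \<open>U\<^sub>n\<^sub>+\<^sub>1\<close> given \<open>\<sigma>(U\<^sub>0, \<dots>, U\<^sub>n)\<close> is its conditional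
  law given \<open>\<sigma>(U\<^sub>n)\<close>.
\<close>

definition markov_property :: "'w measure \<Rightarrow> (nat \<Rightarrow> 'w \<Rightarrow> real) \<Rightarrow> bool" where
  "markov_property M U \<longleftrightarrow>
    (\<forall>n. \<forall>A\<in>sets borel. AE \<omega> in M.
       real_cond_exp M (vimage_algebra (space M) (sample U n) (\<Pi>\<^sub>M i\<in>{..n}. borel))
         (\<lambda>\<omega>. indicator A (U (Suc n) \<omega>)) \<omega> =
       real_cond_exp M (vimage_algebra (space M) (U n) borel)
         (\<lambda>\<omega>. indicator A (U (Suc n) \<omega>)) \<omega>)"

definition stationary :: "'w measure \<Rightarrow> (nat \<Rightarrow> 'w \<Rightarrow> real) \<Rightarrow> bool" where
  "stationary M U \<longleftrightarrow>
    (\<forall>k n. distr M (\<Pi>\<^sub>M i\<in>{..n}. borel) (sample (\<lambda>i. U (k + i)) n) =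
           distr M (\<Pi>\<^sub>M i\<in>{..n}. borel) (sample U n))"

definition copula_markov_chain ::
    "'w measure \<Rightarrow> (nat \<Rightarrow> 'w \<Rightarrow> real) \<Rightarrow> (real \<Rightarrow> real \<Rightarrow> real) \<Rightarrow> bool" where
  "copula_markov_chain M U C \<longleftrightarrow>
    prob_space M \<and> (\<forall>i. U i \<in> borel_measurable M) \<and>
    markov_property M U \<and> stationary M U \<and>
    (\<forall>i. distr M borel (U i) = uniform_measure lborel {0<..<1}) \<and>
    (\<forall>i u v. measure M {\<omega> \<in> space M. U i \<omega> \<le> u \<and> U (Suc i) \<omega> \<le> v} = C u v)"

section \<open>Likelihood\<close>

text \<open>
  The logarithm with \<open>ln 0 = -\<infinity>\<close>. On the boundary of the parameter regions a density may
  vanish at some points of the square; the real-valued library logarithm has \<open>ln 0 = 0\<close>, which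
  would produce spurious maximizers.
\<close>

definition ln_ext :: "real \<Rightarrow> ereal" where
  "ln_ext x = (if 0 < x then ereal (ln x) else - \<infinity>)"

definition log_likelihood ::
    "('p \<Rightarrow> real \<Rightarrow> real \<Rightarrow> real) \<Rightarrow> nat \<Rightarrow> (nat \<Rightarrow> real) \<Rightarrow> 'p \<Rightarrow> ereal" where
  "log_likelihood c n x \<Lambda> = (\<Sum>i=1..n. ln_ext (c \<Lambda> (x (i - 1)) (x i)))"

text \<open>
  An estimator is a sequence of statistics: \<open>T n\<close> is a measurable function of the sample
  \<open>(x\<^sub>0, \<dots>, x\<^sub>n)\<close> alone.
\<close>

definition max_likelihood_estimator ::
    "('p::euclidean_space \<Rightarrow> real \<Rightarrow> real \<Rightarrow> real) \<Rightarrow> 'p set \<Rightarrow>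
     (nat \<Rightarrow> (nat \<Rightarrow> real) \<Rightarrow> 'p) \<Rightarrow> bool" where
  "max_likelihood_estimator c \<Theta> T \<longleftrightarrow>
    (\<forall>n. T n \<in> borel_measurable (\<Pi>\<^sub>M i\<in>{..n}. borel) \<and>
         (\<forall>x \<in> {..n} \<rightarrow>\<^sub>E {0..1}.
            T n x \<in> \<Theta> \<and>
            (\<forall>\<Lambda>'\<in>\<Theta>. log_likelihood c n x \<Lambda>' \<le> log_likelihood c n x (T n x))))"

definition partial_deriv ::
    "'s::finite \<Rightarrow> (real^'s \<Rightarrow> real) \<Rightarrow> real^'s \<Rightarrow> real" where
  "partial_deriv k f \<Lambda> = deriv (\<lambda>t. f (\<Lambda> + t *\<^sub>R axis k 1)) 0"

text \<open>The matrix \<open>\<Sigma>\<close>; the expectation is under the law of a chain with parameter \<open>\<Lambda>\<close>.\<close>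

definition Sigma_matrix ::
    "'w measure \<Rightarrow> (nat \<Rightarrow> 'w \<Rightarrow> real) \<Rightarrow> (real^'s \<Rightarrow> real \<Rightarrow> real \<Rightarrow> real) \<Rightarrow>
     real^'s \<Rightarrow> real^'s^('s::finite)" where
  "Sigma_matrix M U c \<Lambda> =
    (\<chi> i j. LINT \<omega>|M.
       partial_deriv i (\<lambda>L. ln (c L (U 0 \<omega>) (U 1 \<omega>))) \<Lambda> *
       partial_deriv j (\<lambda>L. ln (c L (U 0 \<omega>) (U 1 \<omega>))) \<Lambda>)"

text \<open>
  \<open>real_of_ereal\<close> is harmless here: where the log-likelihood is finite, it is finite in a
  neighbourhood (the densities are continuous in the parameter), and it is finite at every
  maximizer, since it vanishes at the parameter \<open>0\<close>.
\<close>

definition observed_information ::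
    "(real^'s \<Rightarrow> real \<Rightarrow> real \<Rightarrow> real) \<Rightarrow> nat \<Rightarrow> (nat \<Rightarrow> real) \<Rightarrow>
     real^'s \<Rightarrow> real^'s^('s::finite)" where
  "observed_information c n x \<Lambda> =
    (\<chi> k j. - partial_deriv k
               (partial_deriv j (\<lambda>L. real_of_ereal (log_likelihood c n x L))) \<Lambda>)"

section \<open>Asymptotics\<close>

definition consistent_estimator ::
    "'w measure \<Rightarrow> (nat \<Rightarrow> 'w \<Rightarrow> real) \<Rightarrow> (nat \<Rightarrow> (nat \<Rightarrow> real) \<Rightarrow> 'p::metric_space) \<Rightarrow>
     'p \<Rightarrow> bool" where
  "consistent_estimator M U T \<Lambda> \<longleftrightarrow>
    (\<forall>\<epsilon>>0. (\<lambda>n. measure M {\<omega> \<in> space M. dist (T n (sample U n \<omega>)) \<Lambda> > \<epsilon>}) \<longlonglongrightarrow> 0)"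

definition converges_in_distribution ::
    "'w measure \<Rightarrow> (nat \<Rightarrow> 'w \<Rightarrow> 'p::topological_space) \<Rightarrow> 'p measure \<Rightarrow> bool" where
  "converges_in_distribution M X \<mu> \<longleftrightarrow>
    (\<forall>f :: 'p \<Rightarrow> real. continuous_on UNIV f \<and> bounded (range f) \<longrightarrow>
       (\<lambda>n. LINT \<omega>|M. f (X n \<omega>)) \<longlonglongrightarrow> (LINT x|\<mu>. f x))"

text \<open>The normal law \<open>N(m, V)\<close>, for a positive definite covariance matrix \<open>V\<close>.\<close>

definition multivariate_normal ::
    "real^'s \<Rightarrow> real^'s^('s::finite) \<Rightarrow> (real^'s) measure" where
  "multivariate_normal m V = density lborel (\<lambda>x. ennreal
     (exp (- ((x - m) \<bullet> (matrix_inv V *v (x - m))) / 2) / sqrt ((2 * pi) ^ CARD('s) * det V)))"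

definition std_normal_upper_quantile :: "real \<Rightarrow> real" where
  "std_normal_upper_quantile p = (THE z. measure (density lborel std_normal_density) {z<..} = p)"

section \<open>The three families\<close>

definition sine_density :: "real^2 \<Rightarrow> real \<Rightarrow> real \<Rightarrow> real" where
  "sine_density \<Lambda> u v =
     1 + 2 * \<Lambda>$1 * cos (pi * u) * cos (pi * v) + 2 * \<Lambda>$2 * cos (2 * pi * u) * cos (2 * pi * v)"

definition sine_region :: "(real^2) set" where
  "sine_region = {\<Lambda>. \<bar>\<Lambda>$1\<bar> + \<bar>\<Lambda>$2\<bar> \<le> 1/2}"

text \<open>The components of the sine-cosine parameter are \<open>(\<lambda>\<^sub>1, \<lambda>\<^sub>2, \<mu>\<^sub>1, \<mu>\<^sub>2)\<close>, in this order.\<close>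

definition sine_cosine_density :: "real^4 \<Rightarrow> real \<Rightarrow> real \<Rightarrow> real" where
  "sine_cosine_density \<Lambda> u v =
     1 + 2 * \<Lambda>$1 * cos (2 * pi * u) * cos (2 * pi * v)
       + 2 * \<Lambda>$3 * sin (2 * pi * u) * sin (2 * pi * v)
       + 2 * \<Lambda>$2 * cos (4 * pi * u) * cos (4 * pi * v)
       + 2 * \<Lambda>$4 * sin (4 * pi * u) * sin (4 * pi * v)"

definition sine_cosine_region :: "(real^4) set" where
  "sine_cosine_region = {\<Lambda>. \<bar>\<Lambda>$1\<bar> + \<bar>\<Lambda>$2\<bar> + \<bar>\<Lambda>$3\<bar> + \<bar>\<Lambda>$4\<bar> \<le> 1/2}"

definition legendre_density :: "real^2 \<Rightarrow> real \<Rightarrow> real \<Rightarrow> real" where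
  "legendre_density \<Lambda> u v =
     1 + 3 * \<Lambda>$1 * (2 * u - 1) * (2 * v - 1)
       + 5 * \<Lambda>$2 * (6 * u\<^sup>2 - 6 * u + 1) * (6 * v\<^sup>2 - 6 * v + 1)"

definition legendre_region :: "(real^2) set" where
  "legendre_region = {\<Lambda>. 3 * \<bar>\<Lambda>$1\<bar> + 5 * \<bar>\<Lambda>$2\<bar> \<le> 1}"

end

theory Submission
  imports Defs "HOL-Real_Asymp.Real_Asymp"
begin

text \<open>
  Each of the three densities has the form
  \<open>c\<^sub>\<Lambda>(u, v) = 1 + \<Sum>\<^sub>k \<Lambda>\<^sub>k e\<^sub>k(u) e\<^sub>k(v)\<close>, where the functions \<open>e\<^sub>k\<close> are orthonormal in \<open>L\<^sup>2[0,1]\<close> and have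
  mean zero, and each parameter region is \<open>\<Sum>\<^sub>k b\<^sub>k |\<Lambda>\<^sub>k| \<le> 1\<close> with \<open>b\<^sub>k\<close> the maximum of \<open>e\<^sub>k\<^sup>2\<close> on
  \<open>[0,1]\<close>. Two features of this form carry the proof.

  The density is affine in the parameter. Hence the log-likelihood is concave, and with
  \<open>\<psi> = (e\<^sub>k(u) e\<^sub>k(v))\<^sub>k\<close>, \<open>h = T - \<Lambda>\<close> and \<open>T\<close> the maximizer, the identity
  \<open>1/c\<^sub>T - 1/c\<^sub>\<Lambda> = - (h \<bullet> \<psi>) / (c\<^sub>T c\<^sub>\<Lambda>)\<close> turns the likelihood equations into an exact linear
  relation between \<open>h\<close> and the score. Already the variational inequality for a maximizer over a
  convex set bounds the quadratic form of the sample information at \<open>h\<close> by the scalar product of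
  \<open>h\<close> with the score, and this gives consistency with rate \<open>1/\<surd>n\<close> without a preliminary
  localization (\<open>root_n_rate\<close>). Once \<open>T\<close> is interior, the equations say that \<open>\<surd>n h\<close> is
  \<open>\<Sigma>\<^sup>-\<^sup>1\<close> times the normalized score up to a vanishing error (\<open>asymptotic_linearity\<close>), and that the
  observed information at \<open>T\<close>, divided by \<open>n\<close>, is close to \<open>\<Sigma>\<close> (\<open>plug_in_info_limit\<close>).

  The transition operator has finite rank and is diagonal in the \<open>e\<^sub>k\<close>, with eigenvalues
  \<open>\<Lambda>\<^sub>k\<close> of modulus less than one. So Poisson's equation has an explicit bounded solution, and every
  bounded function of two consecutive states is its mean plus a martingale difference plus a
  telescoping term (\<open>poisson_decomposition\<close>). This yields the law of large numbers in mean square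
  (\<open>law_of_large_numbers\<close>) and, since the score is itself a martingale difference, convergence of
  its characteristic functions to those of \<open>N(0, \<Sigma>)\<close> (\<open>char_function_limit\<close>).

  What remains is of a general kind: passing from characteristic functions to convergence in
  distribution in several dimensions (\<open>continuity_theorem\<close>), the characteristic function of the
  multivariate normal law (\<open>multivariate_normal_char\<close>), a measurable choice of a maximizer
  (\<open>measurable_argmax_selection\<close>), and Slutsky's argument for the confidence intervals
  (\<open>studentized_interval\<close>).

  Outside the unit square a density may be negative or unbounded. The probabilistic part therefore
  works with the functions \<open>e\<^sub>k\<close> cut off outside \<open>[0,1]\<close>: this changes the likelihood on a null
  event only, while all functions become bounded, and the density becomes \<open>1\<close> off the square.
\<close>

section \<open>The transition law of a chain generated by a copula\<close>

abbreviation unif01 :: "real measure" where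
  "unif01 \<equiv> uniform_measure lborel {0..1}"

lemma unif01_eq_density: "unif01 = density lborel (\<lambda>x. indicator {0..1} x)"
  unfolding uniform_measure_def by (intro density_cong) (auto simp: divide_ennreal_def)

lemma prob_space_unif01: "prob_space unif01"
  by (rule prob_space_uniform_measure) simp_all

interpretation unif01: prob_space unif01
  by (rule prob_space_unif01)

lemma uniform_measure_Ioo_eq: "uniform_measure lborel {0<..<1::real} = unif01"
proof (rule measure_eqI)
  fix A assume "A \<in> sets (uniform_measure lborel {0<..<1::real})"
  then have [measurable]: "A \<in> sets borel" by simp
  have "AE x in lborel. x \<in> {0<..<1} \<inter> A \<longleftrightarrow> x \<in> {0..1::real} \<inter> A"
    using AE_lborel_singleton[of "0::real"] AE_lborel_singleton[of "1::real"]
    by eventually_elim auto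
  then have "emeasure lborel ({0<..<1} \<inter> A) = emeasure lborel ({0..1::real} \<inter> A)"
    by (intro emeasure_eq_AE) auto
  then show "emeasure (uniform_measure lborel {0<..<1}) A = emeasure unif01 A"
    by (subst (1 2) emeasure_uniform_measure) auto
qed simp

lemma AE_unif01: "AE x in unif01. x \<in> {0..1}"
  by (rule AE_uniform_measureI) auto

lemma sets_prod_eq_borel: "sets (borel \<Otimes>\<^sub>M borel :: (real \<times> real) measure) = sets borel"
  by (metis borel_prod)

text \<open>
  Quadrants are closed under intersection, generate the Borel sets of the plane and exhaust it, so
  a joint distribution function determines the law.
\<close>

lemma measure_eqI_quadrants:
  fixes M N :: "(real \<times> real) measure"
  assumes "sets M = sets (borel \<Otimes>\<^sub>M borel)" "sets N = sets (borel \<Otimes>\<^sub>M borel)" "finite_measure M"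
    and eq: "\<And>u v. emeasure M ({..u} \<times> {..v}) = emeasure N ({..u} \<times> {..v})"
  shows "M = N"
proof (rule measure_eqI_generator_eq)
  let ?E = "range (\<lambda>a::real \<times> real. {..a})"
  interpret finite_measure M by fact
  have eq': "{..a} = {..fst a} \<times> {..snd a}" for a :: "real \<times> real"
    by (auto simp: less_eq_prod_def)
  show "Int_stable ?E"
  proof (intro Int_stableI, elim imageE, clarify)
    fix a b c d :: real
    have "{..(a, b)} \<inter> {..(c, d)} = {..(min a c, min b d)}"
      by (auto simp: eq')
    then show "{..(a, b)} \<inter> {..(c, d)} \<in> ?E" by blast
  qed
  show "?E \<subseteq> Pow UNIV" by simp
  show "emeasure M X = emeasure N X" if "X \<in> ?E" for X
    using that eq by (auto simp: eq')
  have *: "sets (borel :: (real \<times> real) measure) = sigma_sets UNIV ?E"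
    by (subst borel_eq_atMost) (simp add: image_def)
  show "sets M = sigma_sets UNIV ?E" "sets N = sigma_sets UNIV ?E"
    using assms(1,2) * sets_prod_eq_borel by auto
  show "range (\<lambda>i::nat. {..(real i, real i)}) \<subseteq> ?E" by blast
  show "(\<Union>i::nat. {..(real i, real i)}) = UNIV"
  proof safe
    fix a b :: real
    obtain i where "real i \<ge> max a b" using real_arch_simple by blast
    then show "(a, b) \<in> (\<Union>i::nat. {..(real i, real i)})"
      by (auto intro!: exI[of _ i])
  qed simp
  show "emeasure M {..(real i, real i)} \<noteq> \<infinity>" for i using emeasure_finite by simp
qed

text \<open>
  The function \<open>c\<close> is a version of the given density \<open>c0\<close> that is nonnegative and bounded on
  the whole plane; only the values on the unit square are tied to \<open>c0\<close>.
\<close>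

locale copula_chain = prob_space M
  for M :: "'w measure" +
  fixes U :: "nat \<Rightarrow> 'w \<Rightarrow> real" and C c0 c :: "real \<Rightarrow> real \<Rightarrow> real" and B :: real
  assumes chain: "copula_markov_chain M U C"
    and dens: "has_copula_density C c0"
    and c_eq: "\<And>u v. u \<in> {0..1} \<Longrightarrow> v \<in> {0..1} \<Longrightarrow> c u v = c0 u v"
    and c_meas: "(\<lambda>(u, v). c u v) \<in> borel_measurable (borel \<Otimes>\<^sub>M borel)"
    and c_nn: "\<And>u v. 0 \<le> c u v" and c_le: "\<And>u v. c u v \<le> B"
begin

lemma chain_measurable[measurable]: "U i \<in> borel_measurable M"
  using chain by (simp add: copula_markov_chain_def)

lemma chain_distr: "distr M borel (U i) = unif01"
  using chain by (simp add: copula_markov_chain_def uniform_measure_Ioo_eq)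

lemma chain_AE: "AE \<omega> in M. U i \<omega> \<in> {0..1}"
proof -
  have "AE x in distr M borel (U i). x \<in> {0..1}"
    unfolding chain_distr by (rule AE_unif01)
  then show ?thesis by (subst (asm) AE_distr_iff) auto
qed

lemma sample_measurable[measurable]: "sample U n \<in> measurable M (\<Pi>\<^sub>M i\<in>{..n}. borel)"
  unfolding sample_def by measurable

lemmas c_measurable[measurable] = c_meas
lemma c_comp_measurable[measurable (raw)]:
  assumes "g \<in> borel_measurable N" "h \<in> borel_measurable N"
  shows "(\<lambda>x. c (g x) (h x)) \<in> borel_measurable N"
  using measurable_compose[OF measurable_Pair[OF assms] c_meas] by simp

text \<open>
  Both laws have the same distribution function: the copula prescribes it on the unit square, and
  outside the square it is determined by the uniform marginals.
\<close>

lemma pair_law: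
  "distr M (borel \<Otimes>\<^sub>M borel) (\<lambda>\<omega>. (U i \<omega>, U (Suc i) \<omega>)) =
   density (unif01 \<Otimes>\<^sub>M unif01) (\<lambda>(u, v). ennreal (c u v))"
proof (rule measure_eqI_quadrants)
  interpret P: prob_space "distr M (borel \<Otimes>\<^sub>M borel) (\<lambda>\<omega>. (U i \<omega>, U (Suc i) \<omega>))"
    by (rule prob_space_distr) measurable
  show "finite_measure (distr M (borel \<Otimes>\<^sub>M borel) (\<lambda>\<omega>. (U i \<omega>, U (Suc i) \<omega>)))"
    by (rule P.finite_measure_axioms)
  fix u v :: real
  \<comment> \<open>The copula density is prescribed for arguments in \<open>[0,1]\<close>; larger ones are moved to \<open>1\<close>.\<close>
  define u' v' where uv': "u' = min 1 u" "v' = min 1 v"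
  have joint: "prob {\<omega> \<in> space M. U i \<omega> \<le> s \<and> U (Suc i) \<omega> \<le> t} = C s t" for s t
    using chain by (simp add: copula_markov_chain_def)
  have L: "emeasure (distr M (borel \<Otimes>\<^sub>M borel) (\<lambda>\<omega>. (U i \<omega>, U (Suc i) \<omega>))) ({..u} \<times> {..v})
      = ennreal (C u v)"
  proof -
    have "emeasure (distr M (borel \<Otimes>\<^sub>M borel) (\<lambda>\<omega>. (U i \<omega>, U (Suc i) \<omega>))) ({..u} \<times> {..v})
      = emeasure M ((\<lambda>\<omega>. (U i \<omega>, U (Suc i) \<omega>)) -` ({..u} \<times> {..v}) \<inter> space M)"
      by (subst emeasure_distr) auto
    also have "(\<lambda>\<omega>. (U i \<omega>, U (Suc i) \<omega>)) -` ({..u} \<times> {..v}) \<inter> space M =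
        {\<omega> \<in> space M. U i \<omega> \<le> u \<and> U (Suc i) \<omega> \<le> v}" by auto
    finally show ?thesis using joint[of u v] by (simp add: emeasure_eq_measure)
  qed
  have C': "C u v = (if u < 0 \<or> v < 0 then 0 else C u' v')"
  proof (cases "u < 0 \<or> v < 0")
    case True
    have "prob {\<omega> \<in> space M. U i \<omega> \<le> u \<and> U (Suc i) \<omega> \<le> v} = prob {}"
      using chain_AE[of i] chain_AE[of "Suc i"] True
      by (intro measure_eq_AE) (auto elim!: eventually_mono[OF eventually_conj])
    then show ?thesis using True joint by simp
  next
    case False
    have "prob {\<omega> \<in> space M. U i \<omega> \<le> u \<and> U (Suc i) \<omega> \<le> v} =
        prob {\<omega> \<in> space M. U i \<omega> \<le> u' \<and> U (Suc i) \<omega> \<le> v'}"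
    proof (intro measure_eq_AE)
      show "AE x in M. (x \<in> {\<omega> \<in> space M. U i \<omega> \<le> u \<and> U (Suc i) \<omega> \<le> v}) =
          (x \<in> {\<omega> \<in> space M. U i \<omega> \<le> u' \<and> U (Suc i) \<omega> \<le> v'})"
        using chain_AE[of i] chain_AE[of "Suc i"]
        by eventually_elim (auto simp: uv')
    qed auto
    then show ?thesis using False joint by simp
  qed
  have R: "emeasure (density (unif01 \<Otimes>\<^sub>M unif01) (\<lambda>(u, v). ennreal (c u v))) ({..u} \<times> {..v})
     = (\<integral>\<^sup>+z. ennreal (indicator ({0..u'} \<times> {0..v'}) z * c0 (fst z) (snd z)) \<partial>(lborel \<Otimes>\<^sub>M lborel))"
  proof -
    have "unif01 \<Otimes>\<^sub>M unif01 = density (lborel \<Otimes>\<^sub>M lborel)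
        (\<lambda>(x, y). indicator {0..1} x * indicator {0..1} y)"
      unfolding unif01_eq_density
      by (rule pair_measure_density)
         (auto simp flip: unif01_eq_density intro: unif01.sigma_finite_measure lborel.sigma_finite_measure_axioms
            prob_space_imp_sigma_finite prob_space_unif01)
    then have "emeasure (density (unif01 \<Otimes>\<^sub>M unif01) (\<lambda>(u, v). ennreal (c u v))) ({..u} \<times> {..v})
      = (\<integral>\<^sup>+z. (indicator {0..1} (fst z) * indicator {0..1} (snd z)) *
           (ennreal (c (fst z) (snd z)) * indicator ({..u} \<times> {..v}) z) \<partial>(lborel \<Otimes>\<^sub>M lborel))"
      by (simp add: emeasure_density nn_integral_density split_beta')
    also have "\<dots> = (\<integral>\<^sup>+z. ennreal (indicator ({0..u'} \<times> {0..v'}) z * c0 (fst z) (snd z)) \<partial>(lborel \<Otimes>\<^sub>M lborel))"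
    proof (intro nn_integral_cong)
      fix z :: "real \<times> real"
      have "(indicator {0..1} (fst z) * indicator {0..1} (snd z)) *
          (ennreal (c (fst z) (snd z)) * indicator ({..u} \<times> {..v}) z) =
          ennreal (indicator ({0..u'} \<times> {0..v'}) z * c (fst z) (snd z))"
        by (cases z) (auto simp: uv' indicator_def)
      also have "indicator ({0..u'} \<times> {0..v'}) z * c (fst z) (snd z) =
          indicator ({0..u'} \<times> {0..v'}) z * c0 (fst z) (snd z)"
        using c_eq[of "fst z" "snd z"] by (cases z) (auto simp: uv' indicator_def)
      finally show "(indicator {0..1} (fst z) * indicator {0..1} (snd z)) *
          (ennreal (c (fst z) (snd z)) * indicator ({..u} \<times> {..v}) z) =
          ennreal (indicator ({0..u'} \<times> {0..v'}) z * c0 (fst z) (snd z))" .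
    qed
    finally show ?thesis .
  qed
  show "emeasure (distr M (borel \<Otimes>\<^sub>M borel) (\<lambda>\<omega>. (U i \<omega>, U (Suc i) \<omega>))) ({..u} \<times> {..v}) =
      emeasure (density (unif01 \<Otimes>\<^sub>M unif01) (\<lambda>(u, v). ennreal (c u v))) ({..u} \<times> {..v})"
  proof (cases "u < 0 \<or> v < 0")
    case True
    then have "indicator ({0..u'} \<times> {0..v'}) z = (0::real)" for z :: "real \<times> real"
      by (auto simp: uv' indicator_def)
    then show ?thesis using True by (simp add: L R C')
  next
    case False
    then have uv: "u' \<in> {0..1}" "v' \<in> {0..1}" by (auto simp: uv')
    have nn: "0 \<le> indicator ({0..u'} \<times> {0..v'}) z * c0 (fst z) (snd z)" for z :: "real \<times> real"
      using c_eq[of "fst z" "snd z"] c_nn[of "fst z" "snd z"] uv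
      by (cases z) (auto simp: indicator_def)
    have "set_integrable (lborel \<Otimes>\<^sub>M lborel) ({0..u'} \<times> {0..v'}) (\<lambda>(x, y). c0 x y) \<and>
       C u' v' = set_lebesgue_integral (lborel \<Otimes>\<^sub>M lborel) ({0..u'} \<times> {0..v'}) (\<lambda>(x, y). c0 x y)"
      using dens uv unfolding has_copula_density_def by blast
    then have "(\<integral>\<^sup>+z. ennreal (indicator ({0..u'} \<times> {0..v'}) z * c0 (fst z) (snd z)) \<partial>(lborel \<Otimes>\<^sub>M lborel))
       = ennreal (C u' v')"
      using nn
      by (subst nn_integral_eq_integral)
         (auto simp: set_integrable_def set_lebesgue_integral_def split_beta')
    then show ?thesis using False by (simp add: L R C')
  qed
qed (auto simp: sets_uniform_measure)

definition transition_prob :: "real set \<Rightarrow> real \<Rightarrow> real" where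
  "transition_prob A u = (\<integral>v. c u v * indicator A v \<partial>unif01)"

lemma transition_prob_measurable:
  assumes [measurable]: "A \<in> sets borel"
  shows "transition_prob A \<in> borel_measurable borel"
  unfolding transition_prob_def by measurable

lemma c_ind_integrable:
  assumes [measurable]: "A \<in> sets borel"
  shows "integrable unif01 (\<lambda>v. c u v * indicator A v)"
  by (rule unif01.integrable_const_bound[where B = B])
     (use c_nn c_le order_trans[OF c_nn c_le] in \<open>auto simp: indicator_def\<close>)

lemma transition_prob_bounds:
  assumes "A \<in> sets borel"
  shows "0 \<le> transition_prob A u" "transition_prob A u \<le> B"
proof -
  show "0 \<le> transition_prob A u" unfolding transition_prob_def using c_nn by (intro integral_nonneg_AE) auto
  have "transition_prob A u \<le> (\<integral>v. B \<partial>unif01)" unfolding transition_prob_def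
    using c_le order_trans[OF c_nn c_le]
    by (intro integral_mono c_ind_integrable assms) (auto simp: indicator_def)
  then show "transition_prob A u \<le> B" by (simp add: unif01.prob_space)
qed

lemma ennreal_ptrans:
  assumes [measurable]: "A \<in> sets borel"
  shows "ennreal (transition_prob A u) = (\<integral>\<^sup>+v. ennreal (c u v) * indicator A v \<partial>unif01)"
proof -
  have "(\<integral>\<^sup>+v. ennreal (c u v) * indicator A v \<partial>unif01) = (\<integral>\<^sup>+v. ennreal (c u v * indicator A v) \<partial>unif01)"
    by (intro nn_integral_cong) (auto simp: indicator_def)
  also have "\<dots> = ennreal (transition_prob A u)" unfolding transition_prob_def
    by (intro nn_integral_eq_integral c_ind_integrable) (use c_nn in auto)
  finally show ?thesis by simp
qed

text \<open>
  Both sides have the same integrals over events of \<open>\<sigma>(U\<^sub>n)\<close>, by \<open>pair_law\<close>.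
\<close>

lemma cond_exp_marginal:
  assumes A[measurable]: "A \<in> sets borel"
  shows "AE \<omega> in M. real_cond_exp M (vimage_algebra (space M) (U n) borel)
         (\<lambda>\<omega>. indicator A (U (Suc n) \<omega>)) \<omega> = transition_prob A (U n \<omega>)"
proof -
  let ?F = "vimage_algebra (space M) (U n) borel"
  note transition_prob_measurable[OF A, measurable]
  have sub: "subalgebra M ?F"
    by (auto simp: subalgebra_def sets_vimage_algebra2 intro: measurable_sets)
  interpret sigma_finite_subalgebra M ?F
    by (rule finite_measure_subalgebra_is_sigma_finite) (use sub in unfold_locales)
  have i1: "integrable M (\<lambda>\<omega>. indicator A (U (Suc n) \<omega>) :: real)"
    by (rule integrable_const_bound[where B = 1]) auto
  have i2: "integrable M (\<lambda>\<omega>. transition_prob A (U n \<omega>))"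
    by (rule integrable_const_bound[where B = B]) (use transition_prob_bounds[OF A] in auto)
  show ?thesis
  proof (rule real_cond_exp_charact)
    fix D assume "D \<in> sets ?F"
    then obtain S where [measurable]: "S \<in> sets borel" and D: "D = U n -` S \<inter> space M"
      by (auto simp: sets_vimage_algebra2)
    have [measurable]: "D \<in> sets M" unfolding D by measurable
    have "ennreal (\<integral>x\<in>D. indicator A (U (Suc n) x) \<partial>M) = 
      (\<integral>\<^sup>+x. ennreal (indicator D x * indicator A (U (Suc n) x)) \<partial>M)"
      unfolding set_lebesgue_integral_def real_scaleR_def
      by (intro nn_integral_eq_integral[symmetric])
         (auto intro!: integrable_const_bound[where B = 1] simp: indicator_def)
    also have "\<dots> = (\<integral>\<^sup>+x. indicator (S \<times> A) (U n x, U (Suc n) x) \<partial>M)"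
      by (intro nn_integral_cong) (auto simp: indicator_def D)
    also have "\<dots> = (\<integral>\<^sup>+z. indicator (S \<times> A) z \<partial>distr M (borel \<Otimes>\<^sub>M borel) (\<lambda>\<omega>. (U n \<omega>, U (Suc n) \<omega>)))"
      by (subst nn_integral_distr) auto
    also have "\<dots> = (\<integral>\<^sup>+z. ennreal (c (fst z) (snd z)) * indicator (S \<times> A) z \<partial>(unif01 \<Otimes>\<^sub>M unif01))"
      unfolding pair_law by (subst nn_integral_density) (auto simp: split_beta')
    also have "\<dots> = (\<integral>\<^sup>+u. (\<integral>\<^sup>+v. ennreal (c u v) * indicator (S \<times> A) (u, v) \<partial>unif01) \<partial>unif01)"
      by (subst unif01.nn_integral_fst[symmetric]) (auto simp: split_beta')
    also have "\<dots> = (\<integral>\<^sup>+u. indicator S u * ennreal (transition_prob A u) \<partial>unif01)"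
      by (intro nn_integral_cong, rename_tac u, case_tac "u \<in> S") (auto simp: ennreal_ptrans indicator_times)
    also have "\<dots> = (\<integral>\<^sup>+u. indicator S u * ennreal (transition_prob A u) \<partial>distr M borel (U n))"
      by (simp add: chain_distr)
    also have "\<dots> = (\<integral>\<^sup>+x. indicator S (U n x) * ennreal (transition_prob A (U n x)) \<partial>M)"
      by (subst nn_integral_distr) auto
    also have "\<dots> = (\<integral>\<^sup>+x. ennreal (indicator D x * transition_prob A (U n x)) \<partial>M)"
      by (intro nn_integral_cong) (auto simp: indicator_def D)
    also have "\<dots> = ennreal (\<integral>x\<in>D. transition_prob A (U n x) \<partial>M)"
      unfolding set_lebesgue_integral_def real_scaleR_def
      using transition_prob_bounds[OF A] order_trans[OF transition_prob_bounds[OF A]]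
      by (intro nn_integral_eq_integral)
         (auto intro!: integrable_const_bound[where B = B] simp: indicator_def)
    finally show "(\<integral>x\<in>D. indicator A (U (Suc n) x) \<partial>M) = (\<integral>x\<in>D. transition_prob A (U n x) \<partial>M)"
      unfolding set_lebesgue_integral_def
      using transition_prob_bounds[OF A]
      by (subst (asm) ennreal_inj) (auto intro!: integral_nonneg_AE)
  qed (use i1 i2 in \<open>auto intro!: measurable_compose[OF measurable_vimage_algebra1]\<close>)
qed

text \<open>
  The Markov property enters only here: it replaces the conditional law of \<open>U\<^sub>n\<^sub>+\<^sub>1\<close> given the
  present by the one given the whole past, which fixes the joint law on measurable rectangles.
\<close>

lemma sample_pair_law:
  "distr M ((\<Pi>\<^sub>M i\<in>{..n}. borel) \<Otimes>\<^sub>M borel) (\<lambda>\<omega>. (sample U n \<omega>, U (Suc n) \<omega>)) =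
   density (distr M (\<Pi>\<^sub>M i\<in>{..n}. borel) (sample U n) \<Otimes>\<^sub>M unif01) (\<lambda>(x, v). ennreal (c (x n) v))"
  (is "?L = ?R")
proof -
  let ?S = "\<Pi>\<^sub>M i\<in>{..n}. (borel :: real measure)"
  interpret S: prob_space "distr M ?S (sample U n)" by (rule prob_space_distr) measurable
  interpret P: pair_prob_space "distr M ?S (sample U n)" unif01 ..
  interpret L: prob_space ?L by (rule prob_space_distr) measurable
  have rect: "emeasure ?L (D \<times> A) = emeasure ?R (D \<times> A)"
    if [measurable]: "D \<in> sets ?S" "A \<in> sets borel" for D A
  proof -
    let ?F = "vimage_algebra (space M) (sample U n) ?S"
    note transition_prob_measurable[OF that(2), measurable]
    have sub: "subalgebra M ?F"
      by (auto simp: subalgebra_def sets_vimage_algebra2[OF measurable_space[OF sample_measurable, THEN funcsetI]]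
          intro: measurable_sets[OF sample_measurable])
    interpret sigma_finite_subalgebra M ?F
      by (rule finite_measure_subalgebra_is_sigma_finite) (use sub in unfold_locales)
    define E where "E = sample U n -` D \<inter> space M"
    have E: "E \<in> sets ?F" unfolding E_def by (rule in_vimage_algebra) fact
    have [measurable]: "E \<in> sets M" unfolding E_def by measurable
    have n: "sample U n x n = U n x" for x by (simp add: sample_def)
    have i1: "integrable M (\<lambda>\<omega>. indicator A (U (Suc n) \<omega>) :: real)"
      by (rule integrable_const_bound[where B = 1]) auto
    have "AE \<omega> in M. real_cond_exp M ?F (\<lambda>\<omega>. indicator A (U (Suc n) \<omega>)) \<omega> =
       real_cond_exp M (vimage_algebra (space M) (U n) borel)
         (\<lambda>\<omega>. indicator A (U (Suc n) \<omega>)) \<omega>"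
      using chain that(2) unfolding copula_markov_chain_def markov_property_def by blast
    with cond_exp_marginal[OF that(2), of n]
    have AE: "AE \<omega> in M. real_cond_exp M ?F (\<lambda>\<omega>. indicator A (U (Suc n) \<omega>)) \<omega> = transition_prob A (U n \<omega>)"
      by eventually_elim simp
    have "emeasure ?L (D \<times> A) = (\<integral>\<^sup>+z. indicator (D \<times> A) z \<partial>?L)" by simp
    also have "\<dots> = (\<integral>\<^sup>+x. indicator (D \<times> A) (sample U n x, U (Suc n) x) \<partial>M)"
      by (subst nn_integral_distr) auto
    also have "\<dots> = (\<integral>\<^sup>+x. ennreal (indicator E x * indicator A (U (Suc n) x)) \<partial>M)"
      by (intro nn_integral_cong) (auto simp: indicator_def E_def)
    also have "\<dots> = ennreal (\<integral>x\<in>E. indicator A (U (Suc n) x) \<partial>M)"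
      unfolding set_lebesgue_integral_def real_scaleR_def
      by (intro nn_integral_eq_integral)
         (auto intro!: integrable_const_bound[where B = 1] simp: indicator_def)
    also have "(\<integral>x\<in>E. indicator A (U (Suc n) x) \<partial>M) =
       (\<integral>x\<in>E. real_cond_exp M ?F (\<lambda>\<omega>. indicator A (U (Suc n) \<omega>)) x \<partial>M)"
      by (rule real_cond_exp_intA[OF i1 E])
    also have "\<dots> = (\<integral>x\<in>E. transition_prob A (U n x) \<partial>M)"
      unfolding set_lebesgue_integral_def
      by (intro integral_cong_AE) (use AE in auto)
    also have "ennreal \<dots> = (\<integral>\<^sup>+x. ennreal (indicator E x * transition_prob A (U n x)) \<partial>M)"
      unfolding set_lebesgue_integral_def real_scaleR_def
      using transition_prob_bounds[OF that(2)] order_trans[OF transition_prob_bounds[OF that(2)]]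
      by (intro nn_integral_eq_integral[symmetric])
         (auto intro!: integrable_const_bound[where B = B] simp: indicator_def)
    also have "\<dots> = (\<integral>\<^sup>+x. indicator D (sample U n x) * ennreal (transition_prob A (sample U n x n)) \<partial>M)"
      by (intro nn_integral_cong) (auto simp: indicator_def E_def n)
    also have "\<dots> = (\<integral>\<^sup>+x. indicator D x * ennreal (transition_prob A (x n)) \<partial>distr M ?S (sample U n))"
      by (subst nn_integral_distr) auto
    also have "\<dots> = (\<integral>\<^sup>+x. (\<integral>\<^sup>+v. ennreal (c (x n) v) * indicator (D \<times> A) (x, v) \<partial>unif01) \<partial>distr M ?S (sample U n))"
      by (intro nn_integral_cong, rename_tac x, case_tac "x \<in> D") (auto simp: ennreal_ptrans indicator_times)
    also have "\<dots> = (\<integral>\<^sup>+z. ennreal (c (fst z n) (snd z)) * indicator (D \<times> A) z \<partial>(distr M ?S (sample U n) \<Otimes>\<^sub>M unif01))"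
      by (subst unif01.nn_integral_fst[symmetric]) (auto simp: split_beta')
    also have "\<dots> = emeasure ?R (D \<times> A)"
      by (subst emeasure_density) (auto simp: split_beta')
    finally show ?thesis .
  qed
  let ?E = "{a \<times> b | a b. a \<in> sets ?S \<and> b \<in> sets (borel :: real measure)}"
  show ?thesis
  proof (rule measure_eqI_generator_eq[where E = ?E and \<Omega> = "space ?S \<times> UNIV" and A = "\<lambda>_. space ?S \<times> UNIV"])
    show "Int_stable ?E" using Int_stable_pair_measure_generator[of ?S borel] by simp
    show "?E \<subseteq> Pow (space ?S \<times> UNIV)" by (auto dest: sets.sets_into_space)
    show "emeasure ?L X = emeasure ?R X" if "X \<in> ?E" for X using that rect by auto
    show "sets ?L = sigma_sets (space ?S \<times> UNIV) ?E"
      by (simp add: sets_pair_measure)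
    have "sets ?R = sets (?S \<Otimes>\<^sub>M (borel :: real measure))"
      unfolding sets_density by (rule sets_pair_measure_cong) auto
    then show "sets ?R = sigma_sets (space ?S \<times> UNIV) ?E"
      by (simp add: sets_pair_measure)
    have "space ?S \<times> UNIV \<in> ?E" by (intro CollectI exI conjI refl sets.top) auto
    then show "range (\<lambda>_::nat. space ?S \<times> UNIV) \<subseteq> ?E" by blast
    show "(\<Union>i::nat. space ?S \<times> UNIV) = space ?S \<times> (UNIV :: real set)" by simp
    show "emeasure ?L (space ?S \<times> UNIV) \<noteq> \<infinity>" using L.emeasure_finite by simp
  qed
qed

text \<open>
  All later arguments use the chain through this formula, which integrates out the last state and
  so takes the place of conditional expectations. Complex values allow characteristic functions.
\<close>

lemma transition_expectation:
  fixes F :: "(nat \<Rightarrow> real) \<times> real \<Rightarrow> complex"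
  assumes [measurable]: "F \<in> borel_measurable ((\<Pi>\<^sub>M i\<in>{..n}. borel) \<Otimes>\<^sub>M borel)"
    and bd: "\<And>z. norm (F z) \<le> K"
  shows "(\<integral>\<omega>. F (sample U n \<omega>, U (Suc n) \<omega>) \<partial>M) =
         (\<integral>\<omega>. (\<integral>v. c (U n \<omega>) v *\<^sub>R F (sample U n \<omega>, v) \<partial>unif01) \<partial>M)"
proof -
  let ?S = "\<Pi>\<^sub>M i\<in>{..n}. (borel :: real measure)"
  interpret S: prob_space "distr M ?S (sample U n)" by (rule prob_space_distr) measurable
  interpret P: pair_prob_space "distr M ?S (sample U n)" unif01 ..
  have n: "sample U n x n = U n x" for x by (simp add: sample_def)
  have m: "(\<lambda>z. c (fst z n) (snd z) *\<^sub>R F z) \<in> borel_measurable (distr M ?S (sample U n) \<Otimes>\<^sub>M unif01)"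
    by measurable
  have "(\<integral>\<omega>. F (sample U n \<omega>, U (Suc n) \<omega>) \<partial>M) =
     (\<integral>z. F z \<partial>distr M (?S \<Otimes>\<^sub>M borel) (\<lambda>\<omega>. (sample U n \<omega>, U (Suc n) \<omega>)))"
    by (subst integral_distr) auto
  also have "\<dots> = (\<integral>z. c (fst z n) (snd z) *\<^sub>R F z \<partial>(distr M ?S (sample U n) \<Otimes>\<^sub>M unif01))"
    unfolding sample_pair_law split_beta'
    by (subst integral_density) (use c_nn in auto)
  also have "\<dots> = (\<integral>x. (\<integral>v. c (x n) v *\<^sub>R F (x, v) \<partial>unif01) \<partial>distr M ?S (sample U n))"
  proof (subst P.integral_fst'[symmetric])
    show "integrable (distr M ?S (sample U n) \<Otimes>\<^sub>M unif01) (\<lambda>z. c (fst z n) (snd z) *\<^sub>R F z)"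
    proof (rule P.P.integrable_const_bound[where B = "B * K"])
      show "AE z in distr M ?S (sample U n) \<Otimes>\<^sub>M unif01. norm (c (fst z n) (snd z) *\<^sub>R F z) \<le> B * K"
        using c_nn c_le bd order_trans[OF c_nn c_le] by (auto intro!: mult_mono)
    qed (use m in simp)
  qed simp
  also have "\<dots> = (\<integral>\<omega>. (\<integral>v. c (sample U n \<omega> n) v *\<^sub>R F (sample U n \<omega>, v) \<partial>unif01) \<partial>M)"
    by (subst integral_distr) auto
  finally show ?thesis by (simp add: n)
qed

end

section \<open>Densities of finite rank and Poisson's equation\<close>

lemma integrable_unif01:
  fixes h :: "real \<Rightarrow> 'b::{banach, second_countable_topology}"
  assumes [measurable]: "h \<in> borel_measurable borel" and "\<And>u. norm (h u) \<le> K"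
  shows "integrable unif01 h"
  using assms(2) assms(1)[unfolded measurable_cong_sets[of borel unif01 borel borel, simplified]]
  by (intro unif01.integrable_const_bound[where B = K]) auto

text \<open>
  The bound on \<open>f k\<close> is required on the whole line, so that features and densities are bounded
  everywhere and no exceptional sets have to be carried along.
\<close>

locale orthonormal_family =
  fixes f :: "'s::finite \<Rightarrow> real \<Rightarrow> real" and b :: "'s \<Rightarrow> real"
  assumes f_meas[measurable]: "\<And>k. f k \<in> borel_measurable borel"
    and f_bound: "\<And>k u. (f k u)\<^sup>2 \<le> b k"
    and f_mean: "\<And>k. (\<integral>u. f k u \<partial>unif01) = 0"
    and f_orth: "\<And>k j. (\<integral>u. f k u * f j u \<partial>unif01) = (if k = j then 1 else 0)"
begin

definition feature :: "real \<Rightarrow> real \<Rightarrow> real^'s" where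
  "feature u v = (\<chi> k. f k u * f k v)"

definition dens :: "real^'s \<Rightarrow> real \<Rightarrow> real \<Rightarrow> real" where
  "dens L u v = 1 + L \<bullet> feature u v"

text \<open>
  The norm in which the parameter region is the closed unit ball.
\<close>

definition weight :: "real^'s \<Rightarrow> real" where
  "weight L = (\<Sum>k\<in>UNIV. b k * \<bar>L $ k\<bar>)"

lemma f_abs: "\<bar>f k u\<bar> \<le> sqrt (b k)"
  by (metis f_bound real_sqrt_abs real_sqrt_le_mono)

text \<open>
  The square of \<open>f k\<close> has mean one and so cannot stay below one.
\<close>

lemma b_ge_1: "1 \<le> b k"
proof -
  have "1 = (\<integral>u. (f k u)\<^sup>2 \<partial>unif01)" using f_orth[of k k] by (simp add: power2_eq_square)
  also have "\<dots> \<le> (\<integral>u. b k \<partial>unif01)"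
    by (intro integral_mono integrable_unif01[where K = "b k"])
       (use f_bound in \<open>auto intro: order_trans[OF zero_le_power2]\<close>)
  finally show ?thesis by (simp add: unif01.prob_space)
qed

lemma feature_bound: "\<bar>feature u v $ k\<bar> \<le> b k"
proof -
  have "\<bar>f k u\<bar> * \<bar>f k v\<bar> \<le> sqrt (b k) * sqrt (b k)"
    using f_abs[of k] b_ge_1[of k] by (intro mult_mono) auto
  then show ?thesis using b_ge_1[of k] by (simp add: feature_def abs_mult)
qed

definition \<beta> :: real where "\<beta> = (\<Sum>k\<in>UNIV. b k)"

lemma \<beta>_ge_1: "1 \<le> \<beta>"
proof -
  have "b undefined \<le> \<beta>" unfolding \<beta>_def
    by (rule member_le_sum) (auto intro: order_trans[OF _ b_ge_1])
  then show ?thesis using b_ge_1 by (rule order_trans[rotated])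
qed

lemma norm_feature: "norm (feature u v) \<le> \<beta>"
  unfolding \<beta>_def by (rule order_trans[OF norm_le_l1_cart sum_mono]) (rule feature_bound)

lemma inner_feature_bound: "\<bar>L \<bullet> feature u v\<bar> \<le> weight L"
proof -
  have "\<bar>L \<bullet> feature u v\<bar> \<le> (\<Sum>k\<in>UNIV. \<bar>L $ k * feature u v $ k\<bar>)"
    by (simp add: inner_vec_def sum_abs)
  also have "\<dots> \<le> weight L" unfolding weight_def abs_mult
    by (intro sum_mono) (subst mult.commute, intro mult_right_mono feature_bound, simp)
  finally show ?thesis .
qed

lemma dens_ge: "1 - weight L \<le> dens L u v" and dens_le: "dens L u v \<le> 1 + weight L"
  using inner_feature_bound[of L u v] by (auto simp: dens_def)

lemma feature_measurable[measurable (raw)]: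
  assumes [measurable]: "g \<in> borel_measurable N" "h \<in> borel_measurable N"
  shows "(\<lambda>x. feature (g x) (h x)) \<in> borel_measurable N"
proof -
  have "(\<lambda>x. \<chi> k. f k (g x) * f k (h x)) \<in> borel_measurable N"
    unfolding borel_measurable_euclidean_space[where 'c = "real^'s"]
    by (auto simp: Basis_vec_def inner_axis)
  then show ?thesis by (simp add: feature_def)
qed

lemma dens_measurable[measurable (raw)]:
  assumes [measurable]: "l \<in> borel_measurable N" "g \<in> borel_measurable N" "h \<in> borel_measurable N"
  shows "(\<lambda>x. dens (l x) (g x) (h x)) \<in> borel_measurable N"
  unfolding dens_def by measurable

text \<open>
  The operator with kernel \<open>dens L\<close> acts as expectation plus the diagonal operator that multiplies
  the coefficient along \<open>f k\<close> by \<open>L $ k\<close>.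
\<close>

lemma dens_apply:
  fixes h :: "real \<Rightarrow> real"
  assumes [measurable]: "h \<in> borel_measurable borel" and bd: "\<And>v. \<bar>h v\<bar> \<le> K"
  shows "(\<integral>v. dens L u v * h v \<partial>unif01) =
    (\<integral>v. h v \<partial>unif01) + (\<Sum>k\<in>UNIV. L $ k * f k u * (\<integral>v. f k v * h v \<partial>unif01))"
proof -
  have K: "0 \<le> K" using bd[of 0] by linarith
  have i: "integrable unif01 (\<lambda>v. f k v * h v)" for k
  proof (rule integrable_unif01[where K = "sqrt (b k) * K"])
    fix v show "norm (f k v * h v) \<le> sqrt (b k) * K"
      unfolding real_norm_def abs_mult using f_abs bd K b_ge_1[of k] by (intro mult_mono) auto
  qed measurable
  have ih: "integrable unif01 h" by (rule integrable_unif01[where K = K]) (use bd in auto)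
  have "(\<integral>v. dens L u v * h v \<partial>unif01) =
      (\<integral>v. h v + (\<Sum>k\<in>UNIV. L $ k * f k u * (f k v * h v)) \<partial>unif01)"
    by (intro Bochner_Integration.integral_cong)
       (auto simp: dens_def feature_def inner_vec_def algebra_simps sum_distrib_right sum_distrib_left)
  also have "\<dots> = (\<integral>v. h v \<partial>unif01) + (\<Sum>k\<in>UNIV. L $ k * f k u * (\<integral>v. f k v * h v \<partial>unif01))"
    using i ih by (subst Bochner_Integration.integral_add) auto
  finally show ?thesis .
qed

lemma dens_integral: "(\<integral>v. dens L u v \<partial>unif01) = 1"
  using dens_apply[of "\<lambda>_. 1" 1 L u] by (simp add: f_mean unif01.prob_space)

lemma dens_integral_const: "(\<integral>v. dens L u v * a \<partial>unif01) = a"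
  by (simp add: dens_integral)

lemma dens_f: "(\<integral>v. dens L u v * f k v \<partial>unif01) = L $ k * f k u"
proof -
  have "(\<integral>v. dens L u v * f k v \<partial>unif01) = (\<Sum>j\<in>UNIV. L $ j * f j u * (if j = k then 1 else 0))"
    using dens_apply[of "f k" "sqrt (b k)" L u] f_abs by (simp add: f_mean f_orth)
  then show ?thesis by (simp add: if_distrib sum.delta cong: if_cong)
qed

end

lemma exp_taylor2:
  fixes z :: complex
  shows "norm (exp z - (1 + z + z\<^sup>2/2)) \<le> exp (norm z) * norm z ^ 3 / 2"
  using Taylor_exp_field[of z 2] by (simp add: numeral_2_eq_2 numeral_3_eq_3)

text \<open>
  One step of the martingale sum: \<open>D\<close> is the increment, \<open>x = 1/\<surd>n\<close> its normalization, \<open>s\<close> the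
  limiting variance and \<open>1 - g x\<^sup>2/2\<close> the corrector. The corrector absorbs the telescoping part \<open>g - g'\<close> of \<open>D\<^sup>2 - s\<close>,
  so that up to third order only the martingale terms \<open>D\<close> and \<open>m\<close> remain.
\<close>

lemma one_step_expansion:
  fixes K :: real
  assumes K: "0 \<le> K"
  obtains C where "0 \<le> C"
    "\<And>D g g' m s x :: real. \<lbrakk>\<bar>D\<bar> \<le> K; \<bar>g\<bar> \<le> K; \<bar>g'\<bar> \<le> K; 0 \<le> s; s \<le> K; D\<^sup>2 - s = m + g - g'; 0 \<le> x; x \<le> 1\<rbrakk>
     \<Longrightarrow> norm (exp (of_real (s * x\<^sup>2 / 2) + \<i> * of_real (D * x)) * (1 - of_real (g' * x\<^sup>2 / 2)) -
            (1 - of_real (g * x\<^sup>2 / 2)) - \<i> * of_real (D * x) + of_real (m * x\<^sup>2 / 2)) \<le> C * x ^ 3"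
proof
  define C1 where "C1 = exp (2*K) * (2*K)^3 / 2 + K\<^sup>2 / 2 + K\<^sup>2 / 8"
  define C where "C = C1 * (1 + K) + K\<^sup>2 / 2 + (K + K\<^sup>2) * K / 4"
  have C1: "0 \<le> C1" unfolding C1_def using K by auto
  show "0 \<le> C" unfolding C_def using C1 K by (intro add_nonneg_nonneg mult_nonneg_nonneg) auto
  fix D g g' m s x :: real
  assume D: "\<bar>D\<bar> \<le> K" and g: "\<bar>g\<bar> \<le> K" "\<bar>g'\<bar> \<le> K" and s: "0 \<le> s" "s \<le> K"
    and eq: "D\<^sup>2 - s = m + g - g'" and x: "0 \<le> x" "x \<le> 1"
  define z where "z = complex_of_real (s * x\<^sup>2 / 2) + \<i> * of_real (D * x)"
  define A where "A = exp z - (1 + \<i> * of_real (D * x) + of_real ((s - D\<^sup>2) * x\<^sup>2 / 2))"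
  have x2: "x\<^sup>2 \<le> x" "x^4 \<le> x^3" using x by (auto simp: power2_eq_square mult_left_le power_decreasing)
  have x3: "0 \<le> x^3" using x by simp
  have x21: "x\<^sup>2 \<le> 1" using x x2 by linarith
  have nz: "norm z \<le> 2 * K * x"
  proof -
    have "norm z \<le> \<bar>s * x\<^sup>2 / 2\<bar> + \<bar>D * x\<bar>"
      unfolding z_def by (rule order_trans[OF norm_triangle_ineq]) (simp only: norm_of_real norm_mult norm_ii mult_1 order_refl)
    also have "\<bar>s * x\<^sup>2 / 2\<bar> \<le> K * x"
    proof -
      have "s * x\<^sup>2 \<le> K * x" by (rule mult_mono) (use s K x2 in auto)
      moreover have "0 \<le> s * x\<^sup>2" using s by simp
      ultimately show ?thesis by linarith
    qed
    also have "\<bar>D * x\<bar> \<le> K * x" using mult_right_mono[OF D x(1)] x by (simp add: abs_mult)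
    finally show ?thesis by simp
  qed
  have r: "norm (exp z - (1 + z + z\<^sup>2/2)) \<le> exp (2*K) * (2*K)^3 / 2 * x^3"
  proof -
    have "norm (exp z - (1 + z + z\<^sup>2/2)) \<le> exp (norm z) * norm z ^ 3 / 2" by (rule exp_taylor2)
    also have "\<dots> \<le> exp (2 * K) * (2 * K * x)^3 / 2"
      using nz x K mult_left_mono[OF x(2), of "2 * K"]
      by (intro divide_right_mono mult_mono power_mono) auto
    finally show ?thesis by (simp add: power_mult_distrib mult_ac)
  qed
  have "A = (exp z - (1 + z + z\<^sup>2/2)) + (\<i> * of_real (s * D * x^3 / 2) + of_real (s\<^sup>2 * x^4 / 8))"
    unfolding A_def z_def by (simp add: field_simps power2_eq_square power3_eq_cube power4_eq_xxxx)
  then have "norm A \<le> exp (2*K) * (2*K)^3 / 2 * x^3 + (\<bar>s * D * x^3 / 2\<bar> + \<bar>s\<^sup>2 * x^4 / 8\<bar>)"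
    using r by (auto simp only: intro!: order_trans[OF norm_triangle_ineq] add_mono)
       (simp_all only: norm_of_real norm_mult norm_ii mult_1 order_refl)
  also have "\<bar>s * D * x^3 / 2\<bar> \<le> K\<^sup>2 / 2 * x^3"
    using mult_mono[of s K "\<bar>D\<bar>" K] D s K x3 by (auto simp: abs_mult power2_eq_square intro: mult_right_mono)
  also have "\<bar>s\<^sup>2 * x^4 / 8\<bar> \<le> K\<^sup>2 / 8 * x^3"
    using mult_mono[of "s\<^sup>2" "K\<^sup>2" "x^4" "x^3"] s K x x2 by (auto simp: abs_mult power_mono)
  finally have A: "norm A \<le> C1 * x^3" by (simp add: C1_def algebra_simps)
  have "exp z * (1 - of_real (g' * x\<^sup>2 / 2)) -
      (1 - of_real (g * x\<^sup>2 / 2)) - \<i> * of_real (D * x) + of_real (m * x\<^sup>2 / 2) =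
     A * (1 - of_real (g' * x\<^sup>2 / 2)) - \<i> * of_real (D * g' * x^3 / 2) - of_real ((s - D\<^sup>2) * g' * x^4 / 4)
     + of_real (((s - D\<^sup>2) - g' + g + m) * x\<^sup>2 / 2)"
    unfolding A_def by (simp add: field_simps power2_eq_square power3_eq_cube power4_eq_xxxx)
  moreover have "(s - D\<^sup>2) - g' + g + m = 0" using eq by simp
  ultimately have "norm (exp z * (1 - of_real (g' * x\<^sup>2 / 2)) -
      (1 - of_real (g * x\<^sup>2 / 2)) - \<i> * of_real (D * x) + of_real (m * x\<^sup>2 / 2)) =
      norm (A * (1 - of_real (g' * x\<^sup>2 / 2)) - \<i> * of_real (D * g' * x^3 / 2) - of_real ((s - D\<^sup>2) * g' * x^4 / 4))"
    by simp
  also have "\<dots> \<le> norm A * norm (1 - complex_of_real (g' * x\<^sup>2 / 2)) + \<bar>D * g' * x^3 / 2\<bar> + \<bar>(s - D\<^sup>2) * g' * x^4 / 4\<bar>"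
    by (rule order_trans[OF norm_triangle_ineq4] order_trans[OF norm_triangle_ineq4] add_mono)+
       (simp_all only: norm_of_real norm_mult norm_ii mult_1 order_refl)
  also have "norm A * norm (1 - complex_of_real (g' * x\<^sup>2 / 2)) \<le> (C1 * x^3) * (1 + K)"
  proof (intro mult_mono A)
    have "norm (1 - complex_of_real (g' * x\<^sup>2 / 2)) \<le> 1 + \<bar>g' * x\<^sup>2 / 2\<bar>"
      by (rule order_trans[OF norm_triangle_ineq4]) (simp only: norm_of_real norm_one order_refl)
    also have "\<bar>g' * x\<^sup>2 / 2\<bar> \<le> K"
      using mult_mono[of "\<bar>g'\<bar>" K "x\<^sup>2" 1] g K x21 by (auto simp: abs_mult)
    finally show "norm (1 - complex_of_real (g' * x\<^sup>2 / 2)) \<le> 1 + K" by simp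
  qed (use C1 x in auto)
  also have "\<bar>D * g' * x^3 / 2\<bar> \<le> K\<^sup>2 / 2 * x^3"
    using mult_mono[of "\<bar>D\<bar>" K "\<bar>g'\<bar>" K] D g K x3 by (auto simp: abs_mult power2_eq_square intro: mult_right_mono)
  also have "\<bar>(s - D\<^sup>2) * g' * x^4 / 4\<bar> \<le> (K + K\<^sup>2) * K / 4 * x^3"
  proof -
    have "D\<^sup>2 \<le> K\<^sup>2" using D K by (simp add: abs_le_square_iff[symmetric])
    then have "\<bar>s - D\<^sup>2\<bar> \<le> K + K\<^sup>2" using s by (smt (verit) zero_le_power2)
    then have "\<bar>s - D\<^sup>2\<bar> * \<bar>g'\<bar> * x^4 \<le> (K + K\<^sup>2) * K * x^3"
      using g K x x2 by (intro mult_mono) auto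
    then show ?thesis using x by (simp add: abs_mult)
  qed
  finally show "norm (exp (of_real (s * x\<^sup>2 / 2) + \<i> * of_real (D * x)) * (1 - of_real (g' * x\<^sup>2 / 2)) -
            (1 - of_real (g * x\<^sup>2 / 2)) - \<i> * of_real (D * x) + of_real (m * x\<^sup>2 / 2)) \<le> C * x ^ 3"
    unfolding z_def C_def by (simp add: algebra_simps)
qed

text \<open>
  A chain that starts from the uniform law and moves by the kernel \<open>dens L\<close>, for an interior
  parameter.
\<close>

locale finite_rank_chain = orthonormal_family f b + prob_space M
  for f :: "'s::finite \<Rightarrow> real \<Rightarrow> real" and b :: "'s \<Rightarrow> real" and M :: "'w measure" +
  fixes U :: "nat \<Rightarrow> 'w \<Rightarrow> real" and L :: "real^'s"
  assumes U_meas[measurable]: "\<And>i. U i \<in> borel_measurable M"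
    and U_distr: "\<And>i. distr M borel (U i) = unif01"
    and L_interior: "weight L < 1"
    and transition: "\<And>F n K. \<lbrakk>F \<in> borel_measurable ((\<Pi>\<^sub>M i\<in>{..n}. borel) \<Otimes>\<^sub>M borel);
          \<And>z. norm (F z :: complex) \<le> K\<rbrakk> \<Longrightarrow>
         (\<integral>\<omega>. F (sample U n \<omega>, U (Suc n) \<omega>) \<partial>M) =
         (\<integral>\<omega>. (\<integral>v. dens L (U n \<omega>) v *\<^sub>R F (sample U n \<omega>, v) \<partial>unif01) \<partial>M)"
begin

lemma sample_meas[measurable]: "sample U n \<in> measurable M (\<Pi>\<^sub>M i\<in>{..n}. borel)"
  unfolding sample_def by measurable

definition \<delta> :: real where "\<delta> = 1 - weight L"

lemma \<delta>_pos: "0 < \<delta>" using L_interior by (simp add: \<delta>_def)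

lemma dens_L_ge: "\<delta> \<le> dens L u v" using dens_ge by (simp add: \<delta>_def)
lemma dens_L_pos: "0 < dens L u v" using dens_L_ge \<delta>_pos by (rule less_le_trans[rotated])
lemma dens_L_le: "dens L u v \<le> 2" using dens_le[of L u v] L_interior by linarith

lemma dens_L_integrable:
  fixes h :: "real \<Rightarrow> real"
  assumes [measurable]: "h \<in> borel_measurable borel" and bd: "\<And>v. \<bar>h v\<bar> \<le> K"
  shows "integrable unif01 (\<lambda>v. dens L u v * h v)"
proof (rule integrable_unif01[where K = "2 * K"])
  fix v show "norm (dens L u v * h v) \<le> 2 * K"
    unfolding real_norm_def abs_mult using dens_L_le[of u v] dens_L_pos[of u v] bd by (intro mult_mono) auto
qed measurable

lemma L_lt_1: "\<bar>L $ k\<bar> < 1"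
proof -
  have "\<bar>L $ k\<bar> \<le> b k * \<bar>L $ k\<bar>" using mult_right_mono[OF b_ge_1[of k], of "\<bar>L $ k\<bar>"] by simp
  also have "\<dots> \<le> weight L" unfolding weight_def
    by (rule member_le_sum) (auto intro: mult_nonneg_nonneg order_trans[OF zero_le_one b_ge_1])
  finally show ?thesis using L_interior by simp
qed

text \<open>
  The mean of \<open>k(U\<^sub>0, U\<^sub>1)\<close>; see \<open>expectation_pair\<close>.
\<close>

definition dens_mean :: "(real \<Rightarrow> real \<Rightarrow> real) \<Rightarrow> real" where
  "dens_mean k = (\<integral>u. (\<integral>v. dens L u v * k u v \<partial>unif01) \<partial>unif01)"

text \<open>
  With \<open>p\<close> the conditional mean of \<open>k\<close> given the first state, the function
  \<open>g = p + \<Sum>\<^sub>j L\<^sub>j/(1 - L\<^sub>j) \<langle>p, f\<^sub>j\<rangle> f\<^sub>j\<close> solves Poisson's equation: subtracting its image under the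
  transition operator leaves \<open>p\<close> minus its mean, because the operator is diagonal in the \<open>f\<^sub>j\<close>.
\<close>

lemma poisson_decomposition:
  fixes k :: "real \<Rightarrow> real \<Rightarrow> real"
  assumes k[measurable]: "(\<lambda>(u, v). k u v) \<in> borel_measurable (borel \<Otimes>\<^sub>M borel)" and bd: "\<And>u v. \<bar>k u v\<bar> \<le> K"
  obtains m g K' where
    "(\<lambda>(u, v). m u v) \<in> borel_measurable (borel \<Otimes>\<^sub>M borel)" "g \<in> borel_measurable borel"
    "\<And>u v. \<bar>m u v\<bar> \<le> K'" "\<And>u. \<bar>g u\<bar> \<le> K'"
    "\<And>u. (\<integral>v. dens L u v * m u v \<partial>unif01) = 0"
    "\<And>u v. k u v - dens_mean k = m u v + g u - g v"
proof -
  have K: "0 \<le> K" using bd[of 0 0] by linarith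
  have [measurable]: "k u \<in> borel_measurable borel" for u
    using measurable_Pair2[OF k, of u] by simp
  define p where "p u = (\<integral>v. dens L u v * k u v \<partial>unif01)" for u
  have p_meas[measurable]: "p \<in> borel_measurable borel" unfolding p_def
    by measurable
  have p_bd: "\<bar>p u\<bar> \<le> 2 * K" for u
  proof -
    have "\<bar>p u\<bar> \<le> (\<integral>v. \<bar>dens L u v * k u v\<bar> \<partial>unif01)" unfolding p_def by (rule integral_abs_bound)
    also have "\<dots> \<le> (\<integral>v. 2 * K \<partial>unif01)"
    proof (rule integral_mono)
      show "integrable unif01 (\<lambda>v. \<bar>dens L u v * k u v\<bar>)"
        by (intro Bochner_Integration.integrable_abs dens_L_integrable) (use bd in auto)
      show "\<bar>dens L u v * k u v\<bar> \<le> 2 * K" for v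
        unfolding abs_mult using dens_L_le[of u v] dens_L_pos[of u v] bd by (intro mult_mono) auto
    qed simp
    finally show ?thesis by (simp add: unif01.prob_space)
  qed
  define a where "a j = (\<integral>v. f j v * p v \<partial>unif01)" for j
  \<comment> \<open>The series over the powers of the transition operator is geometric in each direction \<open>f j\<close>.\<close>
  define r where "r j = a j * L $ j / (1 - L $ j)" for j
  define g where "g u = p u + (\<Sum>j\<in>UNIV. r j * f j u)" for u
  define m where "m u v = k u v - dens_mean k - g u + g v" for u v
  define G where "G = 2 * K + (\<Sum>j\<in>UNIV. \<bar>r j\<bar> * sqrt (b j))"
  have g_meas[measurable]: "g \<in> borel_measurable borel" unfolding g_def by measurable
  have g_bd: "\<bar>g u\<bar> \<le> G" for u
    unfolding g_def G_def
    by (intro order_trans[OF abs_triangle_ineq] add_mono p_bd order_trans[OF sum_abs] sum_mono)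
       (auto simp: abs_mult intro!: mult_left_mono f_abs)
  have pi: "(\<integral>v. p v \<partial>unif01) = dens_mean k" by (simp add: dens_mean_def p_def)
  have Pg: "(\<integral>v. dens L u v * g v \<partial>unif01) = dens_mean k + g u - p u" for u
  proof -
    have "(\<integral>v. dens L u v * g v \<partial>unif01) =
       (\<integral>v. dens L u v * p v + (\<Sum>j\<in>UNIV. r j * (dens L u v * f j v)) \<partial>unif01)"
      by (intro Bochner_Integration.integral_cong) (auto simp: g_def algebra_simps sum_distrib_left)
    also have "\<dots> = (\<integral>v. dens L u v * p v \<partial>unif01) + (\<Sum>j\<in>UNIV. r j * (L $ j * f j u))"
    proof -
      have "integrable unif01 (\<lambda>v. dens L u v * f j v)" for j
        by (intro dens_L_integrable[OF _ f_abs]) measurable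
      moreover have "integrable unif01 (\<lambda>v. dens L u v * p v)"
        by (intro dens_L_integrable[OF _ p_bd]) measurable
      ultimately show ?thesis
        by (simp add: dens_f)
    qed
    also have "(\<integral>v. dens L u v * p v \<partial>unif01) = dens_mean k + (\<Sum>j\<in>UNIV. L $ j * f j u * a j)"
      by (subst dens_apply[OF p_meas p_bd]) (simp add: pi a_def)
    also have "dens_mean k + (\<Sum>j\<in>UNIV. L $ j * f j u * a j) + (\<Sum>j\<in>UNIV. r j * (L $ j * f j u)) =
        dens_mean k + (\<Sum>j\<in>UNIV. r j * f j u)"
    proof -
      have "L $ j * f j u * a j + r j * (L $ j * f j u) = r j * f j u" for j
        using L_lt_1[of j] by (simp add: r_def field_simps)
      then show ?thesis by (simp add: sum.distrib[symmetric])
    qed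
    finally show ?thesis by (simp add: g_def)
  qed
  have Pm: "(\<integral>v. dens L u v * m u v \<partial>unif01) = 0" for u
  proof -
    have "(\<integral>v. dens L u v * m u v \<partial>unif01) = (\<integral>v. dens L u v * k u v - dens L u v * (dens_mean k + g u) + dens L u v * g v \<partial>unif01)"
      by (intro Bochner_Integration.integral_cong) (auto simp: m_def algebra_simps)
    also have "\<dots> = p u - (dens_mean k + g u) + (dens_mean k + g u - p u)"
    proof -
      have "integrable unif01 (\<lambda>v. dens L u v * k u v)" by (intro dens_L_integrable[OF _ bd]) measurable
      moreover have "integrable unif01 (\<lambda>v. dens L u v * (dens_mean k + g u))"
        by (rule dens_L_integrable[OF _ order_refl]) measurable
      moreover have "integrable unif01 (\<lambda>v. dens L u v * g v)" by (intro dens_L_integrable[OF _ g_bd]) measurable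
      ultimately show ?thesis
        by (simp only: Bochner_Integration.integral_add Bochner_Integration.integral_diff
            Bochner_Integration.integrable_diff dens_integral_const Pg p_def[symmetric])
    qed
    finally show ?thesis by simp
  qed
  define K' where "K' = K + \<bar>dens_mean k\<bar> + G + G"
  have G: "0 \<le> G" using g_bd[of 0] by linarith
  show ?thesis
  proof
    show "(\<lambda>(u, v). m u v) \<in> borel_measurable (borel \<Otimes>\<^sub>M borel)"
      using k unfolding m_def split_beta' by measurable
    show "\<bar>m u v\<bar> \<le> K'" for u v
      using bd[of u v] g_bd[of u] g_bd[of v] unfolding m_def K'_def by linarith
    show "\<bar>g u\<bar> \<le> K'" for u
      using K G g_bd[of u] unfolding K'_def by linarith
    show "g \<in> borel_measurable borel" by (rule g_meas)
    show "(\<integral>v. dens L u v * m u v \<partial>unif01) = 0" for u by (rule Pm)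
    show "k u v - dens_mean k = m u v + g u - g v" for u v by (simp add: m_def)
  qed
qed

lemma martingale_difference:
  fixes H :: "(nat \<Rightarrow> real) \<Rightarrow> complex"
  assumes [measurable]: "H \<in> borel_measurable (\<Pi>\<^sub>M i\<in>{..n}. borel)" and H: "\<And>x. norm (H x) \<le> K"
    and m[measurable]: "(\<lambda>(u, v). m u v) \<in> borel_measurable (borel \<Otimes>\<^sub>M borel)" and bd: "\<And>u v. \<bar>m u v\<bar> \<le> K'"
    and z: "\<And>u. (\<integral>v. dens L u v * m u v \<partial>unif01) = 0"
  shows "(\<integral>\<omega>. H (sample U n \<omega>) * of_real (m (U n \<omega>) (U (Suc n) \<omega>)) \<partial>M) = 0"
proof -
  have mm: "(\<lambda>z. m (fst z n) (snd z)) \<in> borel_measurable ((\<Pi>\<^sub>M i\<in>{..n}. borel) \<Otimes>\<^sub>M (borel :: real measure))"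
  proof -
    have "(\<lambda>z. (fst z n, snd z)) \<in> measurable ((\<Pi>\<^sub>M i\<in>{..n}. borel) \<Otimes>\<^sub>M (borel :: real measure)) (borel \<Otimes>\<^sub>M (borel :: real measure))"
      by measurable
    from measurable_compose[OF this m] show ?thesis by simp
  qed
  define F where "F = (\<lambda>z :: (nat \<Rightarrow> real) \<times> real. H (fst z) * of_real (m (fst z n) (snd z)))"
  have [measurable]: "F \<in> borel_measurable ((\<Pi>\<^sub>M i\<in>{..n}. borel) \<Otimes>\<^sub>M borel)"
    unfolding F_def using mm by measurable
  have bF: "norm (F z) \<le> K * K'" for z
    unfolding F_def norm_mult norm_of_real using H[of "fst z"] bd[of "fst z n" "snd z"]
    by (intro mult_mono) (auto intro: order_trans[OF norm_ge_zero])
  have n: "sample U n x n = U n x" for x by (simp add: sample_def)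
  have mu: "m u \<in> borel_measurable borel" for u using measurable_Pair2[OF m, of u] by simp
  have in0: "(\<integral>v. dens L (U n \<omega>) v *\<^sub>R F (sample U n \<omega>, v) \<partial>unif01) = 0" for \<omega>
  proof -
    have "(\<integral>v. dens L (U n \<omega>) v *\<^sub>R F (sample U n \<omega>, v) \<partial>unif01) =
       (\<integral>v. H (sample U n \<omega>) * of_real (dens L (U n \<omega>) v * m (U n \<omega>) v) \<partial>unif01)"
      by (intro Bochner_Integration.integral_cong) (auto simp: F_def n scaleR_conv_of_real)
    also have "\<dots> = H (sample U n \<omega>) * of_real (\<integral>v. dens L (U n \<omega>) v * m (U n \<omega>) v \<partial>unif01)"
      by (simp only: integral_mult_right_zero integral_complex_of_real)
    finally show ?thesis by (simp add: z)
  qed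
  have "(\<integral>\<omega>. H (sample U n \<omega>) * of_real (m (U n \<omega>) (U (Suc n) \<omega>)) \<partial>M) =
      (\<integral>\<omega>. F (sample U n \<omega>, U (Suc n) \<omega>) \<partial>M)"
    by (simp add: F_def n)
  also have "\<dots> = 0" by (subst transition[OF _ bF]) (use in0 in auto)
  finally show ?thesis .
qed

section \<open>Mean square bounds and the law of large numbers\<close>

definition path_sum :: "(real \<Rightarrow> real \<Rightarrow> real) \<Rightarrow> nat \<Rightarrow> (nat \<Rightarrow> real) \<Rightarrow> real" where
  "path_sum d n x = (\<Sum>i<n. d (x i) (x (Suc i)))"

lemma path_sum_measurable:
  assumes d: "(\<lambda>(u, v). d u v) \<in> borel_measurable (borel \<Otimes>\<^sub>M borel)" and "j \<le> n"
  shows "path_sum d j \<in> borel_measurable (\<Pi>\<^sub>M i\<in>{..n}. borel)"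
proof -
  have "(\<lambda>x. d (x i) (x (Suc i))) \<in> borel_measurable (\<Pi>\<^sub>M i\<in>{..n}. borel)" if "i < j" for i
  proof -
    have "(\<lambda>x. (x i, x (Suc i))) \<in> measurable (\<Pi>\<^sub>M i\<in>{..n}. borel) (borel \<Otimes>\<^sub>M (borel :: real measure))"
      using that \<open>j \<le> n\<close> by (intro measurable_Pair measurable_component_singleton) auto
    from measurable_compose[OF this d] show ?thesis by simp
  qed
  then show ?thesis unfolding path_sum_def by (intro borel_measurable_sum) auto
qed

lemma path_sum_sample: "j \<le> n \<Longrightarrow> path_sum d j (sample U n \<omega>) = (\<Sum>i<j. d (U i \<omega>) (U (Suc i) \<omega>))"
  by (simp add: path_sum_def sample_def)

lemma pair_fun_measurable:
  assumes d: "(\<lambda>(u, v). d u v) \<in> borel_measurable (borel \<Otimes>\<^sub>M borel)"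
  shows "(\<lambda>\<omega>. d (U i \<omega>) (U j \<omega>)) \<in> borel_measurable M"
  using measurable_compose[OF _ d, of "\<lambda>\<omega>. (U i \<omega>, U j \<omega>)" M] by simp

text \<open>
  Martingale differences are uncorrelated, so their second moments add up.
\<close>

lemma martingale_second_moment:
  assumes m: "(\<lambda>(u, v). m u v) \<in> borel_measurable (borel \<Otimes>\<^sub>M borel)" and bd: "\<And>u v. \<bar>m u v\<bar> \<le> K"
    and z: "\<And>u. (\<integral>v. dens L u v * m u v \<partial>unif01) = 0"
  shows "(\<integral>\<omega>. (\<Sum>i<n. m (U i \<omega>) (U (Suc i) \<omega>))\<^sup>2 \<partial>M) \<le> real n * (K :: real)\<^sup>2"
proof (induction n)
  case (Suc n)
  have K: "0 \<le> K" using bd[of 0 0] by linarith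
  note [measurable] = pair_fun_measurable[OF m]
  define S where "S \<omega> = (\<Sum>i<n. m (U i \<omega>) (U (Suc i) \<omega>))" for \<omega>
  define D where "D \<omega> = m (U n \<omega>) (U (Suc n) \<omega>)" for \<omega>
  have [measurable]: "S \<in> borel_measurable M" "D \<in> borel_measurable M" unfolding S_def D_def by measurable
  have bS: "\<bar>path_sum m n x\<bar> \<le> n * K" for x
    unfolding path_sum_def using sum_bounded_above[of "{..<n}" "\<lambda>i. \<bar>m (x i) (x (Suc i))\<bar>" K] bd
    by (intro order_trans[OF sum_abs]) auto
  have S: "S \<omega> = path_sum m n (sample U n \<omega>)" for \<omega> by (simp add: S_def path_sum_sample)
  have bS': "\<bar>S \<omega>\<bar> \<le> n * K" for \<omega> unfolding S by (rule bS)
  have bD: "\<bar>D \<omega>\<bar> \<le> K" for \<omega> unfolding D_def by (rule bd)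
  have "(\<integral>\<omega>. complex_of_real (path_sum m n (sample U n \<omega>)) * of_real (m (U n \<omega>) (U (Suc n) \<omega>)) \<partial>M) = 0"
    using path_sum_measurable[OF m order_refl, of n] bS
    by (intro martingale_difference[where K = "n * K", OF _ _ m bd z]) auto
  then have cross: "(\<integral>\<omega>. S \<omega> * D \<omega> \<partial>M) = 0"
    unfolding S[symmetric] D_def[symmetric] of_real_mult[symmetric] integral_complex_of_real by simp
  have i1: "integrable M (\<lambda>\<omega>. (S \<omega>)\<^sup>2)"
    by (rule integrable_const_bound[where B = "(real n * K)\<^sup>2"]) (use bS' K in \<open>auto simp: abs_le_square_iff[symmetric]\<close>)
  have i2: "integrable M (\<lambda>\<omega>. (D \<omega>)\<^sup>2)"
    by (rule integrable_const_bound[where B = "K\<^sup>2"]) (use bD K in \<open>auto simp: abs_le_square_iff[symmetric]\<close>)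
  have i3: "integrable M (\<lambda>\<omega>. S \<omega> * D \<omega>)"
    by (rule integrable_const_bound[where B = "(real n * K) * K"]) (use bD bS' K in \<open>auto simp: abs_mult intro!: mult_mono\<close>)
  have "(\<integral>\<omega>. (\<Sum>i<Suc n. m (U i \<omega>) (U (Suc i) \<omega>))\<^sup>2 \<partial>M) = (\<integral>\<omega>. (S \<omega>)\<^sup>2 + 2 * (S \<omega> * D \<omega>) + (D \<omega>)\<^sup>2 \<partial>M)"
    by (intro Bochner_Integration.integral_cong) (auto simp: S_def D_def power2_eq_square algebra_simps)
  also have "\<dots> = (\<integral>\<omega>. (S \<omega>)\<^sup>2 \<partial>M) + (\<integral>\<omega>. (D \<omega>)\<^sup>2 \<partial>M)"
    using i1 i2 i3 by (simp add: cross)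
  also have "(\<integral>\<omega>. (D \<omega>)\<^sup>2 \<partial>M) \<le> (\<integral>\<omega>. K\<^sup>2 \<partial>M)"
    by (intro integral_mono i2) (use bD K in \<open>auto simp: abs_le_square_iff[symmetric]\<close>)
  also have "(\<integral>\<omega>. (S \<omega>)\<^sup>2 \<partial>M) \<le> real n * K\<^sup>2" using Suc by (simp add: S_def)
  finally show ?case by (simp add: prob_space algebra_simps)
qed simp

text \<open>
  By the Poisson decomposition the centred sum is a martingale, whose second moment grows at most
  linearly, plus a bounded term.
\<close>

lemma law_of_large_numbers:
  assumes k: "(\<lambda>(u, v). k u v) \<in> borel_measurable (borel \<Otimes>\<^sub>M borel)" and bd: "\<And>u v. \<bar>k u v\<bar> \<le> K"
  obtains C where "\<And>n. n \<ge> 1 \<Longrightarrow>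
    (\<integral>\<omega>. ((\<Sum>i<n. k (U i \<omega>) (U (Suc i) \<omega>)) / n - dens_mean k)\<^sup>2 \<partial>M) \<le> C / n"
proof -
  obtain m g K' where m: "(\<lambda>(u, v). m u v) \<in> borel_measurable (borel \<Otimes>\<^sub>M borel)"
    and g[measurable]: "g \<in> borel_measurable borel"
    and b: "\<And>u v. \<bar>m u v\<bar> \<le> K'" "\<And>u. \<bar>g u\<bar> \<le> K'"
    and z: "\<And>u. (\<integral>v. dens L u v * m u v \<partial>unif01) = 0"
    and eq: "\<And>u v. k u v - dens_mean k = m u v + g u - g v"
    by (rule poisson_decomposition[OF k bd]) blast
  note [measurable] = pair_fun_measurable[OF m]
  have K: "0 \<le> K'" using b(2)[of 0] by linarith
  show ?thesis
  proof
    fix n :: nat assume n: "n \<ge> 1"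
    define S where "S \<omega> = (\<Sum>i<n. m (U i \<omega>) (U (Suc i) \<omega>))" for \<omega>
    have [measurable]: "S \<in> borel_measurable M" unfolding S_def by measurable
    have bS: "\<bar>S \<omega>\<bar> \<le> n * K'" for \<omega>
      unfolding S_def using sum_bounded_above[of "{..<n}" "\<lambda>i. \<bar>m (U i \<omega>) (U (Suc i) \<omega>)\<bar>" K'] b
      by (intro order_trans[OF sum_abs]) auto
    have i1: "integrable M (\<lambda>\<omega>. (S \<omega>)\<^sup>2)"
      by (rule integrable_const_bound[where B = "(real n * K')\<^sup>2"]) (use bS K in \<open>auto simp: abs_le_square_iff[symmetric]\<close>)
    have tel: "(\<Sum>i<n. g (U i \<omega>) - g (U (Suc i) \<omega>)) = g (U 0 \<omega>) - g (U n \<omega>)" for \<omega>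
      by (induction n) auto
    have e: "(\<Sum>i<n. k (U i \<omega>) (U (Suc i) \<omega>)) / n - dens_mean k = (S \<omega> + g (U 0 \<omega>) - g (U n \<omega>)) / n" for \<omega>
    proof -
      have "(\<Sum>i<n. k (U i \<omega>) (U (Suc i) \<omega>) - dens_mean k) = S \<omega> + (g (U 0 \<omega>) - g (U n \<omega>))"
        unfolding eq tel[symmetric] S_def by (simp add: sum.distrib[symmetric] algebra_simps)
      then show ?thesis using n by (simp add: sum_subtractf field_simps)
    qed
    have "((\<Sum>i<n. k (U i \<omega>) (U (Suc i) \<omega>)) / n - dens_mean k)\<^sup>2 \<le> (2 * (S \<omega>)\<^sup>2 + 8 * K'\<^sup>2) / (real n)\<^sup>2" for \<omega>
    proof -
      have "(S \<omega> + (g (U 0 \<omega>) - g (U n \<omega>)))\<^sup>2 \<le> 2 * (S \<omega>)\<^sup>2 + 2 * (g (U 0 \<omega>) - g (U n \<omega>))\<^sup>2"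
        using zero_le_power2[of "S \<omega> - (g (U 0 \<omega>) - g (U n \<omega>))"] by (simp add: power2_sum power2_diff)
      moreover have "(g (U 0 \<omega>) - g (U n \<omega>))\<^sup>2 \<le> (2 * K')\<^sup>2"
        using b(2)[of "U 0 \<omega>"] b(2)[of "U n \<omega>"] K by (intro abs_le_square_iff[THEN iffD1]) auto
      ultimately have "(S \<omega> + g (U 0 \<omega>) - g (U n \<omega>))\<^sup>2 \<le> 2 * (S \<omega>)\<^sup>2 + 8 * K'\<^sup>2"
        by (simp add: power_mult_distrib algebra_simps)
      then show ?thesis unfolding e power_divide by (intro divide_right_mono) auto
    qed
    then have "(\<integral>\<omega>. ((\<Sum>i<n. k (U i \<omega>) (U (Suc i) \<omega>)) / n - dens_mean k)\<^sup>2 \<partial>M) \<le>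
        (\<integral>\<omega>. (2 * (S \<omega>)\<^sup>2 + 8 * K'\<^sup>2) / (real n)\<^sup>2 \<partial>M)"
      using i1 by (intro integral_mono') auto
    also have "\<dots> = (2 * (\<integral>\<omega>. (S \<omega>)\<^sup>2 \<partial>M) + 8 * K'\<^sup>2) / (real n)\<^sup>2"
      using i1 by (simp add: prob_space)
    also have "\<dots> \<le> (2 * (n * K'\<^sup>2) + 8 * K'\<^sup>2) / (real n)\<^sup>2"
      using martingale_second_moment[OF m b(1) z, of n]
      by (intro divide_right_mono) (auto simp: S_def)
    also have "\<dots> \<le> (2 * (n * K'\<^sup>2) + 8 * (n * K'\<^sup>2)) / (real n)\<^sup>2"
      using n mult_right_mono[of 1 "real n" "K'\<^sup>2"] by (intro divide_right_mono) auto
    also have "\<dots> = 10 * K'\<^sup>2 / n" using n by (simp add: power2_eq_square field_simps)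
    finally show "(\<integral>\<omega>. ((\<Sum>i<n. k (U i \<omega>) (U (Suc i) \<omega>)) / n - dens_mean k)\<^sup>2 \<partial>M) \<le> 10 * K'\<^sup>2 / n" .
  qed
qed

section \<open>Characteristic functions of martingale sums\<close>

text \<open>
  The conditional variances of the summands are not constant, but by Poisson's equation they
  differ from their mean \<open>s\<close> by a martingale difference and a telescoping term. Multiplied by
  \<open>exp(j s/2n)\<close> and by the corrector \<open>1 - g(U\<^sub>j)/2n\<close>, the characteristic function of the \<open>j\<close>-th
  partial sum changes by \<open>O(n\<^sup>-\<^sup>3\<^sup>/\<^sup>2)\<close> per step, hence by \<open>O(n\<^sup>-\<^sup>1\<^sup>/\<^sup>2)\<close> over all \<open>n\<close> steps.
\<close>

theorem char_function_limit:
  assumes d: "(\<lambda>(u, v). d u v) \<in> borel_measurable (borel \<Otimes>\<^sub>M borel)" and bd: "\<And>u v. \<bar>d u v\<bar> \<le> Kd"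
    and z: "\<And>u. (\<integral>v. dens L u v * d u v \<partial>unif01) = 0"
  shows "(\<lambda>n. \<integral>\<omega>. iexp ((\<Sum>i<n. d (U i \<omega>) (U (Suc i) \<omega>)) / sqrt (real n)) \<partial>M)
    \<longlonglongrightarrow> of_real (exp (- dens_mean (\<lambda>u v. (d u v)\<^sup>2) / 2))"
proof -
  define s where "s = dens_mean (\<lambda>u v. (d u v)\<^sup>2)"
  have Kd: "0 \<le> Kd" using bd[of 0 0] by linarith
  have d2: "(\<lambda>(u, v). (d u v)\<^sup>2) \<in> borel_measurable (borel \<Otimes>\<^sub>M borel)"
    using d unfolding split_beta' by measurable
  have bd2: "\<bar>(d u v)\<^sup>2\<bar> \<le> Kd\<^sup>2" for u v using bd[of u v] Kd by (simp add: abs_le_square_iff[symmetric])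
  obtain m g Km where m: "(\<lambda>(u, v). m u v) \<in> borel_measurable (borel \<Otimes>\<^sub>M borel)"
    and g[measurable]: "g \<in> borel_measurable borel"
    and b: "\<And>u v. \<bar>m u v\<bar> \<le> Km" "\<And>u. \<bar>g u\<bar> \<le> Km"
    and zm: "\<And>u. (\<integral>v. dens L u v * m u v \<partial>unif01) = 0"
    and eq: "\<And>u v. (d u v)\<^sup>2 - s = m u v + g u - g v"
    unfolding s_def by (rule poisson_decomposition[OF d2 bd2]) blast
  have Km: "0 \<le> Km" using b(2)[of 0] by linarith
  have s0: "0 \<le> s" unfolding s_def dens_mean_def using dens_L_pos
    by (intro integral_nonneg_AE AE_I2 mult_nonneg_nonneg) (auto intro: less_imp_le)
  define K where "K = Kd + Km + s"
  have K: "0 \<le> K" unfolding K_def using Kd Km s0 by simp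
  obtain C where C: "0 \<le> C" and step: "\<And>D g g' m s x :: real. \<lbrakk>\<bar>D\<bar> \<le> K; \<bar>g\<bar> \<le> K; \<bar>g'\<bar> \<le> K; 0 \<le> s; s \<le> K; D\<^sup>2 - s = m + g - g'; 0 \<le> x; x \<le> 1\<rbrakk>
     \<Longrightarrow> norm (exp (of_real (s * x\<^sup>2 / 2) + \<i> * of_real (D * x)) * (1 - of_real (g' * x\<^sup>2 / 2)) -
            (1 - of_real (g * x\<^sup>2 / 2)) - \<i> * of_real (D * x) + of_real (m * x\<^sup>2 / 2)) \<le> C * x ^ 3"
    using one_step_expansion[OF K] by blast
  note [measurable] = pair_fun_measurable[OF m] pair_fun_measurable[OF d]
  define S where "S j \<omega> = (\<Sum>i<j. d (U i \<omega>) (U (Suc i) \<omega>))" for j \<omega>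
  have [measurable]: "S j \<in> borel_measurable M" for j unfolding S_def by measurable
  define Z where "Z n j \<omega> = exp (of_real (s * real j * (1 / sqrt (real n))\<^sup>2 / 2) + \<i> * of_real (S j \<omega> * (1 / sqrt (real n))))" for n j \<omega>
  have [measurable]: "Z n j \<in> borel_measurable M" for n j unfolding Z_def by measurable
  have nZ: "norm (Z n j \<omega>) \<le> exp (s / 2)" if "j \<le> n" for n j \<omega>
  proof -
    have "norm (Z n j \<omega>) = exp (s * real j * (1 / sqrt (real n))\<^sup>2 / 2)"
      unfolding Z_def by (simp add: norm_exp_eq_Re)
    also have "s * real j * (1 / sqrt (real n))\<^sup>2 / 2 \<le> s / 2"
      using s0 that mult_left_mono[of "real j" "real n" s] by (cases "n = 0") (auto simp: power_divide field_simps)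
    finally show ?thesis by simp
  qed
  \<comment> \<open>The normalized exponential with its corrector: the almost-martingale of the proof.\<close>
  define W where "W n j \<omega> = Z n j \<omega> * (1 - of_real (g (U j \<omega>) * (1 / sqrt (real n))\<^sup>2 / 2))" for n j \<omega>
  have [measurable]: "W n j \<in> borel_measurable M" for n j unfolding W_def by measurable
  have x01: "0 \<le> 1 / sqrt (real n)" "1 / sqrt (real n) \<le> 1" for n :: nat
    by (cases "n = 0"; simp)+
  have xK: "\<bar>g u * (1 / sqrt (real n))\<^sup>2 / 2\<bar> \<le> K" for u n
  proof -
    have "(1 / sqrt (real n))\<^sup>2 \<le> 1" using power_le_one[OF x01] by blast
    then have "\<bar>g u\<bar> * (1 / sqrt (real n))\<^sup>2 \<le> Km * 1" using b(2) Km by (intro mult_mono) auto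
    then show ?thesis using Kd s0 Km by (simp add: K_def abs_mult)
  qed
  have nW: "norm (W n j \<omega>) \<le> exp (s / 2) * (1 + K)" if "j \<le> n" for n j \<omega>
    unfolding W_def norm_mult
  proof (intro mult_mono nZ that)
    show "norm (1 - complex_of_real (g (U j \<omega>) * (1 / sqrt (real n))\<^sup>2 / 2)) \<le> 1 + K"
      using xK[of "U j \<omega>" n] by (intro order_trans[OF norm_triangle_ineq4]) (simp only: norm_of_real norm_one add_le_cancel_left)
  qed auto
  have iW: "integrable M (W n j)" if "j \<le> n" for n j
    by (rule integrable_const_bound[where B = "exp (s / 2) * (1 + K)"]) (use nW that in auto)
  have iZ: "integrable M (Z n j)" if "j \<le> n" for n j
    by (rule integrable_const_bound[where B = "exp (s / 2)"]) (use nZ that in auto)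
  have incr: "norm ((\<integral>\<omega>. W n (Suc j) \<omega> \<partial>M) - (\<integral>\<omega>. W n j \<omega> \<partial>M)) \<le> exp (s / 2) * (C * (1 / sqrt (real n))^3)"
    if j: "j < n" for n j
  proof -
    define x where "x = 1 / sqrt (real n)"
    have x: "0 \<le> x" "x \<le> 1" unfolding x_def by (rule x01)+
    define D where "D \<omega> = d (U j \<omega>) (U (Suc j) \<omega>)" for \<omega>
    define mm where "mm \<omega> = m (U j \<omega>) (U (Suc j) \<omega>)" for \<omega>
    have [measurable]: "D \<in> borel_measurable M" "mm \<in> borel_measurable M" unfolding D_def mm_def by measurable
    define H where "H y = exp (of_real (s * real j * x\<^sup>2 / 2) + \<i> * of_real (path_sum d j y * x))" for y
    have [measurable]: "H \<in> borel_measurable (\<Pi>\<^sub>M i\<in>{..j}. borel)"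
      unfolding H_def using path_sum_measurable[OF d order_refl, of j] by measurable
    have HZ: "H (sample U j \<omega>) = Z n j \<omega>" for \<omega> by (simp add: H_def Z_def S_def path_sum_sample x_def)
    have bH: "norm (H y) \<le> exp (s / 2)" for y
    proof -
      have "norm (H y) = exp (s * real j * x\<^sup>2 / 2)"
        unfolding H_def by (simp add: norm_exp_eq_Re)
      also have "s * real j * x\<^sup>2 / 2 \<le> s / 2"
        using s0 j mult_left_mono[of "real j" "real n" s] by (auto simp: x_def power_divide field_simps)
      finally show ?thesis by simp
    qed
    have z1: "(\<integral>\<omega>. Z n j \<omega> * of_real (D \<omega>) \<partial>M) = 0"
      using martingale_difference[where n = j and H = H, OF _ bH d bd z] by (simp add: HZ D_def)
    have z2: "(\<integral>\<omega>. Z n j \<omega> * of_real (mm \<omega>) \<partial>M) = 0"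
      using martingale_difference[where n = j and H = H, OF _ bH m b(1) zm] by (simp add: HZ mm_def)
    have jn: "j \<le> n" "Suc j \<le> n" using j by auto
    have i1: "integrable M (\<lambda>\<omega>. Z n j \<omega> * of_real (D \<omega>))"
      by (rule integrable_const_bound[where B = "exp (s / 2) * Kd"])
         (use nZ[OF jn(1)] bd in \<open>auto simp: norm_mult D_def intro!: mult_mono\<close>)
    have i2: "integrable M (\<lambda>\<omega>. Z n j \<omega> * of_real (mm \<omega>))"
      by (rule integrable_const_bound[where B = "exp (s / 2) * Km"])
         (use nZ[OF jn(1)] b in \<open>auto simp: norm_mult mm_def intro!: mult_mono\<close>)
    define R where "R \<omega> = exp (of_real (s * x\<^sup>2 / 2) + \<i> * of_real (D \<omega> * x)) * (1 - of_real (g (U (Suc j) \<omega>) * x\<^sup>2 / 2)) -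
            (1 - of_real (g (U j \<omega>) * x\<^sup>2 / 2)) - \<i> * of_real (D \<omega> * x) + of_real (mm \<omega> * x\<^sup>2 / 2)" for \<omega>
    have R: "norm (R \<omega>) \<le> C * x^3" for \<omega>
      unfolding R_def
    proof (rule step)
      show "\<bar>D \<omega>\<bar> \<le> K" using bd[of "U j \<omega>" "U (Suc j) \<omega>"] Km s0 by (simp add: D_def K_def)
      show "\<bar>g (U j \<omega>)\<bar> \<le> K" "\<bar>g (U (Suc j) \<omega>)\<bar> \<le> K" 
        using b(2)[of "U j \<omega>"] b(2)[of "U (Suc j) \<omega>"] Kd s0 by (auto simp: K_def)
      show "s \<le> K" using Kd Km by (simp add: K_def)
      show "(D \<omega>)\<^sup>2 - s = mm \<omega> + g (U j \<omega>) - g (U (Suc j) \<omega>)" unfolding D_def mm_def by (rule eq)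
    qed (use s0 x in auto)
    \<comment> \<open>The step \<open>W n (Suc j) - W n j\<close> is \<open>Z n j * R\<close> up to two martingale differences of mean zero.\<close>
    have ZS: "Z n (Suc j) \<omega> = Z n j \<omega> * exp (of_real (s * x\<^sup>2 / 2) + \<i> * of_real (D \<omega> * x))" for \<omega>
      unfolding Z_def exp_add[symmetric] x_def[symmetric]
      by (rule arg_cong[where f = exp]) (simp add: S_def D_def algebra_simps add_divide_distrib)
    have "W n (Suc j) \<omega> - W n j \<omega> = Z n j \<omega> * R \<omega> + \<i> * of_real x * (Z n j \<omega> * of_real (D \<omega>))
        - of_real (x\<^sup>2 / 2) * (Z n j \<omega> * of_real (mm \<omega>))" for \<omega>
      unfolding W_def ZS R_def x_def[symmetric] by (simp add: algebra_simps)
    then have ZR: "Z n j \<omega> * R \<omega> = (W n (Suc j) \<omega> - W n j \<omega>) - \<i> * of_real x * (Z n j \<omega> * of_real (D \<omega>))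
        + of_real (x\<^sup>2 / 2) * (Z n j \<omega> * of_real (mm \<omega>))" for \<omega> by (simp add: algebra_simps)
    have "(\<integral>\<omega>. Z n j \<omega> * R \<omega> \<partial>M) = (\<integral>\<omega>. W n (Suc j) \<omega> \<partial>M) - (\<integral>\<omega>. W n j \<omega> \<partial>M)"
      unfolding ZR using i1 i2 iW[OF jn(1)] iW[OF jn(2)] z1 z2 by simp
    then have "norm ((\<integral>\<omega>. W n (Suc j) \<omega> \<partial>M) - (\<integral>\<omega>. W n j \<omega> \<partial>M)) \<le> (\<integral>\<omega>. norm (Z n j \<omega> * R \<omega>) \<partial>M)"
      by (metis integral_norm_bound)
    also have "\<dots> \<le> (\<integral>\<omega>. exp (s / 2) * (C * x^3) \<partial>M)"
    proof (rule integral_mono')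
      show "norm (Z n j \<omega> * R \<omega>) \<le> exp (s / 2) * (C * x^3)" for \<omega>
        unfolding norm_mult using nZ[OF jn(1)] R by (intro mult_mono) auto
    qed (use C x in auto)
    finally show ?thesis by (simp add: prob_space x_def)
  qed
  have tot: "norm ((\<integral>\<omega>. W n n \<omega> \<partial>M) - (\<integral>\<omega>. W n 0 \<omega> \<partial>M)) \<le> exp (s / 2) * C / sqrt (real n)" for n :: nat
  proof -
    have "norm ((\<integral>\<omega>. W n j \<omega> \<partial>M) - (\<integral>\<omega>. W n 0 \<omega> \<partial>M)) \<le> real j * (exp (s / 2) * (C * (1 / sqrt (real n))^3))" if "j \<le> n" for j
      using that
    proof (induction j)
      case (Suc j)
      have "norm ((\<integral>\<omega>. W n (Suc j) \<omega> \<partial>M) - (\<integral>\<omega>. W n 0 \<omega> \<partial>M)) \<le>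
        norm ((\<integral>\<omega>. W n (Suc j) \<omega> \<partial>M) - (\<integral>\<omega>. W n j \<omega> \<partial>M)) + norm ((\<integral>\<omega>. W n j \<omega> \<partial>M) - (\<integral>\<omega>. W n 0 \<omega> \<partial>M))"
        by (rule order_trans[OF _ norm_triangle_ineq]) simp
      also have "\<dots> \<le> exp (s / 2) * (C * (1 / sqrt (real n))^3) + real j * (exp (s / 2) * (C * (1 / sqrt (real n))^3))"
        using Suc by (intro add_mono incr Suc.IH) auto
      finally show ?case by (simp only: of_nat_Suc distrib_right mult_1) 
    qed simp
    from this[of n] have "norm ((\<integral>\<omega>. W n n \<omega> \<partial>M) - (\<integral>\<omega>. W n 0 \<omega> \<partial>M)) \<le> real n * (exp (s / 2) * (C * (1 / sqrt (real n))^3))"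
      by simp
    also have "\<dots> = exp (s / 2) * C / sqrt (real n)"
      by (cases "n = 0") (auto simp: power3_eq_cube field_simps)
    finally show ?thesis .
  qed
  have sq0: "(\<lambda>n. K / sqrt (real n)) \<longlonglongrightarrow> 0" for K :: real by real_asymp
  have lim1: "(\<lambda>n. (\<integral>\<omega>. W n n \<omega> \<partial>M) - (\<integral>\<omega>. W n 0 \<omega> \<partial>M)) \<longlonglongrightarrow> 0"
    by (rule Lim_null_comparison[OF _ sq0[of "exp (s/2) * C"]]) (use tot in auto)
  have lim2: "(\<lambda>n. (\<integral>\<omega>. W n 0 \<omega> \<partial>M) - 1) \<longlonglongrightarrow> 0"
  proof (rule Lim_null_comparison)
    show "\<forall>\<^sub>F n in sequentially. norm ((\<integral>\<omega>. W n 0 \<omega> \<partial>M) - 1) \<le> Km / 2 / real n"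
    proof (rule always_eventually, rule allI)
      fix n
      have "W n 0 \<omega> = 1 - of_real (g (U 0 \<omega>) / real n / 2)" for \<omega>
        by (simp add: W_def Z_def S_def power_divide)
      moreover have "integrable M (\<lambda>\<omega>. g (U 0 \<omega>) / real n / 2)"
        by (intro integrable_divide integrable_const_bound[where B = Km]) (use b in auto)
      ultimately have "(\<integral>\<omega>. W n 0 \<omega> \<partial>M) - 1 = - of_real (\<integral>\<omega>. g (U 0 \<omega>) / real n / 2 \<partial>M)"
        by (simp only: integral_complex_of_real[symmetric])
           (subst Bochner_Integration.integral_diff, auto simp: prob_space simp del: of_real_divide)
      then have "norm ((\<integral>\<omega>. W n 0 \<omega> \<partial>M) - 1) = \<bar>\<integral>\<omega>. g (U 0 \<omega>) / real n / 2 \<partial>M\<bar>"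
        by (simp only: norm_minus_cancel norm_of_real)
      also have "\<dots> \<le> (\<integral>\<omega>. \<bar>g (U 0 \<omega>) / real n / 2\<bar> \<partial>M)" by (rule integral_abs_bound)
      also have "\<dots> \<le> (\<integral>\<omega>. Km / 2 / real n \<partial>M)"
        using b(2) Km by (intro integral_mono') (auto simp: mult.commute[of _ 2] intro!: divide_right_mono)
      finally show "norm ((\<integral>\<omega>. W n 0 \<omega> \<partial>M) - 1) \<le> Km / 2 / real n" by (simp add: prob_space)
    qed
    show "(\<lambda>n. Km / 2 / real n) \<longlonglongrightarrow> 0" by real_asymp
  qed
  have lim3: "(\<lambda>n. (\<integral>\<omega>. Z n n \<omega> \<partial>M) - (\<integral>\<omega>. W n n \<omega> \<partial>M)) \<longlonglongrightarrow> 0"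
  proof (rule Lim_null_comparison)
    show "\<forall>\<^sub>F n in sequentially. norm ((\<integral>\<omega>. Z n n \<omega> \<partial>M) - (\<integral>\<omega>. W n n \<omega> \<partial>M)) \<le> exp (s / 2) * Km / real n"
    proof (rule always_eventually, rule allI)
      fix n
      have "(\<integral>\<omega>. Z n n \<omega> \<partial>M) - (\<integral>\<omega>. W n n \<omega> \<partial>M) = (\<integral>\<omega>. Z n n \<omega> - W n n \<omega> \<partial>M)"
        using iZ iW by simp
      also have "norm \<dots> \<le> (\<integral>\<omega>. norm (Z n n \<omega> - W n n \<omega>) \<partial>M)" by (rule integral_norm_bound)
      also have "\<dots> \<le> (\<integral>\<omega>. exp (s / 2) * Km / real n \<partial>M)"
      proof (rule integral_mono')
        fix \<omega>
        have "Z n n \<omega> - W n n \<omega> = Z n n \<omega> * of_real (g (U n \<omega>) / real n / 2)"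
          by (simp add: W_def power_divide algebra_simps)
        then have "norm (Z n n \<omega> - W n n \<omega>) = norm (Z n n \<omega>) * (\<bar>g (U n \<omega>)\<bar> / real n / 2)"
          by (simp only: norm_mult norm_of_real) simp
        also have "\<dots> \<le> exp (s / 2) * (Km / real n)"
        proof (intro mult_mono nZ)
          have half: "y / 2 \<le> y" if "0 \<le> y" for y :: real using that by simp
          have "\<bar>g (U n \<omega>)\<bar> / real n / 2 \<le> \<bar>g (U n \<omega>)\<bar> / real n"
            by (intro half) simp
          also have "\<dots> \<le> Km / real n" using b(2) by (intro divide_right_mono) auto
          finally show "\<bar>g (U n \<omega>)\<bar> / real n / 2 \<le> Km / real n" .
        qed auto
        finally show "norm (Z n n \<omega> - W n n \<omega>) \<le> exp (s / 2) * Km / real n" by simp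
      qed (use Km in auto)
      finally show "norm ((\<integral>\<omega>. Z n n \<omega> \<partial>M) - (\<integral>\<omega>. W n n \<omega> \<partial>M)) \<le> exp (s / 2) * Km / real n"
        by (simp add: prob_space)
    qed
    show "(\<lambda>n. exp (s / 2) * Km / real n) \<longlonglongrightarrow> 0" by real_asymp
  qed
  have "(\<lambda>n. (((\<integral>\<omega>. Z n n \<omega> \<partial>M) - (\<integral>\<omega>. W n n \<omega> \<partial>M)) + ((\<integral>\<omega>. W n n \<omega> \<partial>M) - (\<integral>\<omega>. W n 0 \<omega> \<partial>M))
      + ((\<integral>\<omega>. W n 0 \<omega> \<partial>M) - 1)) + 1) \<longlonglongrightarrow> 0 + 0 + 0 + 1"
    by (intro tendsto_add lim1 lim2 lim3 tendsto_const)
  then have "(\<lambda>n. (\<integral>\<omega>. Z n n \<omega> \<partial>M)) \<longlonglongrightarrow> 1" by simp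
  then have "(\<lambda>n. of_real (exp (- s / 2)) * (\<integral>\<omega>. Z n n \<omega> \<partial>M)) \<longlonglongrightarrow> of_real (exp (- s / 2)) * 1"
    by (intro tendsto_mult tendsto_const)
  moreover have "\<forall>\<^sub>F n in sequentially. of_real (exp (- s / 2)) * (\<integral>\<omega>. Z n n \<omega> \<partial>M) = 
      (\<integral>\<omega>. iexp ((\<Sum>i<n. d (U i \<omega>) (U (Suc i) \<omega>)) / sqrt (real n)) \<partial>M)"
    using eventually_gt_at_top[of 0]
  proof eventually_elim
    case (elim n)
    have "of_real (exp (- s / 2)) * Z n n \<omega> = iexp ((\<Sum>i<n. d (U i \<omega>) (U (Suc i) \<omega>)) / sqrt (real n))" for \<omega>
      using elim unfolding Z_def S_def exp_of_real[symmetric] exp_add[symmetric]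
      by (intro arg_cong[where f = exp]) (simp add: power_divide)
    then show ?case by (simp only: integral_mult_right_zero[symmetric])
  qed
  ultimately show ?thesis unfolding s_def[symmetric]
    by (simp add: filterlim_cong)
qed

end

section \<open>Convergence in distribution through characteristic functions\<close>

text \<open>
  The phase makes sines and constants instances of the first rule.
\<close>

inductive_set trig_poly :: "('a::euclidean_space \<Rightarrow> real) set" where
  cos: "(\<lambda>x. cos (a \<bullet> x + \<phi>)) \<in> trig_poly"
| scale: "h \<in> trig_poly \<Longrightarrow> (\<lambda>x. c * h x) \<in> trig_poly"
| add: "h \<in> trig_poly \<Longrightarrow> k \<in> trig_poly \<Longrightarrow> (\<lambda>x. h x + k x) \<in> trig_poly"

lemma trig_poly_const: "(\<lambda>_. c) \<in> trig_poly"
  using trig_poly.scale[OF trig_poly.cos[of 0 0], of c] by simp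

lemma trig_poly_mult_cos:
  assumes "h \<in> trig_poly"
  shows "(\<lambda>x. cos (a \<bullet> x + \<phi>) * h x) \<in> trig_poly"
  using assms
proof induction
  case (cos b \<psi>)
  have "(\<lambda>x. (1/2) * cos ((a - b) \<bullet> x + (\<phi> - \<psi>)) + (1/2) * cos ((a + b) \<bullet> x + (\<phi> + \<psi>))) \<in> trig_poly"
    by (intro trig_poly.intros)
  moreover have "cos (a \<bullet> x + \<phi>) * cos (b \<bullet> x + \<psi>) =
      (1/2) * cos ((a - b) \<bullet> x + (\<phi> - \<psi>)) + (1/2) * cos ((a + b) \<bullet> x + (\<phi> + \<psi>))" for x
    by (simp add: cos_times_cos inner_diff_left inner_add_left algebra_simps)
  ultimately show ?case by simp
next
  case (scale h c)
  from trig_poly.scale[OF scale.IH, of c] show ?case by (simp add: mult.left_commute)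
next
  case (add h k)
  from trig_poly.add[OF add.IH] show ?case by (simp add: distrib_left)
qed

lemma trig_poly_mult:
  assumes "h \<in> trig_poly" "k \<in> trig_poly"
  shows "(\<lambda>x. h x * k x) \<in> trig_poly"
  using assms(1)
proof induction
  case (cos a \<phi>)
  show ?case by (rule trig_poly_mult_cos[OF assms(2)])
next
  case (scale h c)
  from trig_poly.scale[OF scale.IH, of c] show ?case by (simp add: mult.assoc)
next
  case (add h k)
  from trig_poly.add[OF add.IH] show ?case by (simp add: distrib_right)
qed

lemma trig_poly_continuous: "h \<in> trig_poly \<Longrightarrow> continuous_on UNIV h"
  by (induction rule: trig_poly.induct) (auto intro!: continuous_intros)

lemma trig_poly_bounded: "h \<in> trig_poly \<Longrightarrow> \<exists>B. \<forall>x. \<bar>h x\<bar> \<le> B"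
proof (induction rule: trig_poly.induct)
  case (cos a \<phi>) show ?case by (rule exI[of _ 1]) simp
next
  case (scale h c)
  then obtain B where "\<forall>x. \<bar>h x\<bar> \<le> B" by blast
  then show ?case by (intro exI[of _ "\<bar>c\<bar> * B"]) (auto simp: abs_mult intro!: mult_left_mono)
next
  case (add h k)
  then obtain B B' where "\<forall>x. \<bar>h x\<bar> \<le> B" "\<forall>x. \<bar>k x\<bar> \<le> B'" by blast
  then show ?case
    by (intro exI[of _ "B + B'"]) (auto intro!: order_trans[OF abs_triangle_ineq] add_mono)
qed

lemma trig_poly_measurable: "h \<in> trig_poly \<Longrightarrow> h \<in> borel_measurable borel"
  by (intro borel_measurable_continuous_onI trig_poly_continuous)

text \<open>
  Used to see that a function supported away from the cut of the argument stays continuous across it.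
\<close>

lemma Arg_left_sector:
  assumes "\<bar>Im z\<bar> < \<bar>Re z\<bar>" "Re z < 0"
  shows "3 * pi / 4 \<le> \<bar>Arg z\<bar>"
proof (rule ccontr)
  define t where "t = \<bar>Arg z\<bar>"
  assume "\<not> 3 * pi / 4 \<le> \<bar>Arg z\<bar>"
  then have t: "0 \<le> t" "t + pi / 4 < pi" by (auto simp: t_def)
  have e1: "Re z = norm z * cos t"
    using Re_rcis[of "norm z" "Arg z"] by (simp add: rcis_cmod_Arg t_def)
  have e2: "\<bar>Im z\<bar> = norm z * \<bar>sin t\<bar>"
  proof -
    have "\<bar>Im z\<bar> = norm z * \<bar>sin (Arg z)\<bar>"
      using arg_cong[OF Im_rcis[of "norm z" "Arg z"], of abs] unfolding rcis_cmod_Arg abs_mult by simp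
    also have "\<bar>sin (Arg z)\<bar> = \<bar>sin t\<bar>" by (cases "0 \<le> Arg z") (auto simp: t_def)
    finally show ?thesis .
  qed
  have st: "0 \<le> sin t" using t pi_gt_zero by (intro sin_ge_zero) linarith+
  have "norm z * (sin t + cos t) < 0"
  proof -
    have "norm z * sin t < - (norm z * cos t)"
      using assms unfolding e1[symmetric] using e2 st by simp
    then show ?thesis unfolding distrib_left by linarith
  qed
  then have neg: "sin t + cos t < 0" unfolding mult_less_0_iff by auto
  have "0 \<le> sin (t + pi / 4)" using t pi_gt_zero by (intro sin_ge_zero) linarith+
  also have "sin (t + pi / 4) = (sin t + cos t) * (sqrt 2 / 2)"
    by (simp only: sin_add sin_45 cos_45 distrib_right)
  also have "\<dots> < 0" by (rule mult_neg_pos[OF neg]) simp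
  finally show False by simp
qed

text \<open>
  The function is cut off at radius \<open>2 R\<close> and transported to the torus with period \<open>6 R\<close> in each
  coordinate, where the Stone-Weierstrass theorem applies. Periodicity is what keeps the
  approximating polynomial bounded on all of space.
\<close>

lemma torus_approximation:
  fixes f :: "real^'s \<Rightarrow> real"
  assumes f: "continuous_on UNIV f" and B: "\<And>x. \<bar>f x\<bar> \<le> B" and R: "0 < R" and \<epsilon>: "0 < \<epsilon>"
  obtains h where "h \<in> trig_poly" "\<And>x. \<bar>h x\<bar> \<le> B + \<epsilon>" "\<And>x. norm x \<le> R \<Longrightarrow> \<bar>f x - h x\<bar> \<le> \<epsilon>"
proof -
  \<comment> \<open>Half the period. It exceeds the support radius \<open>2 R\<close>, which leaves room around the cut of \<open>Arg\<close>.\<close>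
  define P where "P = 3 * R"
  have P: "0 < P" using R by (simp add: P_def)
  define cut where "cut x = max 0 (min 1 (2 - norm x / R))" for x :: "real^'s"
  have cut_bds: "0 \<le> cut x" "cut x \<le> 1" for x by (auto simp: cut_def)
  have cut1: "cut x = 1" if "norm x \<le> R" for x using that R by (auto simp: cut_def field_simps)
  have cut0: "cut x = 0" if "norm x \<ge> 2 * R" for x using that R by (auto simp: cut_def field_simps)
  have cut_cont: "continuous_on UNIV cut" unfolding cut_def by (intro continuous_intros) (use R in auto)
  define g where "g x = cut x * f x" for x
  have g_cont: "continuous_on UNIV g" unfolding g_def by (intro continuous_intros cut_cont f)
  have g_bd: "\<bar>g x\<bar> \<le> B" for x
    using mult_mono[of "cut x" 1 "\<bar>f x\<bar>" B] cut_bds[of x] B[of x] by (simp add: g_def abs_mult)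
  define A where "A w = (\<chi> i. P / pi * Arg (w $ i))" for w :: "complex^'s"
  define G where "G w = g (A w)" for w
  define T :: "(complex^'s) set" where "T = {w. \<forall>i. norm (w $ i) = 1}"
  define \<theta> where "\<theta> x = (\<chi> i. cis (pi / P * (x $ i)))" for x :: "real^'s"
  have \<theta>T: "\<theta> x \<in> T" for x by (simp add: \<theta>_def T_def)
  have T_compact: "compact T"
  proof -
    have "closed T" unfolding T_def
      by (intro closed_Collect_all closed_Collect_eq continuous_intros)
    moreover have "bounded T"
    proof (rule boundedI)
      fix w assume "w \<in> T"
      then have "norm w \<le> (\<Sum>i\<in>(UNIV :: 's set). 1)"
        unfolding norm_vec_def T_def by (intro order_trans[OF L2_set_le_sum]) auto
      then show "norm w \<le> real CARD('s)" by simp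
    qed
    ultimately show ?thesis by (simp add: compact_eq_bounded_closed)
  qed
  have G_cont: "continuous_on T G"
  proof (rule continuous_at_imp_continuous_on, rule ballI)
    fix w assume w: "w \<in> T"
    have nz: "w $ i \<noteq> 0" for i using w unfolding T_def by (metis (mono_tags) mem_Collect_eq norm_zero zero_neq_one)
    show "isCont G w"
    proof (cases "\<exists>i. w $ i \<in> \<real>\<^sub>\<le>\<^sub>0")
      case False
      have "isCont (\<lambda>w. Arg (w $ i)) w" for i
        by (rule isCont_o2[where g = Arg]) (use False in \<open>auto intro!: continuous_at_Arg continuous_intros\<close>)
      then have "isCont A w" unfolding A_def isCont_def
        by (intro tendsto_vec_lambda tendsto_mult tendsto_const)
      then show ?thesis unfolding G_def
        by (rule isCont_o2) (use g_cont in \<open>auto simp: continuous_on_eq_continuous_at\<close>)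
    next
      case True
      then obtain i where i: "w $ i \<in> \<real>\<^sub>\<le>\<^sub>0" by blast
      then have wi: "Re (w $ i) < 0" "Im (w $ i) = 0"
        using nz[of i] by (auto simp: complex_nonpos_Reals_iff complex_eq_iff)
      have ev: "\<forall>\<^sub>F z in at w. \<bar>Im (z $ i)\<bar> < \<bar>Re (z $ i)\<bar> \<and> Re (z $ i) < 0"
      proof (intro eventually_conj)
        have "((\<lambda>z. \<bar>Im (z $ i)\<bar> - \<bar>Re (z $ i)\<bar>) \<longlongrightarrow> \<bar>Im (w $ i)\<bar> - \<bar>Re (w $ i)\<bar>) (at w)"
          by (intro tendsto_intros)
        from order_tendstoD(2)[OF this, of 0] wi
        show "\<forall>\<^sub>F z in at w. \<bar>Im (z $ i)\<bar> < \<bar>Re (z $ i)\<bar>" by simp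
        show "\<forall>\<^sub>F z in at w. Re (z $ i) < 0"
          by (rule order_tendstoD(2)[OF _ wi(1)]) (auto intro!: tendsto_eq_intros)
      qed
      \<comment> \<open>Close to the cut the argument is at least \<open>3\<pi>/4\<close> in modulus, which is beyond the support.\<close>
      have zero: "G z = 0" if "\<bar>Im (z $ i)\<bar> < \<bar>Re (z $ i)\<bar>" "Re (z $ i) < 0" for z
      proof -
        define t where "t = Arg (z $ i)"
        have "3 * pi / 4 \<le> \<bar>t\<bar>" unfolding t_def by (rule Arg_left_sector[OF that])
        then have "P / pi * (3 * pi / 4) \<le> P / pi * \<bar>t\<bar>" using P by (intro mult_left_mono) auto
        moreover have "P / pi * (3 * pi / 4) = 9 / 4 * R" by (simp add: P_def)
        ultimately have "2 * R \<le> P / pi * \<bar>t\<bar>" using R by linarith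
        also have "\<dots> = \<bar>A z $ i\<bar>" using P by (simp add: A_def t_def abs_mult)
        also have "\<dots> \<le> norm (A z)" by (rule component_le_norm_cart)
        finally have "2 * R \<le> norm (A z)" .
        then show ?thesis by (simp add: G_def g_def cut0)
      qed
      have "\<forall>\<^sub>F z in at w. G z = 0" using ev by eventually_elim (rule zero; blast)
      moreover have "G w = 0" by (rule zero) (use wi in auto)
      ultimately show ?thesis unfolding isCont_def by (simp add: tendsto_eventually)
    qed
  qed
  define RR where "RR = {F. continuous_on T F \<and> (\<lambda>x. F (\<theta> x)) \<in> trig_poly}"
  have coord: "(\<lambda>w. Re (w $ i)) \<in> RR" "(\<lambda>w. Im (w $ i)) \<in> RR" for i
  proof -
    have ax: "axis i (pi / P) \<bullet> x = pi / P * x $ i" for x :: "real^'s"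
      by (simp add: inner_axis')
    have "(\<lambda>x. Re (\<theta> x $ i)) = (\<lambda>x. cos (axis i (pi / P) \<bullet> x + 0))"
      unfolding ax by (simp add: \<theta>_def)
    then have re: "(\<lambda>x. Re (\<theta> x $ i)) \<in> trig_poly" by (simp only: trig_poly.cos)
    have "cos (y + - (pi / 2)) = sin y" for y :: real by (simp add: cos_diff)
    then have "(\<lambda>x. Im (\<theta> x $ i)) = (\<lambda>x. cos (axis i (pi / P) \<bullet> x + - (pi / 2)))"
      unfolding ax by (simp only: \<theta>_def vec_lambda_beta cis.sel)
    then have im: "(\<lambda>x. Im (\<theta> x $ i)) \<in> trig_poly" by (simp only: trig_poly.cos)
    show "(\<lambda>w. Re (w $ i)) \<in> RR" unfolding RR_def using re by (auto intro!: continuous_intros)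
    show "(\<lambda>w. Im (w $ i)) \<in> RR" unfolding RR_def using im by (auto intro!: continuous_intros)
  qed
  have RR_cont: "continuous_on T F" if "F \<in> RR" for F using that by (simp add: RR_def)
  have RR_add: "(\<lambda>x. F x + F' x) \<in> RR" if "F \<in> RR" "F' \<in> RR" for F F'
  proof -
    have "continuous_on T (\<lambda>x. F x + F' x)" by (intro continuous_on_add RR_cont that)
    moreover have "(\<lambda>x. F (\<theta> x) + F' (\<theta> x)) \<in> trig_poly"
      by (rule trig_poly.add) (use that in \<open>simp_all add: RR_def\<close>)
    ultimately show ?thesis by (simp add: RR_def)
  qed
  have RR_mult: "(\<lambda>x. F x * F' x) \<in> RR" if "F \<in> RR" "F' \<in> RR" for F F'
  proof -
    have "continuous_on T (\<lambda>x. F x * F' x)" by (intro continuous_on_mult RR_cont that)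
    moreover have "(\<lambda>x. F (\<theta> x) * F' (\<theta> x)) \<in> trig_poly"
      by (rule trig_poly_mult) (use that in \<open>simp_all add: RR_def\<close>)
    ultimately show ?thesis by (simp add: RR_def)
  qed
  have RR_sep: "\<exists>F\<in>RR. F w \<noteq> F w'" if ne: "w \<noteq> w'" for w w' :: "complex^'s"
  proof -
    obtain i where "w $ i \<noteq> w' $ i" using ne unfolding vec_eq_iff by blast
    then have "Re (w $ i) \<noteq> Re (w' $ i) \<or> Im (w $ i) \<noteq> Im (w' $ i)" by (auto simp: complex_eq_iff)
    then show ?thesis
    proof
      assume "Re (w $ i) \<noteq> Re (w' $ i)"
      then show ?thesis by (intro bexI[OF _ coord(1)[of i]])
    next
      assume "Im (w $ i) \<noteq> Im (w' $ i)"
      then show ?thesis by (intro bexI[OF _ coord(2)[of i]])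
    qed
  qed
  have RR_const: "(\<lambda>_. c) \<in> RR" for c by (simp add: RR_def trig_poly_const)
  interpret function_ring_on RR T
    by (rule function_ring_on.intro[OF T_compact RR_cont RR_add RR_mult RR_const RR_sep])
  obtain F where F: "F \<in> RR" "\<And>w. w \<in> T \<Longrightarrow> \<bar>G w - F w\<bar> < \<epsilon>"
    using Stone_Weierstrass_basic[OF G_cont \<epsilon>] by blast
  show ?thesis
  proof
    show "(\<lambda>x. F (\<theta> x)) \<in> trig_poly" using F(1) by (simp add: RR_def)
    show "\<bar>F (\<theta> x)\<bar> \<le> B + \<epsilon>" for x
      using F(2)[OF \<theta>T[of x]] g_bd[of "A (\<theta> x)"] by (simp add: G_def)
    show "\<bar>f x - F (\<theta> x)\<bar> \<le> \<epsilon>" if x: "norm x \<le> R" for x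
    proof -
      have "A (\<theta> x) = x"
      proof (rule vec_eq_iff[THEN iffD2], rule allI)
        fix i
        have "\<bar>x $ i\<bar> \<le> norm x" by (rule component_le_norm_cart)
        then have "\<bar>x $ i\<bar> < P" using x R by (simp add: P_def)
        then have "pi / P * (- P) < pi / P * x $ i" "pi / P * x $ i < pi / P * P"
          using P by (intro mult_strict_left_mono; auto)+
        then have "-pi < pi / P * x $ i" "pi / P * x $ i < pi" using P by simp_all
        then have "Arg (cis (pi / P * x $ i)) = pi / P * x $ i"
          by (intro Arg_cis) auto
        then show "A (\<theta> x) $ i = x $ i" using P by (simp only: A_def \<theta>_def vec_lambda_beta) simp
      qed
      then have "G (\<theta> x) = f x" using x by (simp add: G_def g_def cut1)
      then show ?thesis using F(2)[OF \<theta>T[of x]] by simp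
    qed
  qed
qed

text \<open>
  A measurable witness event of probability at least \<open>1 - \<epsilon>\<close> is demanded instead of measurability
  of \<open>P\<close> itself, so that such statements can be combined and weakened freely.
\<close>

definition prob_eventually :: "'w measure \<Rightarrow> real \<Rightarrow> (nat \<Rightarrow> 'w \<Rightarrow> bool) \<Rightarrow> bool" where
  "prob_eventually M \<epsilon> P \<longleftrightarrow>
     (\<forall>\<^sub>F n in sequentially. \<exists>A\<in>sets M. measure M (space M - A) \<le> \<epsilon> \<and> (\<forall>\<omega>\<in>A. P n \<omega>))"

text \<open>
  With high probability: with probability tending to one.
\<close>

definition whp :: "'w measure \<Rightarrow> (nat \<Rightarrow> 'w \<Rightarrow> bool) \<Rightarrow> bool" where
  "whp M P \<longleftrightarrow> (\<forall>\<epsilon>>0. prob_eventually M \<epsilon> P)"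

definition tight_seq :: "'w measure \<Rightarrow> (nat \<Rightarrow> 'w \<Rightarrow> 'a::real_normed_vector) \<Rightarrow> bool" where
  "tight_seq M X \<longleftrightarrow> (\<forall>\<epsilon>>0. \<exists>R. prob_eventually M \<epsilon> (\<lambda>n \<omega>. norm (X n \<omega>) \<le> R))"

lemma prob_eventually_mono:
  assumes "prob_eventually M \<epsilon> P" "\<And>n \<omega>. n \<ge> N \<Longrightarrow> \<omega> \<in> space M \<Longrightarrow> P n \<omega> \<Longrightarrow> Q n \<omega>"
  shows "prob_eventually M \<epsilon> Q"
  using assms(1) eventually_ge_at_top[of N] unfolding prob_eventually_def
  by eventually_elim (use assms(2) sets.sets_into_space in blast)

lemma whp_mono:
  assumes "whp M P" "\<And>n \<omega>. n \<ge> N \<Longrightarrow> \<omega> \<in> space M \<Longrightarrow> P n \<omega> \<Longrightarrow> Q n \<omega>"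
  shows "whp M Q"
  using assms prob_eventually_mono unfolding whp_def by metis

context prob_space
begin

lemma prob_eventually_conj:
  assumes "prob_eventually M \<epsilon> P" "prob_eventually M \<epsilon>' Q"
  shows "prob_eventually M (\<epsilon> + \<epsilon>') (\<lambda>n \<omega>. P n \<omega> \<and> Q n \<omega>)"
  using assms unfolding prob_eventually_def
proof eventually_elim
  case (elim n)
  then obtain A B where A: "A \<in> events" "prob (space M - A) \<le> \<epsilon>" "\<forall>\<omega>\<in>A. P n \<omega>"
    and B: "B \<in> events" "prob (space M - B) \<le> \<epsilon>'" "\<forall>\<omega>\<in>B. Q n \<omega>" by blast
  have "prob (space M - A \<inter> B) = prob ((space M - A) \<union> (space M - B))"
    by (rule arg_cong[where f = prob]) auto
  also have "\<dots> \<le> \<epsilon> + \<epsilon>'"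
    using A B by (intro order_trans[OF measure_Un_le] add_mono) auto
  finally show ?case using A B by (intro bexI[of _ "A \<inter> B"]) auto
qed

lemma whp_conj:
  assumes "whp M P" "whp M Q"
  shows "whp M (\<lambda>n \<omega>. P n \<omega> \<and> Q n \<omega>)"
  unfolding whp_def
proof (intro allI impI)
  fix \<epsilon> :: real assume "0 < \<epsilon>"
  then have "prob_eventually M (\<epsilon>/2 + \<epsilon>/2) (\<lambda>n \<omega>. P n \<omega> \<and> Q n \<omega>)"
    using assms unfolding whp_def by (intro prob_eventually_conj) auto
  then show "prob_eventually M \<epsilon> (\<lambda>n \<omega>. P n \<omega> \<and> Q n \<omega>)" by simp
qed

lemma whp_AE:
  assumes "\<And>n. AE \<omega> in M. P n \<omega>"
  shows "whp M P"
  unfolding whp_def prob_eventually_def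
proof (intro allI impI always_eventually)
  fix \<epsilon> :: real and n assume "0 < \<epsilon>"
  obtain N where N: "N \<in> null_sets M" "{\<omega> \<in> space M. \<not> P n \<omega>} \<subseteq> N"
    using assms[of n] by (auto simp: eventually_ae_filter)
  have "space M - (space M - N) = N" using N by (auto dest: null_sets.sets_into_space sets.sets_into_space[OF null_setsD2])
  then show "\<exists>A\<in>events. prob (space M - A) \<le> \<epsilon> \<and> (\<forall>\<omega>\<in>A. P n \<omega>)"
    using N \<open>0 < \<epsilon>\<close> by (intro bexI[of _ "space M - N"]) (auto simp: measure_def)
qed

lemma whp_second_moment:
  assumes [measurable]: "\<And>n. X n \<in> borel_measurable M" and int: "\<And>n. integrable M (\<lambda>\<omega>. (X n \<omega>)\<^sup>2)"
    and lim: "(\<lambda>n. \<integral>\<omega>. (X n \<omega>)\<^sup>2 \<partial>M) \<longlonglongrightarrow> 0" and \<eta>: "(0::real) < \<eta>"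
  shows "whp M (\<lambda>n \<omega>. \<bar>X n \<omega>\<bar> < \<eta>)"
  unfolding whp_def prob_eventually_def
proof (intro allI impI)
  fix \<epsilon> :: real assume "0 < \<epsilon>"
  then have "\<forall>\<^sub>F n in sequentially. (\<integral>\<omega>. (X n \<omega>)\<^sup>2 \<partial>M) < \<epsilon> * \<eta>\<^sup>2"
    using \<eta> by (intro order_tendstoD(2)[OF lim]) auto
  then show "\<forall>\<^sub>F n in sequentially. \<exists>A\<in>events. prob (space M - A) \<le> \<epsilon> \<and> (\<forall>\<omega>\<in>A. \<bar>X n \<omega>\<bar> < \<eta>)"
  proof eventually_elim
    case (elim n)
    have "prob {\<omega> \<in> space M. \<eta>\<^sup>2 \<le> (X n \<omega>)\<^sup>2} \<le> (\<integral>\<omega>. (X n \<omega>)\<^sup>2 \<partial>M) / \<eta>\<^sup>2"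
      by (intro integral_Markov_inequality_measure[where A = "space M"] int) (use \<eta> in auto)
    also have "\<dots> \<le> \<epsilon>" using elim \<eta> by (simp add: field_simps)
    finally have "prob {\<omega> \<in> space M. \<eta>\<^sup>2 \<le> (X n \<omega>)\<^sup>2} \<le> \<epsilon>" .
    moreover have "space M - {\<omega> \<in> space M. \<bar>X n \<omega>\<bar> < \<eta>} = {\<omega> \<in> space M. \<eta>\<^sup>2 \<le> (X n \<omega>)\<^sup>2}"
      using \<eta> by (auto simp: abs_le_square_iff[symmetric] not_less)
    ultimately show ?case by (intro bexI[of _ "{\<omega> \<in> space M. \<bar>X n \<omega>\<bar> < \<eta>}"]) auto
  qed
qed

lemma tight_second_moment:
  fixes X :: "nat \<Rightarrow> 'a \<Rightarrow> 'b::euclidean_space"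
  assumes [measurable]: "\<And>n. X n \<in> borel_measurable M" and int: "\<And>n. integrable M (\<lambda>\<omega>. (norm (X n \<omega>))\<^sup>2)"
    and bd: "\<And>n. (\<integral>\<omega>. (norm (X n \<omega>))\<^sup>2 \<partial>M) \<le> C"
  shows "tight_seq M X"
  unfolding tight_seq_def prob_eventually_def
proof (intro allI impI)
  fix \<epsilon> :: real assume \<epsilon>: "0 < \<epsilon>"
  define R where "R = (1 + \<bar>C\<bar>) / \<epsilon> + 1"
  have "\<epsilon> * R = 1 + \<bar>C\<bar> + \<epsilon>" using \<epsilon> by (simp add: R_def field_simps)
  then have R: "1 \<le> R" "C \<le> \<epsilon> * R" using \<epsilon> by (auto simp: R_def)
  have R2: "C \<le> \<epsilon> * R\<^sup>2"
    using self_le_power[OF R(1), of 2] \<epsilon> by (intro order_trans[OF R(2)] mult_left_mono) auto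
  show "\<exists>R. \<forall>\<^sub>F n in sequentially. \<exists>A\<in>events. prob (space M - A) \<le> \<epsilon> \<and> (\<forall>\<omega>\<in>A. norm (X n \<omega>) \<le> R)"
  proof (intro exI[of _ R] always_eventually allI)
    fix n
    have "prob {\<omega> \<in> space M. R\<^sup>2 \<le> (norm (X n \<omega>))\<^sup>2} \<le> (\<integral>\<omega>. (norm (X n \<omega>))\<^sup>2 \<partial>M) / R\<^sup>2"
      by (intro integral_Markov_inequality_measure[where A = "space M"] int) (use R in auto)
    also have "\<dots> \<le> \<epsilon>" using order_trans[OF bd[of n] R2] R by (simp add: field_simps)
    finally have p: "prob {\<omega> \<in> space M. R\<^sup>2 \<le> (norm (X n \<omega>))\<^sup>2} \<le> \<epsilon>" .
    have "space M - {\<omega> \<in> space M. norm (X n \<omega>) < R} = {\<omega> \<in> space M. R\<^sup>2 \<le> (norm (X n \<omega>))\<^sup>2}"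
      using R by (auto simp: not_less intro: power_mono dest: power2_le_imp_le)
    with p show "\<exists>A\<in>events. prob (space M - A) \<le> \<epsilon> \<and> (\<forall>\<omega>\<in>A. norm (X n \<omega>) \<le> R)"
      by (intro bexI[of _ "{\<omega> \<in> space M. norm (X n \<omega>) < R}"]) auto
  qed
qed

lemma expectation_le_of_prob:
  fixes h :: "'a \<Rightarrow> real"
  assumes A: "A \<in> events" "prob (space M - A) \<le> \<epsilon>" and [measurable]: "h \<in> borel_measurable M"
    and h: "\<And>\<omega>. \<omega> \<in> space M \<Longrightarrow> \<bar>h \<omega>\<bar> \<le> K" "\<And>\<omega>. \<omega> \<in> A \<Longrightarrow> \<bar>h \<omega>\<bar> \<le> \<eta>" and nn: "0 \<le> \<eta>" "0 \<le> K"
  shows "(\<integral>\<omega>. \<bar>h \<omega>\<bar> \<partial>M) \<le> \<eta> + K * \<epsilon>"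
proof -
  have "(\<integral>\<omega>. \<bar>h \<omega>\<bar> \<partial>M) \<le> (\<integral>\<omega>. \<eta> + K * indicator (space M - A) \<omega> \<partial>M)"
  proof (rule integral_mono)
    show "integrable M (\<lambda>\<omega>. \<bar>h \<omega>\<bar>)"
      by (rule integrable_const_bound[where B = K]) (use h in auto)
    show "integrable M (\<lambda>\<omega>. \<eta> + K * indicator (space M - A) \<omega>)"
      using A nn by (intro integrable_const_bound[where B = "\<eta> + K"]) (auto simp: indicator_def)
    show "\<bar>h \<omega>\<bar> \<le> \<eta> + K * indicator (space M - A) \<omega>" if "\<omega> \<in> space M" for \<omega>
      using h that nn by (cases "\<omega> \<in> A") (auto simp: add_increasing)
  qed
  also have "\<dots> = \<eta> + K * prob (space M - A)"
  proof -
    have "integrable M (\<lambda>\<omega>. K * indicator (space M - A) \<omega>)"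
      using A nn by (intro integrable_const_bound[where B = K]) (auto simp: indicator_def)
    then show ?thesis using A by (simp add: prob_space)
  qed
  also have "\<dots> \<le> \<eta> + K * \<epsilon>" using A nn by (intro add_left_mono mult_left_mono) auto
  finally show ?thesis .
qed

text \<open>
  The exponential \<open>iexp\<close> is Lipschitz and bounded, so a difference that vanishes in probability
  changes characteristic functions by a vanishing amount.
\<close>

lemma char_slutsky:
  fixes X Y :: "nat \<Rightarrow> 'a \<Rightarrow> 'b::euclidean_space"
  assumes [measurable]: "\<And>n. X n \<in> borel_measurable M" "\<And>n. Y n \<in> borel_measurable M"
    and close: "\<And>\<eta>. 0 < \<eta> \<Longrightarrow> whp M (\<lambda>n \<omega>. norm (X n \<omega> - Y n \<omega>) \<le> \<eta>)"
    and lim: "(\<lambda>n. \<integral>\<omega>. iexp (a \<bullet> X n \<omega>) \<partial>M) \<longlonglongrightarrow> l"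
  shows "(\<lambda>n. \<integral>\<omega>. iexp (a \<bullet> Y n \<omega>) \<partial>M) \<longlonglongrightarrow> l"
proof -
  have "(\<lambda>n. (\<integral>\<omega>. iexp (a \<bullet> X n \<omega>) \<partial>M) - (\<integral>\<omega>. iexp (a \<bullet> Y n \<omega>) \<partial>M)) \<longlonglongrightarrow> 0"
  proof (rule LIMSEQ_I, goal_cases)
    case (1 r)
    define \<eta> where "\<eta> = r / 4 / (norm a + 1)"
    have \<eta>: "0 < \<eta>" using 1 by (auto simp: \<eta>_def intro!: divide_pos_pos add_nonneg_pos)
    have a\<eta>: "norm a * \<eta> \<le> r / 4"
    proof -
      have "norm a * \<eta> \<le> (norm a + 1) * \<eta>" using \<eta> by (intro mult_right_mono) auto
      also have "\<dots> = r / 4"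
      proof -
        have "norm a + 1 \<noteq> 0" using norm_ge_zero[of a] by linarith
        then show ?thesis unfolding \<eta>_def
          by (subst times_divide_eq_right) (rule nonzero_mult_div_cancel_left)
      qed
      finally show ?thesis .
    qed
    have "prob_eventually M (r / 8) (\<lambda>n \<omega>. norm (X n \<omega> - Y n \<omega>) \<le> \<eta>)"
      using close[OF \<eta>] 1 unfolding whp_def by auto
    then have "\<forall>\<^sub>F n in sequentially. norm ((\<integral>\<omega>. iexp (a \<bullet> X n \<omega>) \<partial>M) - (\<integral>\<omega>. iexp (a \<bullet> Y n \<omega>) \<partial>M)) < r"
      unfolding prob_eventually_def
    proof eventually_elim
      case (elim n)
      then obtain A where A: "A \<in> events" "prob (space M - A) \<le> r / 8" "\<forall>\<omega>\<in>A. norm (X n \<omega> - Y n \<omega>) \<le> \<eta>" by blast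
      define h where "h \<omega> = norm (iexp (a \<bullet> X n \<omega>) - iexp (a \<bullet> Y n \<omega>))" for \<omega>
      have [measurable]: "h \<in> borel_measurable M" unfolding h_def by measurable
      have "(\<integral>\<omega>. iexp (a \<bullet> X n \<omega>) \<partial>M) - (\<integral>\<omega>. iexp (a \<bullet> Y n \<omega>) \<partial>M) =
          (\<integral>\<omega>. iexp (a \<bullet> X n \<omega>) - iexp (a \<bullet> Y n \<omega>) \<partial>M)"
        by (intro Bochner_Integration.integral_diff[symmetric] integrable_const_bound[where B = 1]) auto
      also have "norm \<dots> \<le> (\<integral>\<omega>. \<bar>h \<omega>\<bar> \<partial>M)"
        unfolding h_def abs_norm_cancel by (rule integral_norm_bound)
      also have "\<dots> \<le> r / 4 + 2 * (r / 8)"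
      proof (rule expectation_le_of_prob[OF A(1,2)])
        show "\<bar>h \<omega>\<bar> \<le> 2" for \<omega> unfolding h_def abs_norm_cancel
          by (rule order_trans[OF norm_triangle_ineq4]) simp
        show "\<bar>h \<omega>\<bar> \<le> r / 4" if "\<omega> \<in> A" for \<omega>
        proof -
          have "iexp (a \<bullet> X n \<omega>) - iexp (a \<bullet> Y n \<omega>) = iexp (a \<bullet> Y n \<omega>) * (iexp (a \<bullet> (X n \<omega> - Y n \<omega>)) - 1)"
            by (simp add: algebra_simps exp_add[symmetric] inner_diff_right)
          then have "h \<omega> = norm (iexp (a \<bullet> (X n \<omega> - Y n \<omega>)) - 1)"
            by (simp add: h_def norm_mult)
          also have "\<dots> \<le> \<bar>a \<bullet> (X n \<omega> - Y n \<omega>)\<bar>"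
            using iexp_approx1[of "a \<bullet> (X n \<omega> - Y n \<omega>)" 0] by simp
          also have "\<dots> \<le> norm a * norm (X n \<omega> - Y n \<omega>)" by (rule Cauchy_Schwarz_ineq2)
          also have "\<dots> \<le> norm a * \<eta>" using A that by (intro mult_left_mono) auto
          finally show ?thesis using a\<eta> by (simp add: h_def)
        qed
      qed (use 1 in auto)
      finally show ?case using 1 by simp
    qed
    then show ?case by (simp add: eventually_sequentially)
  qed
  from tendsto_diff[OF lim this] show ?thesis by simp
qed

text \<open>
  Levy's continuity theorem in several dimensions, for tight sequences: expectations of
  trigonometric polynomials converge, and outside an event of small probability a bounded
  continuous function is uniformly close to one of them.
\<close>

theorem continuity_theorem:
  fixes X :: "nat \<Rightarrow> 'a \<Rightarrow> real^'s"
  assumes X[measurable]: "\<And>n. X n \<in> borel_measurable M" and tight: "tight_seq M X"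
    and \<mu>: "prob_space \<mu>" "sets \<mu> = sets borel"
    and lim: "\<And>a. (\<lambda>n. \<integral>\<omega>. iexp (a \<bullet> X n \<omega>) \<partial>M) \<longlonglongrightarrow> (\<integral>x. iexp (a \<bullet> x) \<partial>\<mu>)"
  shows "converges_in_distribution M X \<mu>"
proof -
  interpret \<mu>: prob_space \<mu> by (rule \<mu>)
  have m\<mu>: "h \<in> borel_measurable \<mu>" if "h \<in> borel_measurable borel" for h :: "real^'s \<Rightarrow> 'c::topological_space"
    using that by (simp add: measurable_cong_sets[OF \<mu>(2) refl])
  have trig: "(\<lambda>n. \<integral>\<omega>. h (X n \<omega>) \<partial>M) \<longlonglongrightarrow> (\<integral>x. h x \<partial>\<mu>)" if "h \<in> trig_poly" for h
    using that
  proof induction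
    case (cos a \<phi>)
    have i: "integrable M (\<lambda>\<omega>. iexp (a \<bullet> X n \<omega>))" for n
      by (rule integrable_const_bound[where B = 1]) auto
    have i': "integrable \<mu> (\<lambda>x. iexp (a \<bullet> x))"
      by (rule \<mu>.integrable_const_bound[where B = 1]) (auto intro!: m\<mu>)
    have e: "cos (a \<bullet> x + \<phi>) = Re (iexp \<phi> * iexp (a \<bullet> x))" for x
      by (simp add: exp_add[symmetric] Re_exp algebra_simps)
    have "(\<lambda>n. Re (iexp \<phi> * (\<integral>\<omega>. iexp (a \<bullet> X n \<omega>) \<partial>M))) \<longlonglongrightarrow> Re (iexp \<phi> * (\<integral>x. iexp (a \<bullet> x) \<partial>\<mu>))"
      by (intro tendsto_intros lim)
    then show ?case unfolding e
      by (simp only: integral_mult_right_zero[symmetric] integral_Re[symmetric] integrable_mult_right i i')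
  next
    case (scale h c)
    from tendsto_mult_left[OF scale.IH, of c] show ?case by simp
  next
    case (add h k)
    have i: "integrable M (\<lambda>\<omega>. h (X n \<omega>))" "integrable \<mu> h" if h: "h \<in> trig_poly" for h :: "real^'s \<Rightarrow> real" and n
    proof -
      obtain B where "\<forall>x. \<bar>h x\<bar> \<le> B" using trig_poly_bounded[OF h] by blast
      then have B: "\<And>x. \<bar>h x\<bar> \<le> B" by blast
      note [measurable] = trig_poly_measurable[OF h]
      show "integrable M (\<lambda>\<omega>. h (X n \<omega>))" by (rule integrable_const_bound[where B = B]) (use B in auto)
      show "integrable \<mu> h" by (rule \<mu>.integrable_const_bound[where B = B]) (use B in \<open>auto intro!: m\<mu>\<close>)
    qed
    from tendsto_add[OF add.IH] show ?case using i[OF add.hyps(1)] i[OF add.hyps(2)] by simp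
  qed
  show ?thesis unfolding converges_in_distribution_def
  proof (intro allI impI, elim conjE)
    fix f :: "real^'s \<Rightarrow> real" assume f: "continuous_on UNIV f" "bounded (range f)"
    have [measurable]: "f \<in> borel_measurable borel" by (intro borel_measurable_continuous_onI f)
    obtain B where B: "\<And>x. \<bar>f x\<bar> \<le> B" using f(2) by (auto simp: bounded_iff)
    have B0: "0 \<le> B" using B[of 0] by linarith
    show "(\<lambda>n. \<integral>\<omega>. f (X n \<omega>) \<partial>M) \<longlonglongrightarrow> (\<integral>x. f x \<partial>\<mu>)"
    proof (rule LIMSEQ_I, goal_cases)
      case (1 r)
      \<comment> \<open>The two approximation errors \<open>\<epsilon> + (2B+1) \<epsilon>\<close> together use up half of \<open>r\<close>.\<close>
      define \<epsilon> where "\<epsilon> = min 1 (r / (2 * (4 + 2 * (2 * B + 1))))"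
      have \<epsilon>: "0 < \<epsilon>" "\<epsilon> \<le> 1" using 1 B0 by (auto simp: \<epsilon>_def)
      have "\<epsilon> * (4 + 2 * (2 * B + 1)) \<le> r / (2 * (4 + 2 * (2 * B + 1))) * (4 + 2 * (2 * B + 1))"
        using B0 by (intro mult_right_mono) (auto simp: \<epsilon>_def)
      also have "\<dots> = r / 2" using B0 by (simp add: field_simps)
      finally have \<epsilon>r: "2 * \<epsilon> + 2 * ((2 * B + 1) * \<epsilon>) < r" using \<epsilon> 1 by (simp add: algebra_simps)
      obtain R1 where R1: "prob_eventually M \<epsilon> (\<lambda>n \<omega>. norm (X n \<omega>) \<le> R1)"
        using tight \<epsilon> unfolding tight_seq_def by blast
      have "(\<lambda>n. \<mu>.prob {x. norm x > real n}) \<longlonglongrightarrow> \<mu>.prob (\<Inter>n. {x. norm x > real n})"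
        by (rule \<mu>.finite_Lim_measure_decseq) (auto simp: \<mu> decseq_def)
      moreover have "(\<Inter>n. {x :: real^'s. norm x > real n}) = {}"
        by (auto simp: not_less) (meson real_arch_simple not_less)
      ultimately have "(\<lambda>n. \<mu>.prob {x. norm x > real n}) \<longlonglongrightarrow> 0" by simp
      then have "\<forall>\<^sub>F n in sequentially. \<mu>.prob {x. norm x > real n} < \<epsilon>" by (rule order_tendstoD) (rule \<epsilon>)
      then obtain N where N: "\<mu>.prob {x. norm x > real N} < \<epsilon>" by (auto simp: eventually_sequentially)
      define R where "R = max 1 (max R1 (real N))"
      have R: "0 < R" "R1 \<le> R" "real N \<le> R" by (auto simp: R_def)
      obtain h where h: "h \<in> trig_poly" "\<And>x. \<bar>h x\<bar> \<le> B + \<epsilon>" "\<And>x. norm x \<le> R \<Longrightarrow> \<bar>f x - h x\<bar> \<le> \<epsilon>"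
        by (rule torus_approximation[OF f(1) B R(1) \<epsilon>(1)]) blast
      note [measurable] = trig_poly_measurable[OF h(1)]
      have diff: "\<bar>f x - h x\<bar> \<le> 2 * B + 1" for x using B[of x] h(2)[of x] \<epsilon> by linarith
      have I: "\<bar>(\<integral>x. f (Z x) \<partial>Q) - (\<integral>x. h (Z x) \<partial>Q)\<bar> \<le> \<epsilon> + (2 * B + 1) * \<epsilon>"
        if "prob_space Q" and Z[measurable]: "Z \<in> borel_measurable Q" and "A \<in> sets Q" "measure Q (space Q - A) \<le> \<epsilon>"
          "\<And>x. x \<in> A \<Longrightarrow> norm (Z x) \<le> R" for Q :: "'q measure" and Z A
      proof -
        interpret Q: prob_space Q by fact
        have "(\<integral>x. f (Z x) \<partial>Q) - (\<integral>x. h (Z x) \<partial>Q) = (\<integral>x. f (Z x) - h (Z x) \<partial>Q)"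
          by (intro Bochner_Integration.integral_diff[symmetric] Q.integrable_const_bound[where B = "B + \<epsilon>"])
             (use B h(2) \<epsilon> in \<open>auto intro!: AE_I2 add_increasing2\<close>)
        also have "\<bar>\<dots>\<bar> \<le> (\<integral>x. \<bar>f (Z x) - h (Z x)\<bar> \<partial>Q)" by (rule integral_abs_bound)
        also have "\<dots> \<le> \<epsilon> + (2 * B + 1) * \<epsilon>"
          by (rule Q.expectation_le_of_prob[OF that(3,4)]) (use diff h(3) that(5) \<epsilon> B0 in auto)
        finally show ?thesis .
      qed
      have I\<mu>: "\<bar>(\<integral>x. f x \<partial>\<mu>) - (\<integral>x. h x \<partial>\<mu>)\<bar> \<le> \<epsilon> + (2 * B + 1) * \<epsilon>"
      proof -
        have "space \<mu> = UNIV" using sets_eq_imp_space_eq[OF \<mu>(2)] by simp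
        then have "space \<mu> - {x. norm x \<le> real N} = {x. norm x > real N}" by auto
        then show ?thesis using I[of \<mu> "\<lambda>x. x" "{x. norm x \<le> real N}"] N R \<mu>
          by (auto intro!: m\<mu>)
      qed
      have "\<forall>\<^sub>F n in sequentially. norm ((\<integral>\<omega>. h (X n \<omega>) \<partial>M) - (\<integral>x. h x \<partial>\<mu>)) < r - (2 * \<epsilon> + 2 * ((2 * B + 1) * \<epsilon>))"
        using tendstoD[OF trig[OF h(1)], of "r - (2 * \<epsilon> + 2 * ((2 * B + 1) * \<epsilon>))"] \<epsilon>r by (simp add: dist_norm)
      with R1 have "\<forall>\<^sub>F n in sequentially. norm ((\<integral>\<omega>. f (X n \<omega>) \<partial>M) - (\<integral>x. f x \<partial>\<mu>)) < r"
        unfolding prob_eventually_def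
      proof eventually_elim
        case (elim n)
        then obtain A where A: "A \<in> events" "prob (space M - A) \<le> \<epsilon>" "\<forall>\<omega>\<in>A. norm (X n \<omega>) \<le> R1" by blast
        have "\<bar>(\<integral>\<omega>. f (X n \<omega>) \<partial>M) - (\<integral>\<omega>. h (X n \<omega>) \<partial>M)\<bar> \<le> \<epsilon> + (2 * B + 1) * \<epsilon>"
          by (rule I[OF prob_space_axioms X A(1,2)]) (use A(3) R in force)
        then show ?case using I\<mu> elim unfolding real_norm_def by linarith
      qed
      then show ?case by (simp add: eventually_sequentially)
    qed
  qed
qed

end

section \<open>The multivariate normal law\<close>

text \<open>
  The matrix inverse is defined by choice; this is its defining property.
\<close>

lemma matrix_inv_mult:
  fixes A :: "real^'n^'n"
  assumes "invertible A"
  shows "A ** matrix_inv A = mat 1" "matrix_inv A ** A = mat 1"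
  using assms someI_ex[of "\<lambda>A'. A ** A' = mat 1 \<and> A' ** A = mat 1"]
  unfolding invertible_def matrix_inv_def by blast+

lemma matrix_inv_eqI:
  fixes A B :: "real^'n^'n"
  assumes "A ** B = mat 1"
  shows "matrix_inv A = B"
proof -
  have BA: "B ** A = mat 1" using assms by (rule matrix_left_right_inverse[THEN iffD1])
  then have "invertible A" using assms by (auto simp: invertible_def)
  have "matrix_inv A = (B ** A) ** matrix_inv A" by (simp add: BA)
  also have "\<dots> = B" by (simp add: matrix_mul_assoc[symmetric] matrix_inv_mult[OF \<open>invertible A\<close>])
  finally show ?thesis .
qed

lemma matrix_adjoint_inner:
  fixes A :: "real^'n^'m"
  shows "(A *v x) \<bullet> y = x \<bullet> (transpose A *v y)"
proof -
  have "(A *v x) \<bullet> y = y \<bullet> (A *v x)" by (rule inner_commute)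
  also have "\<dots> = (y v* A) \<bullet> x" by (rule dot_lmul_matrix[symmetric])
  also have "\<dots> = x \<bullet> (y v* A)" by (rule inner_commute)
  finally show ?thesis by (simp only: transpose_matrix_vector)
qed

text \<open>
  Boxes determine Lebesgue measure, and the preimage of a box is a linear image of it under the
  inverse, whose volume is known.
\<close>

lemma lborel_linear_density:
  fixes B :: "real^('n::_)^('n::{finite,wellorder})"
  assumes B: "invertible B"
  shows "lborel = density (distr lborel borel (\<lambda>x. B *v x)) (\<lambda>_. ennreal \<bar>det B\<bar>)"
proof (rule lborel_eqI, goal_cases)
  case (1 l u)
  have m[measurable]: "(\<lambda>x. B *v x) \<in> borel_measurable borel"
    by (intro borel_measurable_continuous_onI continuous_intros)
  define B' where "B' = matrix_inv B"
  have inv: "B ** B' = mat 1" "B' ** B = mat 1" using matrix_inv_mult[OF B] by (auto simp: B'_def)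
  have det: "det B * det B' = 1" using arg_cong[OF inv(1), of det] by (simp add: det_mul)
  have vim: "(\<lambda>x. B *v x) -` box l u = (\<lambda>x. B' *v x) ` box l u"
  proof (intro equalityI subsetI)
    fix x assume "x \<in> (\<lambda>x. B *v x) -` box l u"
    moreover have "x = B' *v (B *v x)" by (simp add: matrix_vector_mul_assoc inv)
    ultimately show "x \<in> (\<lambda>x. B' *v x) ` box l u" by (intro image_eqI[where x = "B *v x"]) auto
  next
    fix x assume "x \<in> (\<lambda>x. B' *v x) ` box l u"
    then show "x \<in> (\<lambda>x. B *v x) -` box l u" by (auto simp: matrix_vector_mul_assoc inv)
  qed
  have fin: "emeasure lborel ((\<lambda>x. B' *v x) ` box l u) \<noteq> \<infinity>"
  proof -
    have "bounded ((\<lambda>x. B' *v x) ` box l u)"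
      by (intro bounded_linear_image bounded_box) simp
    then show ?thesis using emeasure_bounded_finite by (metis less_irrefl infinity_ennreal_def)
  qed
  have sb: "(\<lambda>x. B' *v x) ` box l u \<in> sets borel"
    unfolding vim[symmetric] using measurable_sets[OF m, of "box l u"] by simp
  have "measure lebesgue ((\<lambda>x. B' *v x) ` box l u) = \<bar>det (matrix ((*v) B'))\<bar> * measure lebesgue (box l u)"
    by (intro measure_lebesgue_linear_transformation) auto
  then have "measure lborel ((\<lambda>x. B' *v x) ` box l u) = \<bar>det B'\<bar> * measure lborel (box l u)"
    using sb by (simp add: measure_completion)
  then have "emeasure lborel ((\<lambda>x. B *v x) -` box l u) = ennreal (\<bar>det B'\<bar> * measure lborel (box l u))"
    unfolding vim by (subst emeasure_eq_ennreal_measure) (use fin in auto)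
  moreover have "\<bar>det B\<bar> * \<bar>det B'\<bar> = 1" using det by (simp add: abs_mult[symmetric])
  ultimately have "ennreal \<bar>det B\<bar> * emeasure lborel ((\<lambda>x. B *v x) -` box l u) = ennreal (measure lborel (box l u))"
    by (simp add: ennreal_mult[symmetric] mult.assoc[symmetric])
  then show ?case
    using 1 by (simp add: emeasure_density nn_integral_cmult emeasure_distr measure_lborel_box)
qed simp

lemma sum_neg_half_squares:
  fixes x :: "'a::euclidean_space"
  shows "(\<Sum>b\<in>Basis. - (x \<bullet> b)\<^sup>2 / 2) = - (x \<bullet> x) / 2"
proof -
  have "x \<bullet> x = (\<Sum>b\<in>Basis. (x \<bullet> b)\<^sup>2)"
    unfolding power2_eq_square by (rule euclidean_inner)
  then show ?thesis by (simp add: sum_negf sum_divide_distrib)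
qed

lemma integral_iexp_std_normal:
  fixes a :: "'a::euclidean_space"
  shows "(\<integral>z. (\<Prod>b\<in>Basis. std_normal_density (z \<bullet> b)) *\<^sub>R iexp (a \<bullet> z) \<partial>lborel) = of_real (exp (- (a \<bullet> a) / 2))"
proof -
  define F where "F b x = std_normal_density x *\<^sub>R iexp ((a \<bullet> b) * x)" for b x
  have Fm[measurable]: "F b \<in> borel_measurable borel" for b unfolding F_def by measurable
  have "(\<integral>z. (\<Prod>b\<in>Basis. std_normal_density (z \<bullet> b)) *\<^sub>R iexp (a \<bullet> z) \<partial>lborel) =
        (\<integral>z. (\<Prod>b\<in>Basis. F b (z \<bullet> b)) \<partial>lborel)"
  proof (intro Bochner_Integration.integral_cong refl)
    fix z :: 'a
    have "iexp (a \<bullet> z) = (\<Prod>b\<in>Basis. iexp ((a \<bullet> b) * (z \<bullet> b)))"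
      by (subst euclidean_inner) (simp add: exp_sum sum_distrib_left flip: of_real_mult)
    then show "(\<Prod>b\<in>Basis. std_normal_density (z \<bullet> b)) *\<^sub>R iexp (a \<bullet> z) = (\<Prod>b\<in>Basis. F b (z \<bullet> b))"
      by (simp add: F_def scaleR_conv_of_real prod.distrib)
  qed
  also have "\<dots> = (\<integral>f. (\<Prod>b\<in>Basis. F b (f b)) \<partial>(\<Pi>\<^sub>M b\<in>Basis. lborel))"
    by (subst lborel_eq, subst integral_distr) (auto simp: inner_sum_left inner_Basis if_distrib sum.delta cong: if_cong)
  also have "\<dots> = (\<Prod>b\<in>Basis. \<integral>x. F b x \<partial>lborel)"
  proof -
    interpret product_sigma_finite "\<lambda>_::'a. lborel :: real measure" ..
    have "integrable lborel (F b)" for b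
    proof (rule Bochner_Integration.integrable_bound[of lborel std_normal_density])
      show "integrable lborel std_normal_density" using integrable_std_normal_moment[of 0] by simp
    qed (auto simp: F_def norm_mult)
    then show ?thesis by (intro product_integral_prod) auto
  qed
  also have "\<dots> = (\<Prod>b\<in>Basis. of_real (exp (- ((a \<bullet> b)^2) / 2)))"
  proof (intro prod.cong refl)
    fix b
    have "char std_normal_distribution (a \<bullet> b) = (\<integral>x. F b x \<partial>lborel)"
      unfolding char_def F_def by (subst integral_density) (auto simp: normal_density_nonneg)
    then show "(\<integral>x. F b x \<partial>lborel) = of_real (exp (- ((a \<bullet> b)^2) / 2))"
      by (simp add: char_std_normal_distribution)
  qed
  also have "\<dots> = of_real (exp (\<Sum>b\<in>Basis. - ((a \<bullet> b)^2) / 2))"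
    by (simp add: exp_sum)
  also have "(\<Sum>b\<in>Basis. - ((a \<bullet> b)^2) / 2) = - (a \<bullet> a) / 2"
    by (rule sum_neg_half_squares)
  finally show ?thesis .
qed

lemma prod_std_normal_density:
  fixes z :: "real^'n"
  shows "(\<Prod>b\<in>Basis. std_normal_density (z \<bullet> b)) = exp (- (z \<bullet> z) / 2) / sqrt ((2 * pi) ^ CARD('n))"
proof -
  have "(\<Prod>b\<in>Basis. std_normal_density (z \<bullet> b)) = (\<Prod>b\<in>(Basis :: (real^'n) set). 1 / sqrt (2 * pi)) * (\<Prod>b\<in>Basis. exp (- (z \<bullet> b)\<^sup>2 / 2))"
    unfolding std_normal_density_def by (rule prod.distrib)
  also have "(\<Prod>b\<in>(Basis :: (real^'n) set). 1 / sqrt (2 * pi)) = 1 / sqrt ((2 * pi) ^ CARD('n))"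
    unfolding real_sqrt_power by (simp add: power_divide)
  also have "(\<Prod>b\<in>Basis. exp (- (z \<bullet> b)\<^sup>2 / 2)) = exp (\<Sum>b\<in>Basis. - (z \<bullet> b)\<^sup>2 / 2)"
    by (simp add: exp_sum)
  also have "(\<Sum>b\<in>Basis. - (z \<bullet> b)\<^sup>2 / 2) = - (z \<bullet> z) / 2"
    by (rule sum_neg_half_squares)
  finally show ?thesis by simp
qed

definition pos_def_matrix :: "real^'n^'n \<Rightarrow> bool" where
  "pos_def_matrix S \<longleftrightarrow> transpose S = S \<and> (\<forall>x. x \<noteq> 0 \<longrightarrow> 0 < x \<bullet> (S *v x))"

lemma sym_matrix_inner:
  fixes S :: "real^'n^'n"
  assumes "transpose S = S"
  shows "x \<bullet> (S *v y) = y \<bullet> (S *v x)"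
  by (subst inner_commute, subst matrix_adjoint_inner) (simp only: assms)

lemma pos_def_invertible:
  fixes S :: "real^'n^'n"
  assumes "pos_def_matrix S"
  shows "invertible S"
proof -
  have "\<forall>x. S *v x = 0 \<longrightarrow> x = 0"
    using assms unfolding pos_def_matrix_def by (metis inner_zero_right less_irrefl)
  then show ?thesis
    by (simp add: invertible_left_inverse matrix_left_invertible_ker)
qed

text \<open>
  Gram-Schmidt orthonormalization with respect to the scalar product \<open>x \<bullet> S y\<close>.
\<close>

lemma gram_schmidt_columns:
  fixes S :: "real^'n^'n"
  assumes S: "pos_def_matrix S" and "k \<le> CARD('n)"
  shows "\<exists>v :: nat \<Rightarrow> real^'n. \<forall>i<k. \<forall>j<k. v i \<bullet> (S *v v j) = (if i = j then 1 else 0)"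
  using assms(2)
proof (induction k)
  case (Suc k)
  then have "\<exists>v :: nat \<Rightarrow> real^'n. \<forall>i<k. \<forall>j<k. v i \<bullet> (S *v v j) = (if i = j then 1 else 0)" by simp
  then obtain v :: "nat \<Rightarrow> real^'n"
    where "\<forall>i<k. \<forall>j<k. v i \<bullet> (S *v v j) = (if i = j then 1 else 0)" ..
  then have v: "v i \<bullet> (S *v v j) = (if i = j then 1 else 0)" if "i < k" "j < k" for i j
    using that by simp
  have sym: "x \<bullet> (S *v y) = y \<bullet> (S *v x)" for x y
    using S by (intro sym_matrix_inner) (simp add: pos_def_matrix_def)
  have "dim (span (v ` {..<k})) \<le> k"
    using dim_le_card[of "span (v ` {..<k})" "v ` {..<k}"] card_image_le[of "{..<k}" v] by (simp)
  then have "dim (span (v ` {..<k})) < DIM(real^'n)" using Suc.prems by simp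
  then have "span (v ` {..<k}) \<noteq> UNIV" by (intro notI) simp
  then obtain x where x: "x \<notin> span (v ` {..<k})" by blast
  define w where "w = x - (\<Sum>i<k. (v i \<bullet> (S *v x)) *\<^sub>R v i)"
  have "(\<Sum>i<k. (v i \<bullet> (S *v x)) *\<^sub>R v i) \<in> span (v ` {..<k})"
    by (intro span_sum span_scale span_base) auto
  then have "w \<noteq> 0" using x by (auto simp: w_def)
  then have w: "0 < w \<bullet> (S *v w)" using S by (simp add: pos_def_matrix_def)
  have vw: "v j \<bullet> (S *v w) = 0" if "j < k" for j
  proof -
    have "v j \<bullet> (S *v w) = v j \<bullet> (S *v x) - (\<Sum>i<k. (v i \<bullet> (S *v x)) * (v j \<bullet> (S *v v i)))"
      by (simp add: w_def matrix_vector_mult_diff_distrib inner_diff_right linear_sum[OF matrix_vector_mul_linear]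
          inner_sum_right matrix_vector_mult_scaleR)
    also have "(\<Sum>i<k. (v i \<bullet> (S *v x)) * (v j \<bullet> (S *v v i))) = (\<Sum>i<k. if i = j then v i \<bullet> (S *v x) else 0)"
      by (intro sum.cong) (use v that in auto)
    finally show ?thesis using that by (simp add: sum.delta)
  qed
  define v' where "v' = v(k := (1 / sqrt (w \<bullet> (S *v w))) *\<^sub>R w)"
  have "v' i \<bullet> (S *v v' j) = (if i = j then 1 else 0)" if ij: "i < Suc k" "j < Suc k" for i j
  proof (cases "i = k"; cases "j = k")
    assume "i = k" "j = k"
    then show ?thesis using w by (simp add: v'_def matrix_vector_mult_scaleR)
  next
    assume "i = k" "j \<noteq> k"
    then show ?thesis using vw[of j] ij by (simp add: v'_def sym[of w "v j"])
  next
    assume "i \<noteq> k" "j = k"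
    then show ?thesis using vw[of i] ij by (simp add: v'_def matrix_vector_mult_scaleR)
  next
    assume "i \<noteq> k" "j \<noteq> k"
    then show ?thesis using v[of i j] ij by (simp add: v'_def)
  qed
  then show ?case by (intro exI[of _ v']) blast
qed simp

lemma pos_def_factorization:
  fixes S :: "real^'n^'n"
  assumes S: "pos_def_matrix S"
  shows "\<exists>B :: real^'n^'n. transpose B ** S ** B = mat 1"
proof -
  obtain v :: "nat \<Rightarrow> real^'n" where v: "\<forall>i<CARD('n). \<forall>j<CARD('n). v i \<bullet> (S *v v j) = (if i = j then 1 else 0)"
    using gram_schmidt_columns[OF S order_refl] by blast
  obtain h :: "'n \<Rightarrow> nat" where h: "bij_betw h UNIV {0..<CARD('n)}"
    using ex_bij_betw_finite_nat[of "UNIV :: 'n set"] by auto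
  define B :: "real^'n^'n" where "B = (\<chi> i j. v (h j) $ i)"
  have col: "column j B = v (h j)" for j by (simp add: column_def B_def vec_eq_iff)
  have "(transpose B ** (S ** B)) $ i $ j = mat 1 $ i $ j" for i j
  proof -
    have "(transpose B ** (S ** B)) $ i $ j = column i B \<bullet> column j (S ** B)"
      by (simp add: matrix_matrix_mult_def inner_vec_def column_def transpose_def)
    also have "column j (S ** B) = S *v column j B"
      by (simp add: vec_eq_iff column_def matrix_matrix_mult_def matrix_vector_mult_def)
    also have "column i B \<bullet> (S *v column j B) = (if h i = h j then 1 else 0)"
    proof -
      have "h i < CARD('n)" "h j < CARD('n)" using bij_betwE[OF h] by auto
      then show ?thesis unfolding col using v by simp
    qed
    also have "\<dots> = mat 1 $ i $ j" using h by (auto simp: mat_def bij_betw_def inj_on_def)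
    finally show ?thesis .
  qed
  then have "transpose B ** S ** B = mat 1" by (simp add: vec_eq_iff matrix_mul_assoc)
  then show ?thesis by blast
qed

text \<open>
  With \<open>B\<close> such that \<open>B\<^sup>T S B = 1\<close>, one has \<open>S\<^sup>-\<^sup>1 = B B\<^sup>T\<close>, and the substitution \<open>x = B z\<close> reduces
  everything to the product of one-dimensional standard normal densities.
\<close>

lemma multivariate_normal_char:
  fixes S :: "real^('n::_)^('n::{finite,wellorder})"
  assumes S: "pos_def_matrix S"
  shows "prob_space (multivariate_normal 0 (matrix_inv S))"
    and "sets (multivariate_normal 0 (matrix_inv S)) = sets borel"
    and "(\<integral>x. iexp (a \<bullet> x) \<partial>multivariate_normal 0 (matrix_inv S)) = of_real (exp (- (a \<bullet> (matrix_inv S *v a)) / 2))"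
proof -
  obtain B :: "real^'n::_^'n::_" where B: "transpose B ** S ** B = mat 1" using pos_def_factorization[OF S] by blast
  have invS: "invertible S" by (rule pos_def_invertible[OF S])
  define V where "V = matrix_inv S"
  have SV: "S ** V = mat 1" "V ** S = mat 1" using matrix_inv_mult[OF invS] by (auto simp: V_def)
  have Vinv: "matrix_inv V = S" by (rule matrix_inv_eqI) (rule SV)
  have invB: "invertible B" unfolding invertible_left_inverse using B by blast
  have "B ** (transpose B ** S) = mat 1" using B by (rule matrix_left_right_inverse[THEN iffD1])
  then have BBS: "(B ** transpose B) ** S = mat 1" by (simp add: matrix_mul_assoc)
  have BB: "B ** transpose B = V"
  proof -
    have "B ** transpose B = ((B ** transpose B) ** S) ** V" by (simp only: matrix_mul_assoc[symmetric] SV matrix_mul_rid)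
    then show ?thesis by (simp add: BBS)
  qed
  have detV: "det V = (det B)\<^sup>2" unfolding BB[symmetric] by (simp add: det_mul power2_eq_square)
  have detB: "det B \<noteq> 0" using invB invertible_det_nz by blast
  have quad: "(B *v z) \<bullet> (S *v (B *v z)) = z \<bullet> z" for z
  proof -
    have "(B *v z) \<bullet> (S *v (B *v z)) = z \<bullet> (transpose B *v (S *v (B *v z)))"
      by (rule matrix_adjoint_inner)
    also have "transpose B *v (S *v (B *v z)) = z"
      by (simp only: matrix_vector_mul_assoc matrix_mul_assoc B matrix_vector_mul_lid)
    finally show ?thesis .
  qed
  define d where "d x = exp (- (x \<bullet> (S *v x)) / 2) / sqrt ((2 * pi) ^ CARD('n) * det V)" for x :: "real^'n::_"
  have mn: "multivariate_normal 0 V = density lborel (\<lambda>x. ennreal (d x))"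
    unfolding multivariate_normal_def Vinv d_def by simp
  have d_nn: "0 \<le> d x" for x unfolding d_def detV by simp
  have dB: "\<bar>det B\<bar> * d (B *v z) = (\<Prod>b\<in>Basis. std_normal_density (z \<bullet> b))" for z
    unfolding d_def quad prod_std_normal_density detV using detB by (simp add: real_sqrt_mult)
  have dm[measurable]: "d \<in> borel_measurable borel"
    unfolding d_def by (intro borel_measurable_continuous_onI continuous_intros) (use detB detV in auto)
  have Bm[measurable]: "(\<lambda>x. B *v x) \<in> borel_measurable borel"
    by (intro borel_measurable_continuous_onI continuous_intros)
  show "prob_space (multivariate_normal 0 (matrix_inv S))"
  proof
    have "(\<integral>\<^sup>+x. ennreal (d x) \<partial>lborel) = (\<integral>\<^sup>+z. ennreal (\<bar>det B\<bar>) * ennreal (d (B *v z)) \<partial>lborel)"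
      by (subst lborel_linear_density[OF invB], subst nn_integral_density) (simp_all add: nn_integral_distr)
    also have "\<dots> = (\<integral>\<^sup>+z. (\<Prod>b\<in>Basis. ennreal (std_normal_density (z \<bullet> b))) \<partial>(lborel :: (real^'n::_) measure))"
      by (intro nn_integral_cong)
         (simp add: ennreal_mult[symmetric] d_nn dB prod_ennreal normal_density_nonneg)
    also have "\<dots> = (\<Prod>b\<in>(Basis :: (real^'n::_) set). \<integral>\<^sup>+x. ennreal (std_normal_density x) \<partial>lborel)"
      by (intro nn_integral_lborel_prod) auto
    also have "(\<integral>\<^sup>+x. ennreal (std_normal_density x) \<partial>lborel) = 1"
      using prob_space.emeasure_space_1[OF prob_space_normal_density[of 1 0]] by (simp add: emeasure_density)
    finally show "emeasure (multivariate_normal 0 (matrix_inv S)) (space (multivariate_normal 0 (matrix_inv S))) = 1"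
      unfolding V_def[symmetric] mn by (simp add: emeasure_density)
  qed
  show "sets (multivariate_normal 0 (matrix_inv S)) = sets borel"
    by (simp add: multivariate_normal_def)
  have "(\<integral>x. iexp (a \<bullet> x) \<partial>multivariate_normal 0 V) = (\<integral>x. d x *\<^sub>R iexp (a \<bullet> x) \<partial>lborel)"
    unfolding mn by (subst integral_density) (auto simp: d_nn)
  also have "\<dots> = (\<integral>z. \<bar>det B\<bar> *\<^sub>R (d (B *v z) *\<^sub>R iexp (a \<bullet> (B *v z))) \<partial>lborel)"
    by (subst lborel_linear_density[OF invB], subst integral_density) (auto simp: integral_distr)
  also have "\<dots> = (\<integral>z. (\<Prod>b\<in>Basis. std_normal_density (z \<bullet> b)) *\<^sub>R iexp ((transpose B *v a) \<bullet> z) \<partial>lborel)"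
    unfolding scaleR_scaleR dB
    by (subst inner_commute, subst matrix_adjoint_inner, subst inner_commute, rule refl)
  also have "\<dots> = of_real (exp (- ((transpose B *v a) \<bullet> (transpose B *v a)) / 2))"
    by (rule integral_iexp_std_normal)
  also have "(transpose B *v a) \<bullet> (transpose B *v a) = a \<bullet> (V *v a)"
    unfolding BB[symmetric] matrix_vector_mul_assoc[symmetric]
    by (simp only: matrix_adjoint_inner transpose_transpose)
  finally show "(\<integral>x. iexp (a \<bullet> x) \<partial>multivariate_normal 0 (matrix_inv S)) = of_real (exp (- (a \<bullet> (matrix_inv S *v a)) / 2))"
    by (simp add: V_def)
qed

section \<open>Maximizers of products of affine functions\<close>

text \<open>
  A maximizer in \<open>K\<close> exists iff the supremum over \<open>K\<close> equals the supremum over \<open>\<Theta>\<close>; by continuity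
  both suprema may be taken over countable dense subsets.
\<close>

lemma measurable_hits_argmax:
  fixes L :: "'x \<Rightarrow> 'p::euclidean_space \<Rightarrow> real"
  assumes \<Theta>: "compact \<Theta>" "\<Theta> \<noteq> {}"
    and meas[measurable]: "\<And>p. p \<in> \<Theta> \<Longrightarrow> (\<lambda>x. L x p) \<in> borel_measurable N"
    and cont: "\<And>x. x \<in> space N \<Longrightarrow> continuous_on \<Theta> (L x)"
    and K: "closed K"
  shows "{x \<in> space N. \<exists>p\<in>\<Theta> \<inter> K. \<forall>q\<in>\<Theta>. L x q \<le> L x p} \<in> sets N"
proof -
  obtain D where D: "countable D" "D \<subseteq> \<Theta>" "\<Theta> \<subseteq> closure D" by (rule separable)
  obtain E where E: "countable E" "E \<subseteq> \<Theta> \<inter> K" "\<Theta> \<inter> K \<subseteq> closure E" by (rule separable)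
  have approx: "\<exists>k\<in>S. L x k > L x p - \<epsilon>" if x: "x \<in> space N" and p: "p \<in> \<Theta>" "p \<in> closure S" "S \<subseteq> \<Theta>" and "\<epsilon> > 0" for x p S \<epsilon>
  proof -
    obtain d where d: "d > 0" "\<And>q. q \<in> \<Theta> \<Longrightarrow> dist q p < d \<Longrightarrow> dist (L x q) (L x p) < \<epsilon>"
      using cont[OF x] p(1) \<open>\<epsilon> > 0\<close> unfolding continuous_on_iff by meson
    obtain k where "k \<in> S" "dist k p < d" using p(2) d(1) unfolding closure_approachable by blast
    then show ?thesis using d(2)[of k] p(3) by (intro bexI[of _ k]) (auto simp: dist_real_def)
  qed
  have "(\<exists>p\<in>\<Theta> \<inter> K. \<forall>q\<in>\<Theta>. L x q \<le> L x p) \<longleftrightarrow> (\<forall>q\<in>D. \<forall>n::nat. \<exists>k\<in>E. L x k > L x q - 1 / Suc n)"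
    if x: "x \<in> space N" for x
  proof
    assume "\<exists>p\<in>\<Theta> \<inter> K. \<forall>q\<in>\<Theta>. L x q \<le> L x p"
    then obtain p where p: "p \<in> \<Theta> \<inter> K" "\<And>q. q \<in> \<Theta> \<Longrightarrow> L x q \<le> L x p" by blast
    show "\<forall>q\<in>D. \<forall>n::nat. \<exists>k\<in>E. L x k > L x q - 1 / Suc n"
    proof (intro ballI allI)
      fix q and n :: nat assume "q \<in> D"
      obtain k where "k \<in> E" "L x k > L x p - 1 / Suc n"
        using approx[OF x, of p E "1 / Suc n"] p E by auto
      then show "\<exists>k\<in>E. L x k > L x q - 1 / Suc n"
        using p(2)[of q] D(2) \<open>q \<in> D\<close> by (intro bexI[of _ k]) auto
    qed
  next
    assume R: "\<forall>q\<in>D. \<forall>n::nat. \<exists>k\<in>E. L x k > L x q - 1 / Suc n"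
    have "D \<noteq> {}" using D(3) \<Theta>(2) by auto
    then have "E \<noteq> {}" using R by blast
    then have ne: "\<Theta> \<inter> K \<noteq> {}" using E(2) by blast
    have "compact (\<Theta> \<inter> K)" using \<Theta>(1) K by (rule compact_Int_closed)
    moreover have "continuous_on (\<Theta> \<inter> K) (L x)" using cont[OF x] by (rule continuous_on_subset) simp
    ultimately obtain p where p: "p \<in> \<Theta> \<inter> K" "\<And>q. q \<in> \<Theta> \<inter> K \<Longrightarrow> L x q \<le> L x p"
      using continuous_attains_sup[of "\<Theta> \<inter> K" "L x"] ne by blast
    have Dp: "L x q \<le> L x p" if "q \<in> D" for q
    proof (rule field_le_epsilon)
      fix \<epsilon> :: real assume "0 < \<epsilon>"
      then obtain n :: nat where n: "1 / Suc n < \<epsilon>" using nat_approx_posE by blast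
      obtain k where "k \<in> E" "L x k > L x q - 1 / Suc n" using R \<open>q \<in> D\<close> by blast
      then show "L x q \<le> L x p + \<epsilon>" using p(2)[of k] E(2) n by force
    qed
    have "L x q \<le> L x p" if q: "q \<in> \<Theta>" for q
    proof (rule field_le_epsilon)
      fix \<epsilon> :: real assume "0 < \<epsilon>"
      then obtain k where "k \<in> D" "L x k > L x q - \<epsilon>" using approx[OF x q, of D \<epsilon>] D q by blast
      then show "L x q \<le> L x p + \<epsilon>" using Dp[of k] by linarith
    qed
    then show "\<exists>p\<in>\<Theta> \<inter> K. \<forall>q\<in>\<Theta>. L x q \<le> L x p" using p(1) by blast
  qed
  then have "{x \<in> space N. \<exists>p\<in>\<Theta> \<inter> K. \<forall>q\<in>\<Theta>. L x q \<le> L x p} =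
      {x \<in> space N. \<forall>q\<in>D. \<forall>n::nat. \<exists>k\<in>E. L x k > L x q - 1 / Suc n}" by blast
  also have "\<dots> \<in> sets N"
  proof -
    have "{x \<in> space N. L x k > L x q - 1 / Suc n} \<in> sets N" if "q \<in> D" "k \<in> E" for q k and n :: nat
    proof -
      have [measurable]: "(\<lambda>x. L x q) \<in> borel_measurable N" "(\<lambda>x. L x k) \<in> borel_measurable N"
        using that D(2) E(2) by (auto intro: meas)
      show ?thesis by measurable
    qed
    then show ?thesis using D(1) E(1)
      by (intro sets.sets_Collect_countable_All' sets.sets_Collect_countable_All sets.sets_Collect_countable_Ex') auto
  qed
  finally show ?thesis .
qed

text \<open>
  Closure of the set of maximizers under midpoints makes the maximizer of least norm unique. It
  lies in a closed set \<open>K\<close> iff, for all rational \<open>r\<close>, a maximizer of norm at most \<open>r\<close> can be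
  found in \<open>K\<close> as soon as there is one at all, and this is a countable condition.
\<close>

lemma measurable_argmax_selection:
  fixes L :: "'x \<Rightarrow> 'p::euclidean_space \<Rightarrow> real"
  assumes \<Theta>: "compact \<Theta>" "\<Theta> \<noteq> {}"
    and meas: "\<And>p. p \<in> \<Theta> \<Longrightarrow> (\<lambda>x. L x p) \<in> borel_measurable N"
    and cont: "\<And>x. x \<in> space N \<Longrightarrow> continuous_on \<Theta> (L x)"
    and mid: "\<And>x p q. \<lbrakk>x \<in> space N; p \<in> \<Theta>; q \<in> \<Theta>; \<forall>r\<in>\<Theta>. L x r \<le> L x p; \<forall>r\<in>\<Theta>. L x r \<le> L x q\<rbrakk>
      \<Longrightarrow> (1/2) *\<^sub>R (p + q) \<in> \<Theta> \<and> (\<forall>r\<in>\<Theta>. L x r \<le> L x ((1/2) *\<^sub>R (p + q)))"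
  shows "\<exists>T. T \<in> borel_measurable N \<and> (\<forall>x\<in>space N. T x \<in> \<Theta> \<and> (\<forall>q\<in>\<Theta>. L x q \<le> L x (T x)))"
proof -
  define A where "A x = {p \<in> \<Theta>. \<forall>q\<in>\<Theta>. L x q \<le> L x p}" for x
  have A_ne: "A x \<noteq> {}" if "x \<in> space N" for x
    using continuous_attains_sup[OF \<Theta> cont[OF that]] unfolding A_def by blast
  have A_comp: "compact (A x)" if x: "x \<in> space N" for x
  proof -
    have "closed {p \<in> \<Theta>. L x q \<le> L x p}" for q
      by (intro continuous_on_closed_Collect_le continuous_on_const cont[OF x] compact_imp_closed[OF \<Theta>(1)])
    then have "closed (\<Theta> \<inter> (\<Inter>q\<in>\<Theta>. {p \<in> \<Theta>. L x q \<le> L x p}))"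
      by (intro closed_Int closed_INT compact_imp_closed \<Theta>(1)) auto
    moreover have "\<Theta> \<inter> (\<Inter>q\<in>\<Theta>. {p \<in> \<Theta>. L x q \<le> L x p}) = A x" by (auto simp: A_def)
    ultimately have "closed (A x)" by simp
    then have "compact (\<Theta> \<inter> A x)" using \<Theta>(1) by (rule compact_Int_closed[rotated])
    moreover have "\<Theta> \<inter> A x = A x" by (auto simp: A_def)
    ultimately show ?thesis by simp
  qed
  define T where "T x = (SOME p. p \<in> A x \<and> (\<forall>q\<in>A x. norm p \<le> norm q))" for x
  have T: "T x \<in> A x" "\<And>q. q \<in> A x \<Longrightarrow> norm (T x) \<le> norm q" if x: "x \<in> space N" for x
  proof -
    have "\<exists>p. p \<in> A x \<and> (\<forall>q\<in>A x. norm p \<le> norm q)"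
      using continuous_attains_inf[OF A_comp[OF x] A_ne[OF x], of norm] by (auto intro: continuous_on_norm_id)
    then have "T x \<in> A x \<and> (\<forall>q\<in>A x. norm (T x) \<le> norm q)" unfolding T_def by (rule someI_ex)
    then show "T x \<in> A x" "\<And>q. q \<in> A x \<Longrightarrow> norm (T x) \<le> norm q" by blast+
  qed
  \<comment> \<open>Two distinct maximizers of least norm would have a midpoint of smaller norm.\<close>
  have uniq: "p = T x" if x: "x \<in> space N" and p: "p \<in> A x" "norm p \<le> norm (T x)" for x p
  proof (rule ccontr)
    assume "p \<noteq> T x"
    define m where "m = (1/2) *\<^sub>R (p + T x)"
    have "m \<in> A x" unfolding m_def using mid[OF x, of p "T x"] p(1) T(1)[OF x] by (simp add: A_def)
    then have "norm (T x) \<le> norm m" by (rule T(2)[OF x])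
    then have "(norm (T x))\<^sup>2 \<le> (norm m)\<^sup>2" by (rule power_mono) simp
    moreover have "(norm m)\<^sup>2 = ((norm p)\<^sup>2 + (norm (T x))\<^sup>2) / 2 - (norm (p - T x))\<^sup>2 / 4"
      unfolding m_def power2_norm_eq_inner
      by (simp add: inner_left_distrib inner_right_distrib inner_diff_left inner_diff_right inner_commute field_simps)
    moreover have "(norm p)\<^sup>2 \<le> (norm (T x))\<^sup>2" using p(2) by (rule power_mono) simp
    moreover have "0 < (norm (p - T x))\<^sup>2" using \<open>p \<noteq> T x\<close> by simp
    moreover have "a \<le> m \<Longrightarrow> m = (p + a) / 2 - d / 4 \<Longrightarrow> p \<le> a \<Longrightarrow> 0 < d \<Longrightarrow> False" for a m p d :: real
      by argo
    ultimately show False by blast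
  qed
  define hits where "hits K = {x \<in> space N. \<exists>p\<in>\<Theta> \<inter> K. \<forall>q\<in>\<Theta>. L x q \<le> L x p}" for K
  have hits: "x \<in> hits K \<longleftrightarrow> (\<exists>p\<in>A x. p \<in> K)" if "x \<in> space N" for x K
    using that by (auto simp: hits_def A_def)
  have hits_meas: "hits K \<in> sets N" if "closed K" for K
    unfolding hits_def by (rule measurable_hits_argmax[OF \<Theta> meas cont that])
  have inK: "T x \<in> K \<longleftrightarrow> (\<forall>r\<in>\<rat>. x \<in> hits (cball 0 r) \<longrightarrow> x \<in> hits (K \<inter> cball 0 r))"
    if x: "x \<in> space N" and K: "closed K" for x K
  proof
    assume "T x \<in> K"
    show "\<forall>r\<in>\<rat>. x \<in> hits (cball 0 r) \<longrightarrow> x \<in> hits (K \<inter> cball 0 r)"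
    proof (intro ballI impI)
      fix r :: real assume "x \<in> hits (cball 0 r)"
      then obtain p where "p \<in> A x" "norm p \<le> r" using hits[OF x] by auto
      then have "norm (T x) \<le> r" using T(2)[OF x] by force
      then show "x \<in> hits (K \<inter> cball 0 r)" using \<open>T x \<in> K\<close> T(1)[OF x] hits[OF x] by auto
    qed
  next
    assume R: "\<forall>r\<in>\<rat>. x \<in> hits (cball 0 r) \<longrightarrow> x \<in> hits (K \<inter> cball 0 r)"
    have mem: "\<exists>p\<in>A x \<inter> K. norm p \<le> r" if "r \<in> \<rat>" "norm (T x) \<le> r" for r
    proof -
      have "x \<in> hits (cball 0 r)" using T(1)[OF x] that hits[OF x] by auto
      then have "x \<in> hits (K \<inter> cball 0 r)" using R that by blast
      then show ?thesis using hits[OF x] by auto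
    qed
    obtain r0 where "r0 \<in> \<rat>" "norm (T x) < r0" using Rats_dense_in_real[of "norm (T x)" "norm (T x) + 1"] by auto
    then have "A x \<inter> K \<noteq> {}" using mem[of r0] by auto
    moreover have "compact (A x \<inter> K)" using A_comp[OF x] K by (rule compact_Int_closed)
    ultimately obtain p where p: "p \<in> A x \<inter> K" "\<And>q. q \<in> A x \<inter> K \<Longrightarrow> norm p \<le> norm q"
      using continuous_attains_inf[of "A x \<inter> K" norm] by (auto intro: continuous_on_norm_id)
    have "norm p \<le> norm (T x)"
    proof (rule ccontr)
      assume "\<not> norm p \<le> norm (T x)"
      then obtain r where "r \<in> \<rat>" "norm (T x) < r" "r < norm p" using Rats_dense_in_real[of "norm (T x)" "norm p"] by auto
      then show False using mem[of r] p(2) by force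
    qed
    then have "p = T x" using uniq[OF x] p(1) by blast
    then show "T x \<in> K" using p(1) by blast
  qed
  have "T \<in> borel_measurable N"
  proof (rule borel_measurableI)
    fix S :: "'p set" assume "open S"
    then have K: "closed (- S)" by (simp add: closed_Compl)
    have "{x \<in> space N. \<forall>r\<in>\<rat>. x \<in> hits (cball 0 r) \<longrightarrow> x \<in> hits (- S \<inter> cball 0 r)} \<in> sets N"
    proof (rule sets.sets_Collect_countable_All')
      fix r :: real
      have [measurable]: "hits (cball 0 r) \<in> sets N" "hits (- S \<inter> cball 0 r) \<in> sets N"
        by (auto intro!: hits_meas closed_Int K)
      show "{x \<in> space N. x \<in> hits (cball 0 r) \<longrightarrow> x \<in> hits (- S \<inter> cball 0 r)} \<in> sets N" by measurable
    qed (rule countable_rat)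
    then have "space N - {x \<in> space N. \<forall>r\<in>\<rat>. x \<in> hits (cball 0 r) \<longrightarrow> x \<in> hits (- S \<inter> cball 0 r)} \<in> sets N"
      by (rule sets.compl_sets)
    moreover have "T -` S \<inter> space N = space N - {x \<in> space N. \<forall>r\<in>\<rat>. x \<in> hits (cball 0 r) \<longrightarrow> x \<in> hits (- S \<inter> cball 0 r)}"
      using inK[OF _ K] by auto
    ultimately show "T -` S \<inter> space N \<in> sets N" by simp
  qed
  then show ?thesis using T(1) unfolding A_def by blast
qed

text \<open>
  The value of the product at \<open>0\<close> is one, so no factor vanishes at a maximizer; the second claim
  says that the logarithmic derivative along the segment towards \<open>q\<close> is not positive.
\<close>

lemma product_maximizer:
  fixes \<psi> :: "'i \<Rightarrow> 'p::real_inner"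
  assumes fin: "finite I" and \<Theta>: "convex \<Theta>" "0 \<in> \<Theta>" and nn: "\<And>p i. p \<in> \<Theta> \<Longrightarrow> i \<in> I \<Longrightarrow> 0 \<le> 1 + p \<bullet> \<psi> i"
    and T: "T \<in> \<Theta>" and max: "\<And>p. p \<in> \<Theta> \<Longrightarrow> (\<Prod>i\<in>I. 1 + p \<bullet> \<psi> i) \<le> (\<Prod>i\<in>I. 1 + T \<bullet> \<psi> i)"
  shows "\<And>i. i \<in> I \<Longrightarrow> 0 < 1 + T \<bullet> \<psi> i"
    and "\<And>q. q \<in> \<Theta> \<Longrightarrow> (\<Sum>i\<in>I. ((q - T) \<bullet> \<psi> i) / (1 + T \<bullet> \<psi> i)) \<le> 0"
proof -
  have "1 \<le> (\<Prod>i\<in>I. 1 + T \<bullet> \<psi> i)" using max[OF \<Theta>(2)] by simp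
  then have nz: "(\<Prod>i\<in>I. 1 + T \<bullet> \<psi> i) \<noteq> 0" and P: "0 < (\<Prod>i\<in>I. 1 + T \<bullet> \<psi> i)" by linarith+
  show pos: "0 < 1 + T \<bullet> \<psi> i" if "i \<in> I" for i
    using nn[OF T that] nz fin that by (metis order_le_less prod_zero)
  fix q assume q: "q \<in> \<Theta>"
  define G where "G t = (\<Prod>i\<in>I. 1 + (T + t *\<^sub>R (q - T)) \<bullet> \<psi> i)" for t
  have "(G has_field_derivative (\<Prod>i\<in>I. 1 + (T + 0 *\<^sub>R (q - T)) \<bullet> \<psi> i) *
      (\<Sum>i\<in>I. ((q - T) \<bullet> \<psi> i) / (1 + (T + 0 *\<^sub>R (q - T)) \<bullet> \<psi> i))) (at 0)"
    unfolding G_def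
    by (rule has_field_derivative_prod') (use pos in \<open>auto intro!: derivative_eq_intros simp: inner_left_distrib less_imp_neq[symmetric]\<close>)
  then have D: "(G has_field_derivative (\<Prod>i\<in>I. 1 + T \<bullet> \<psi> i) * (\<Sum>i\<in>I. ((q - T) \<bullet> \<psi> i) / (1 + T \<bullet> \<psi> i))) (at 0)"
    by simp
  show "(\<Sum>i\<in>I. ((q - T) \<bullet> \<psi> i) / (1 + T \<bullet> \<psi> i)) \<le> 0"
  proof (rule ccontr)
    assume "\<not> ?thesis"
    then have "0 < (\<Prod>i\<in>I. 1 + T \<bullet> \<psi> i) * (\<Sum>i\<in>I. ((q - T) \<bullet> \<psi> i) / (1 + T \<bullet> \<psi> i))"
      using P by (intro mult_pos_pos) auto
    from DERIV_pos_inc_right[OF D this] obtain d where d: "d > 0" "\<And>h. h > 0 \<Longrightarrow> h < d \<Longrightarrow> G 0 < G (0 + h)" by blast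
    define t where "t = min 1 (d / 2)"
    have t: "0 < t" "t < d" "t \<le> 1" using d by (auto simp: t_def)
    have "T + t *\<^sub>R (q - T) = (1 - t) *\<^sub>R T + t *\<^sub>R q" by (simp add: algebra_simps)
    then have "T + t *\<^sub>R (q - T) \<in> \<Theta>" using convexD_alt[OF \<Theta>(1) T q, of t] t by simp
    then have "G t \<le> G 0" using max unfolding G_def by simp
    then show False using d(2)[of t] t by simp
  qed
qed

text \<open>
  Products of affine functions are log-concave; the arithmetic-geometric mean inequality in each
  factor avoids logarithms of factors that vanish.
\<close>

lemma product_maximizer_midpoint:
  fixes \<psi> :: "'i \<Rightarrow> 'p::real_inner"
  assumes \<Theta>: "convex \<Theta>" and nn: "\<And>p i. p \<in> \<Theta> \<Longrightarrow> i \<in> I \<Longrightarrow> 0 \<le> 1 + p \<bullet> \<psi> i"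
    and p: "p \<in> \<Theta>" "\<forall>r\<in>\<Theta>. (\<Prod>i\<in>I. 1 + r \<bullet> \<psi> i) \<le> (\<Prod>i\<in>I. 1 + p \<bullet> \<psi> i)"
    and q: "q \<in> \<Theta>" "\<forall>r\<in>\<Theta>. (\<Prod>i\<in>I. 1 + r \<bullet> \<psi> i) \<le> (\<Prod>i\<in>I. 1 + q \<bullet> \<psi> i)"
  shows "(1/2) *\<^sub>R (p + q) \<in> \<Theta> \<and> (\<forall>r\<in>\<Theta>. (\<Prod>i\<in>I. 1 + r \<bullet> \<psi> i) \<le> (\<Prod>i\<in>I. 1 + ((1/2) *\<^sub>R (p + q)) \<bullet> \<psi> i))"
proof -
  define m where "m = (1/2) *\<^sub>R (p + q)"
  have m: "m \<in> \<Theta>" using convexD_alt[OF \<Theta> p(1) q(1), of "1/2"] by (simp add: m_def scaleR_add_right)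
  define P where "P r = (\<Prod>i\<in>I. 1 + r \<bullet> \<psi> i)" for r
  have eq: "P p = P q" using p q unfolding P_def by (meson order_antisym)
  have P0: "0 \<le> P r" if "r \<in> \<Theta>" for r unfolding P_def using nn[OF that] by (intro prod_nonneg) auto
  have "P p * P q = (\<Prod>i\<in>I. (1 + p \<bullet> \<psi> i) * (1 + q \<bullet> \<psi> i))" unfolding P_def by (rule prod.distrib[symmetric])
  also have "\<dots> \<le> (\<Prod>i\<in>I. (1 + m \<bullet> \<psi> i)\<^sup>2)"
  proof (rule prod_mono)
    fix i assume i: "i \<in> I"
    have eqm: "1 + m \<bullet> \<psi> i = ((1 + p \<bullet> \<psi> i) + (1 + q \<bullet> \<psi> i)) / 2" by (simp add: m_def inner_left_distrib field_simps)
    have "x * y \<le> ((x + y) / 2)\<^sup>2" for x y :: real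
      using zero_le_power2[of "x - y"] by (simp add: power2_eq_square field_simps)
    then show "0 \<le> (1 + p \<bullet> \<psi> i) * (1 + q \<bullet> \<psi> i) \<and> (1 + p \<bullet> \<psi> i) * (1 + q \<bullet> \<psi> i) \<le> (1 + m \<bullet> \<psi> i)\<^sup>2"
      unfolding eqm using mult_nonneg_nonneg[OF nn[OF p(1) i] nn[OF q(1) i]] by blast
  qed
  also have "\<dots> = (P m)\<^sup>2" unfolding P_def by (rule prod_power_distrib[symmetric])
  finally have "(P p)\<^sup>2 \<le> (P m)\<^sup>2" unfolding eq[symmetric] by (simp add: power2_eq_square)
  then have "P p \<le> P m" using P0[OF m] by (rule power2_le_imp_le)
  then show ?thesis using m p(2) unfolding m_def[symmetric] P_def by (blast intro: order_trans)
qed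

lemma ln_ext_mult: "0 \<le> x \<Longrightarrow> 0 \<le> y \<Longrightarrow> ln_ext (x * y) = ln_ext x + ln_ext y"
  by (auto simp: ln_ext_def ln_mult zero_less_mult_iff)

lemma sum_ln_ext:
  assumes "finite I" "\<And>i. i \<in> I \<Longrightarrow> 0 \<le> a i"
  shows "(\<Sum>i\<in>I. ln_ext (a i)) = ln_ext (\<Prod>i\<in>I. a i)"
  using assms
proof (induction rule: finite_induct)
  case (insert j I)
  then show ?case by (simp add: ln_ext_mult prod_nonneg)
qed (simp add: ln_ext_def zero_ereal_def)

lemma ln_ext_mono: "x \<le> y \<Longrightarrow> ln_ext x \<le> ln_ext y"
  by (auto simp: ln_ext_def)

section \<open>Maximum likelihood estimators of affine density families\<close>

lemma unif01_integral_cong: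
  fixes g h :: "real \<Rightarrow> real"
  assumes g: "g \<in> borel_measurable borel" and h: "h \<in> borel_measurable borel" and eq: "\<And>u. u \<in> {0..1} \<Longrightarrow> g u = h u"
  shows "(\<integral>u. g u \<partial>unif01) = (\<integral>u. h u \<partial>unif01)"
proof (rule integral_cong_AE)
  have s: "sets unif01 = sets borel" by simp
  show "g \<in> borel_measurable unif01" "h \<in> borel_measurable unif01"
    using g h by (simp_all only: measurable_cong_sets[OF s refl])
  show "AE u in unif01. g u = h u" using AE_unif01 by eventually_elim (rule eq)
qed

context orthonormal_family begin

lemma weight_nonneg: "0 \<le> weight L" unfolding weight_def
  by (intro sum_nonneg mult_nonneg_nonneg order_trans[OF zero_le_one b_ge_1]) auto

lemma norm_le_weight: "norm L \<le> weight L"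
proof -
  have "norm L \<le> (\<Sum>k\<in>UNIV. \<bar>L $ k\<bar>)" by (rule norm_le_l1_cart)
  also have "\<dots> \<le> weight L" unfolding weight_def
    using mult_right_mono[OF b_ge_1] by (intro sum_mono) (metis abs_ge_zero mult_1)
  finally show ?thesis .
qed

lemma weight_scaleR: "weight (c *\<^sub>R L) = \<bar>c\<bar> * weight L"
  by (simp add: weight_def abs_mult sum_distrib_left mult_ac)

lemma weight_add: "weight (L + L') \<le> weight L + weight L'"
  unfolding weight_def sum.distrib[symmetric] distrib_left[symmetric]
  by (intro sum_mono) (auto intro!: mult_left_mono order_trans[OF zero_le_one b_ge_1])

lemma weight_le_norm: "weight L \<le> \<beta> * norm L"
  unfolding weight_def \<beta>_def sum_distrib_right
  by (intro sum_mono) (auto intro!: mult_left_mono component_le_norm_cart order_trans[OF zero_le_one b_ge_1])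

lemma weight_lipschitz: "weight L' \<le> weight L + \<beta> * norm (L' - L)"
  using weight_add[of L "L' - L"] weight_le_norm[of "L' - L"] by simp

definition \<Theta> :: "(real^'s) set" where "\<Theta> = {L. weight L \<le> 1}"

lemma \<Theta>_compact: "compact \<Theta>"
proof -
  have "closed \<Theta>" unfolding \<Theta>_def weight_def
    by (intro closed_Collect_le continuous_intros)
  moreover have "bounded \<Theta>"
    by (rule boundedI[of _ 1]) (use norm_le_weight in \<open>auto simp: \<Theta>_def intro: order_trans\<close>)
  ultimately show ?thesis by (simp add: compact_eq_bounded_closed)
qed

lemma \<Theta>_convex: "convex \<Theta>"
proof (rule convexI)
  fix x y :: "real^'s" and u v :: real
  assume *: "x \<in> \<Theta>" "y \<in> \<Theta>" "0 \<le> u" "0 \<le> v" "u + v = 1"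
  have "weight (u *\<^sub>R x + v *\<^sub>R y) \<le> u * weight x + v * weight y"
    using weight_add[of "u *\<^sub>R x" "v *\<^sub>R y"] * by (simp add: weight_scaleR)
  also have "\<dots> \<le> 1" using * by (intro convex_bound_le) (auto simp: \<Theta>_def)
  finally show "u *\<^sub>R x + v *\<^sub>R y \<in> \<Theta>" by (simp add: \<Theta>_def)
qed

lemma zero_in_\<Theta>: "0 \<in> \<Theta>" by (simp add: \<Theta>_def weight_def)

text \<open>
  A slight dilation of an interior point stays in the region.
\<close>

lemma interior_\<Theta>:
  assumes "L \<in> interior \<Theta>"
  shows "weight L < 1"
proof (cases "weight L = 0")
  case False
  then have w: "0 < weight L" using weight_nonneg[of L] by linarith
  then have n: "0 < norm L" by (auto simp: weight_def)
  obtain \<epsilon> where \<epsilon>: "0 < \<epsilon>" "ball L \<epsilon> \<subseteq> \<Theta>"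
    using assms mem_interior by blast
  define t where "t = \<epsilon> / (2 * norm L)"
  have t: "0 < t" using \<epsilon> n by (simp add: t_def)
  have "(1 + t) *\<^sub>R L \<in> ball L \<epsilon>"
    using \<epsilon> n by (simp add: dist_norm scaleR_add_left t_def)
  then have "(1 + t) * weight L \<le> 1" using \<epsilon>(2) t by (auto simp: \<Theta>_def weight_scaleR subset_iff)
  then show ?thesis using mult_pos_pos[OF t w] by (simp add: algebra_simps)
qed simp

lemma dens_nonneg: "L \<in> \<Theta> \<Longrightarrow> 0 \<le> dens L u v"
  using dens_ge[of L u v] by (simp add: \<Theta>_def)

lemma dens_le_2: "L \<in> \<Theta> \<Longrightarrow> dens L u v \<le> 2"
  using dens_le[of L u v] by (simp add: \<Theta>_def)

definition likelihood :: "nat \<Rightarrow> (nat \<Rightarrow> real) \<Rightarrow> real^'s \<Rightarrow> real" where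
  "likelihood n x L = (\<Prod>i<n. dens L (x i) (x (Suc i)))"

lemma likelihood_selection:
  "\<exists>T. T \<in> borel_measurable (\<Pi>\<^sub>M i\<in>{..n}. borel) \<and>
     (\<forall>x\<in>space (\<Pi>\<^sub>M i\<in>{..n}. (borel :: real measure)). T x \<in> \<Theta> \<and> (\<forall>q\<in>\<Theta>. likelihood n x q \<le> likelihood n x (T x)))"
proof (rule measurable_argmax_selection)
  show "compact \<Theta>" "\<Theta> \<noteq> {}" using \<Theta>_compact zero_in_\<Theta> by auto
  fix p assume "p \<in> \<Theta>"
  show "(\<lambda>x. likelihood n x p) \<in> borel_measurable (\<Pi>\<^sub>M i\<in>{..n}. borel)"
    unfolding likelihood_def
    by (intro borel_measurable_prod dens_measurable measurable_const measurable_component_singleton) auto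
next
  fix x show "continuous_on \<Theta> (likelihood n x)"
    unfolding likelihood_def dens_def by (intro continuous_intros)
next
  fix x p q assume "p \<in> \<Theta>" "q \<in> \<Theta>" "\<forall>r\<in>\<Theta>. likelihood n x r \<le> likelihood n x p" "\<forall>r\<in>\<Theta>. likelihood n x r \<le> likelihood n x q"
  then show "(1/2) *\<^sub>R (p + q) \<in> \<Theta> \<and> (\<forall>r\<in>\<Theta>. likelihood n x r \<le> likelihood n x ((1/2) *\<^sub>R (p + q)))"
    unfolding likelihood_def dens_def
    by (intro product_maximizer_midpoint[OF \<Theta>_convex]) (use dens_nonneg in \<open>auto simp: dens_def\<close>)
qed

text \<open>
  The third claim holds because a maximizer off the boundary can be moved in both directions along
  every axis.
\<close>

lemma likelihood_maximizer:
  assumes T: "T \<in> \<Theta>" and max: "\<And>q. q \<in> \<Theta> \<Longrightarrow> likelihood n x q \<le> likelihood n x T"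
  shows "\<And>i. i < n \<Longrightarrow> 0 < dens T (x i) (x (Suc i))"
    and "\<And>q. q \<in> \<Theta> \<Longrightarrow> (\<Sum>i<n. ((q - T) \<bullet> feature (x i) (x (Suc i))) / dens T (x i) (x (Suc i))) \<le> 0"
    and "weight T < 1 \<Longrightarrow> (\<Sum>i<n. (1 / dens T (x i) (x (Suc i))) *\<^sub>R feature (x i) (x (Suc i))) = 0"
proof -
  note pm = product_maximizer[of "{..<n}" \<Theta> "\<lambda>i. feature (x i) (x (Suc i))" T, folded dens_def,
      OF finite_lessThan \<Theta>_convex zero_in_\<Theta> dens_nonneg T max[unfolded likelihood_def]]
  show "0 < dens T (x i) (x (Suc i))" if "i < n" for i
    using pm(1)[of i] that by simp
  show foc: "(\<Sum>i<n. ((q - T) \<bullet> feature (x i) (x (Suc i))) / dens T (x i) (x (Suc i))) \<le> 0" if "q \<in> \<Theta>" for q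
    using pm(2)[of q] that by simp
  assume w: "weight T < 1"
  \<comment> \<open>A step of length \<open>s\<close> along an axis does not leave the region, by \<open>weight_lipschitz\<close>.\<close>
  define s where "s = (1 - weight T) / \<beta>"
  have s: "0 < s" "\<beta> * s = 1 - weight T" using w \<beta>_ge_1 by (auto simp: s_def)
  define G where "G = (\<Sum>i<n. (1 / dens T (x i) (x (Suc i))) *\<^sub>R feature (x i) (x (Suc i)))"
  have "G $ k = 0" for k
  proof -
    have r: "r * G $ k \<le> 0" if r: "\<bar>r\<bar> = s" for r
    proof -
      have "weight (T + r *\<^sub>R axis k 1) \<le> weight T + \<beta> * norm (r *\<^sub>R axis k (1::real))"
        using weight_lipschitz[of "T + r *\<^sub>R axis k 1" T] by simp
      also have "norm (r *\<^sub>R axis k (1::real) :: real^'s) = s" using r by simp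
      finally have "T + r *\<^sub>R axis k 1 \<in> \<Theta>" using s by (simp add: \<Theta>_def)
      from foc[OF this] have "(\<Sum>i<n. r * (feature (x i) (x (Suc i)) $ k / dens T (x i) (x (Suc i)))) \<le> 0"
        by (simp add: inner_axis' inner_axis)
      then show ?thesis by (simp add: G_def sum_distrib_left)
    qed
    from r[of s] r[of "- s"] s(1) have "s * G $ k \<le> 0" "- s * G $ k \<le> 0" by auto
    then have "s * G $ k = 0" by simp
    then show ?thesis using s(1) by simp
  qed
  then show "(\<Sum>i<n. (1 / dens T (x i) (x (Suc i))) *\<^sub>R feature (x i) (x (Suc i))) = 0"
    by (simp add: G_def[symmetric] vec_eq_iff)
qed

end

lemma partial_derivI:
  fixes F G :: "real^'s \<Rightarrow> real"
  assumes W: "open W" "\<Lambda> \<in> W" and eq: "\<And>L. L \<in> W \<Longrightarrow> F L = G L"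
    and D: "((\<lambda>t. G (\<Lambda> + t *\<^sub>R axis k 1)) has_real_derivative D) (at 0)"
  shows "partial_deriv k F \<Lambda> = D"
proof -
  have o: "open ((\<lambda>t. \<Lambda> + t *\<^sub>R axis k 1) -` W)"
    by (intro open_vimage W continuous_intros)
  have "((\<lambda>t. F (\<Lambda> + t *\<^sub>R axis k 1)) has_real_derivative D) (at 0)"
    by (rule has_field_derivative_transform_within_open[OF D o]) (use W eq in auto)
  then show ?thesis unfolding partial_deriv_def by (rule DERIV_imp_deriv)
qed

text \<open>
  Along \<open>t = exp(-n)/p\<close> the function tends to \<open>-\<infinity>\<close>, although its value at \<open>0\<close> is \<open>ln 0 = 0\<close>.
\<close>

lemma not_differentiable_ln_at_0:
  fixes p :: real
  assumes "p \<noteq> 0"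
  shows "\<not> ((\<lambda>t. ln (t * p)) has_real_derivative D) (at 0)"
proof
  assume "((\<lambda>t. ln (t * p)) has_real_derivative D) (at 0)"
  then have c: "isCont (\<lambda>t. ln (t * p)) 0" by (rule DERIV_isCont)
  have "(\<lambda>n. exp (- real n) / p) \<longlonglongrightarrow> 0 / p"
    by (intro tendsto_divide tendsto_const) (use assms in \<open>auto intro: filterlim_compose[OF exp_at_bot] simp: filterlim_uminus_at_bot filterlim_real_sequentially\<close>)
  from isCont_tendsto_compose[OF c, of _ sequentially] this
  have "(\<lambda>n. ln (exp (- real n) / p * p)) \<longlonglongrightarrow> ln (0 * p)" by fastforce
  then have "(\<lambda>n. - real n) \<longlonglongrightarrow> 0" using assms by simp
  then have "\<forall>\<^sub>F n in sequentially. \<bar>- real n\<bar> < 1"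
    using tendstoD[of _ 0 sequentially 1] by (fastforce simp: dist_real_def)
  then obtain N where "\<And>n. n \<ge> N \<Longrightarrow> \<bar>- real n\<bar> < 1" by (auto simp: eventually_sequentially)
  from this[of "Suc N"] show False by simp
qed

text \<open>
  The logarithm of a negative number is \<open>ln |x|\<close>, which has the same logarithmic derivative. For
  \<open>c = 0 \<noteq> p\<close> there is no derivative, and \<open>deriv\<close> returns an unspecified number that is the same for
  all \<open>p\<close>. That the value depends on \<open>c\<close> and \<open>p\<close> alone gives measurability in the sample, also
  off the unit square.
\<close>

lemma deriv_ln_affine:
  fixes c p :: real
  shows "deriv (\<lambda>t. ln (c + t * p)) 0 =
    (if c \<noteq> 0 then p / c else if p = 0 then 0 else (SOME D. False))"
proof -
  consider "c > 0" | "c < 0" | "c = 0" "p = 0" | "c = 0" "p \<noteq> 0" by linarith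
  then show ?thesis
  proof cases
    case 1
    then have "((\<lambda>t. ln (c + t * p)) has_real_derivative p / c) (at 0)"
      by (auto intro!: derivative_eq_intros)
    then show ?thesis using 1 by (auto intro: DERIV_imp_deriv)
  next
    case 2
    then have "((\<lambda>t. ln (- c + t * (- p))) has_real_derivative (- p) / (- c)) (at 0)"
      by (auto intro!: derivative_eq_intros)
    moreover have "(\<lambda>t. ln (- c + t * (- p))) = (\<lambda>t. ln (c + t * p))"
    proof
      fix t show "ln (- c + t * (- p)) = ln (c + t * p)"
        using ln_minus[of "c + t * p"] by (simp add: algebra_simps)
    qed
    ultimately show ?thesis using 2 by (auto intro: DERIV_imp_deriv)
  next
    case 3 then show ?thesis by simp
  next
    case 4
    then show ?thesis using not_differentiable_ln_at_0[of p] by (simp add: deriv_def)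
  qed
qed

text \<open>
  The functions \<open>e k\<close> are given on the whole line and are bounded on \<open>[0,1]\<close> only, as the Legendre
  polynomials are.
\<close>

locale copula_family =
  fixes e :: "'s::finite \<Rightarrow> real \<Rightarrow> real" and b :: "'s \<Rightarrow> real"
  assumes e_cont: "\<And>k. continuous_on UNIV (e k)"
    and e_bound: "\<And>k u. u \<in> {0..1} \<Longrightarrow> (e k u)\<^sup>2 \<le> b k"
    and e_mean: "\<And>k. (\<integral>u. e k u \<partial>unif01) = 0"
    and e_orth: "\<And>k j. (\<integral>u. e k u * e j u \<partial>unif01) = (if k = j then 1 else 0)"
begin

lemma e_measurable[measurable]: "e k \<in> borel_measurable borel"
  by (intro borel_measurable_continuous_onI e_cont)

sublocale orthonormal_family "\<lambda>k u. indicator {0..1} u * e k u" b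
proof
  fix k j :: 's and u :: real
  have m: "(\<lambda>u. indicator {0..1} u * e k u) \<in> borel_measurable borel" for k by measurable
  show "(\<lambda>u. indicator {0..1} u * e k u) \<in> borel_measurable borel" by (rule m)
  have "0 \<le> b k" using e_bound[of 0 k] by (auto intro: order_trans[OF zero_le_power2])
  then show "(indicator {0..1} u * e k u)\<^sup>2 \<le> b k" using e_bound[of u k] by (auto simp: indicator_def)
  have "(\<integral>u. indicator {0..1} u * e k u \<partial>unif01) = (\<integral>u. e k u \<partial>unif01)"
    by (intro unif01_integral_cong m e_measurable) simp
  then show "(\<integral>u. indicator {0..1} u * e k u \<partial>unif01) = 0" by (simp add: e_mean)
  have "(\<integral>u. (indicator {0..1} u * e k u) * (indicator {0..1} u * e j u) \<partial>unif01) = (\<integral>u. e k u * e j u \<partial>unif01)"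
    by (intro unif01_integral_cong borel_measurable_times m e_measurable) simp
  then show "(\<integral>u. (indicator {0..1} u * e k u) * (indicator {0..1} u * e j u) \<partial>unif01) = (if k = j then 1 else 0)"
    by (simp add: e_orth)
qed

definition plane_feature :: "real \<Rightarrow> real \<Rightarrow> real^'s" where "plane_feature u v = (\<chi> k. e k u * e k v)"

text \<open>
  Agrees with \<open>dens\<close> on the unit square, but carries no sign or bound outside.
\<close>

definition plane_dens :: "real^'s \<Rightarrow> real \<Rightarrow> real \<Rightarrow> real" where "plane_dens L u v = 1 + L \<bullet> plane_feature u v"

lemma plane_feature_measurable[measurable (raw)]:
  assumes [measurable]: "g \<in> borel_measurable N" "h \<in> borel_measurable N"
  shows "(\<lambda>x. plane_feature (g x) (h x)) \<in> borel_measurable N"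
proof -
  have "(\<lambda>x. \<chi> k. e k (g x) * e k (h x)) \<in> borel_measurable N"
    unfolding borel_measurable_euclidean_space[where 'c = "real^'s"]
    by (auto simp: Basis_vec_def inner_axis)
  then show ?thesis by (simp add: plane_feature_def)
qed

lemma plane_dens_measurable[measurable (raw)]:
  assumes [measurable]: "l \<in> borel_measurable N" "g \<in> borel_measurable N" "h \<in> borel_measurable N"
  shows "(\<lambda>x. plane_dens (l x) (g x) (h x)) \<in> borel_measurable N"
  unfolding plane_dens_def by measurable

lemma plane_feature_eq_feature: "u \<in> {0..1} \<Longrightarrow> v \<in> {0..1} \<Longrightarrow> plane_feature u v = feature u v"
  by (simp add: plane_feature_def feature_def vec_eq_iff)

lemma plane_dens_eq_dens: "u \<in> {0..1} \<Longrightarrow> v \<in> {0..1} \<Longrightarrow> plane_dens L u v = dens L u v"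
  by (simp add: plane_dens_def dens_def plane_feature_eq_feature)

lemma plane_dens_line: "plane_dens (L + t *\<^sub>R axis k 1) u v = plane_dens L u v + t * plane_feature u v $ k"
  by (simp add: plane_dens_def inner_left_distrib inner_axis')

lemma partial_deriv_ln_plane_dens:
  "partial_deriv k (\<lambda>L. ln (plane_dens L u v)) L =
    (if plane_dens L u v \<noteq> 0 then plane_feature u v $ k / plane_dens L u v else if plane_feature u v $ k = 0 then 0 else (SOME D. False))"
  unfolding partial_deriv_def plane_dens_line by (rule deriv_ln_affine)

lemma partial_deriv_ln_plane_dens_measurable:
  "(\<lambda>(u, v). partial_deriv k (\<lambda>L. ln (plane_dens L u v)) L) \<in> borel_measurable (borel \<Otimes>\<^sub>M borel)"
proof -
  have c: "(\<lambda>z. plane_dens L (fst z) (snd z)) \<in> borel_measurable (borel \<Otimes>\<^sub>M borel)"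
    by (intro plane_dens_measurable measurable_const measurable_fst measurable_snd) simp
  have p: "(\<lambda>z. plane_feature (fst z) (snd z) $ k) \<in> borel_measurable (borel \<Otimes>\<^sub>M borel)"
    unfolding plane_feature_def vec_lambda_beta by measurable
  show ?thesis unfolding partial_deriv_ln_plane_dens split_beta' using c p by measurable
qed

lemma log_likelihood_plane_dens:
  assumes "\<And>i. i < n \<Longrightarrow> 0 < plane_dens L (x i) (x (Suc i))"
  shows "real_of_ereal (log_likelihood plane_dens n x L) = (\<Sum>i<n. ln (plane_dens L (x i) (x (Suc i))))"
proof -
  have "log_likelihood plane_dens n x L = (\<Sum>i<n. ln_ext (plane_dens L (x i) (x (Suc i))))"
    unfolding log_likelihood_def by (simp add: sum.atLeast1_atMost_eq)
  also have "\<dots> = (\<Sum>i<n. ereal (ln (plane_dens L (x i) (x (Suc i)))))"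
    by (intro sum.cong refl) (use assms in \<open>auto simp: ln_ext_def\<close>)
  finally show ?thesis by (simp add: sum_ereal)
qed

lemma observed_information_plane_dens:
  assumes pos: "\<And>i. i < n \<Longrightarrow> 0 < plane_dens L (x i) (x (Suc i))"
  shows "observed_information plane_dens n x L =
    (\<chi> k j. \<Sum>i<n. plane_feature (x i) (x (Suc i)) $ k * plane_feature (x i) (x (Suc i)) $ j / (plane_dens L (x i) (x (Suc i)))\<^sup>2)"
proof -
  define W where "W = {L. \<forall>i\<in>{..<n}. 0 < plane_dens L (x i) (x (Suc i))}"
  have "W = (\<Inter>i\<in>{..<n}. {L. 0 < plane_dens L (x i) (x (Suc i))})" by (auto simp: W_def)
  moreover have "open {L. 0 < plane_dens L (x i) (x (Suc i))}" for i unfolding plane_dens_def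
    by (intro open_Collect_less continuous_intros)
  ultimately have W: "open W" by (simp add: open_INT)
  have LW: "L \<in> W" using pos by (simp add: W_def)
  have ll: "real_of_ereal (log_likelihood plane_dens n x L') = (\<Sum>i<n. ln (plane_dens L' (x i) (x (Suc i))))" if "L' \<in> W" for L'
    using that by (intro log_likelihood_plane_dens) (auto simp: W_def)
  have d1: "partial_deriv j (\<lambda>L. real_of_ereal (log_likelihood plane_dens n x L)) L' =
      (\<Sum>i<n. plane_feature (x i) (x (Suc i)) $ j / plane_dens L' (x i) (x (Suc i)))" if L': "L' \<in> W" for j L'
  proof (rule partial_derivI[OF W L' ll])
    show "((\<lambda>t. \<Sum>i<n. ln (plane_dens (L' + t *\<^sub>R axis j 1) (x i) (x (Suc i)))) has_real_derivative
       (\<Sum>i<n. plane_feature (x i) (x (Suc i)) $ j / plane_dens L' (x i) (x (Suc i)))) (at 0)"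
      unfolding plane_dens_line
      by (rule DERIV_sum) (use L' in \<open>auto intro!: derivative_eq_intros simp: W_def\<close>)
  qed
  have d2: "partial_deriv k (partial_deriv j (\<lambda>L. real_of_ereal (log_likelihood plane_dens n x L))) L =
      (\<Sum>i<n. - (plane_feature (x i) (x (Suc i)) $ k * plane_feature (x i) (x (Suc i)) $ j / (plane_dens L (x i) (x (Suc i)))\<^sup>2))" for k j
  proof (rule partial_derivI[OF W LW d1])
    show "((\<lambda>t. \<Sum>i<n. plane_feature (x i) (x (Suc i)) $ j / plane_dens (L + t *\<^sub>R axis k 1) (x i) (x (Suc i))) has_real_derivative
       (\<Sum>i<n. - (plane_feature (x i) (x (Suc i)) $ k * plane_feature (x i) (x (Suc i)) $ j / (plane_dens L (x i) (x (Suc i)))\<^sup>2))) (at 0)"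
      unfolding plane_dens_line
    proof (rule DERIV_sum)
      fix i assume "i \<in> {..<n}"
      then have "plane_dens L (x i) (x (Suc i)) \<noteq> 0" using pos[of i] by auto
      then show "((\<lambda>t. plane_feature (x i) (x (Suc i)) $ j / (plane_dens L (x i) (x (Suc i)) + t * plane_feature (x i) (x (Suc i)) $ k)) has_real_derivative
         - (plane_feature (x i) (x (Suc i)) $ k * plane_feature (x i) (x (Suc i)) $ j / (plane_dens L (x i) (x (Suc i)))\<^sup>2)) (at 0)"
        by (auto intro!: derivative_eq_intros simp: power2_eq_square mult_ac)
    qed
  qed
  show ?thesis unfolding observed_information_def d2 by (simp add: sum_negf)
qed

text \<open>
  Off the cube the value \<open>0\<close> is chosen: at the parameter \<open>0\<close> the density is \<open>1\<close> whatever the sample, so the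
  observed information is defined by the same formula as on the cube, and coverage events are
  measurable without passing to a completion.
\<close>

definition mle :: "(nat \<Rightarrow> (nat \<Rightarrow> real) \<Rightarrow> real^'s) \<Rightarrow> bool" where
  "mle T \<longleftrightarrow> (\<forall>n. T n \<in> borel_measurable (\<Pi>\<^sub>M i\<in>{..n}. borel) \<and>
     (\<forall>x\<in>{..n} \<rightarrow>\<^sub>E {0..1}. T n x \<in> \<Theta> \<and> (\<forall>q\<in>\<Theta>. likelihood n x q \<le> likelihood n x (T n x))) \<and>
     (\<forall>x. x \<notin> {..n} \<rightarrow>\<^sub>E {0..1} \<longrightarrow> T n x = 0))"

lemma mleD:
  assumes "mle T"
  shows "T n \<in> borel_measurable (\<Pi>\<^sub>M i\<in>{..n}. borel)"
    and "x \<in> {..n} \<rightarrow>\<^sub>E {0..1} \<Longrightarrow> T n x \<in> \<Theta>"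
    and "x \<in> {..n} \<rightarrow>\<^sub>E {0..1} \<Longrightarrow> q \<in> \<Theta> \<Longrightarrow> likelihood n x q \<le> likelihood n x (T n x)"
    and "x \<notin> {..n} \<rightarrow>\<^sub>E {0..1} \<Longrightarrow> T n x = 0"
  using assms unfolding mle_def by blast+

lemma mle_exists: "\<exists>T. mle T"
proof -
  have "\<forall>n. \<exists>T. T \<in> borel_measurable (\<Pi>\<^sub>M i\<in>{..n}. borel) \<and>
     (\<forall>x\<in>space (\<Pi>\<^sub>M i\<in>{..n}. (borel :: real measure)). T x \<in> \<Theta> \<and> (\<forall>q\<in>\<Theta>. likelihood n x q \<le> likelihood n x (T x)))"
    using likelihood_selection by blast
  then obtain S where S: "\<And>n. S n \<in> borel_measurable (\<Pi>\<^sub>M i\<in>{..n}. borel)"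
    "\<And>n x. x \<in> space (\<Pi>\<^sub>M i\<in>{..n}. (borel :: real measure)) \<Longrightarrow> S n x \<in> \<Theta> \<and> (\<forall>q\<in>\<Theta>. likelihood n x q \<le> likelihood n x (S n x))"
    by (auto dest!: choice)
  define T where "T n x = (if x \<in> {..n} \<rightarrow>\<^sub>E {0..1} then S n x else 0)" for n x
  show ?thesis unfolding mle_def
  proof (intro exI[of _ T] allI conjI ballI impI)
    fix n :: nat
    have "{..n} \<rightarrow>\<^sub>E {0..1::real} \<in> sets (\<Pi>\<^sub>M i\<in>{..n}. borel)" by (rule sets_PiM_I_finite) auto
    then show "T n \<in> borel_measurable (\<Pi>\<^sub>M i\<in>{..n}. borel)" unfolding T_def using S(1)
      by (intro measurable_If_set) (auto intro: sets.Int)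
  next
    fix n and x :: "nat \<Rightarrow> real" assume x: "x \<in> {..n} \<rightarrow>\<^sub>E {0..1}"
    have "x \<in> space (\<Pi>\<^sub>M i\<in>{..n}. (borel :: real measure))"
      using x by (auto simp: space_PiM PiE_def)
    note * = S(2)[OF this]
    show "T n x \<in> \<Theta>" unfolding T_def if_P[OF x] using * by (rule conjunct1)
    fix q assume "q \<in> \<Theta>"
    then show "likelihood n x q \<le> likelihood n x (T n x)" unfolding T_def if_P[OF x] by (rule bspec[OF conjunct2[OF *]])
  next
    fix n and x :: "nat \<Rightarrow> real" assume "x \<notin> {..n} \<rightarrow>\<^sub>E {0..1}"
    then show "T n x = 0" unfolding T_def by (rule if_not_P)
  qed
qed

lemma log_likelihood_eq_ln_ext:
  assumes x: "x \<in> {..n} \<rightarrow>\<^sub>E {0..1}" and L: "L \<in> \<Theta>"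
  shows "log_likelihood plane_dens n x L = ln_ext (likelihood n x L)"
proof -
  have "log_likelihood plane_dens n x L = (\<Sum>i<n. ln_ext (plane_dens L (x i) (x (Suc i))))"
    unfolding log_likelihood_def by (simp add: sum.atLeast1_atMost_eq)
  also have "\<dots> = (\<Sum>i<n. ln_ext (dens L (x i) (x (Suc i))))"
    by (intro sum.cong refl arg_cong[where f = ln_ext] plane_dens_eq_dens) (use x in \<open>auto simp: PiE_def Pi_def\<close>)
  also have "\<dots> = ln_ext (likelihood n x L)"
    unfolding likelihood_def by (intro sum_ln_ext dens_nonneg L) auto
  finally show ?thesis .
qed

lemma mle_max_likelihood_estimator:
  assumes "mle T"
  shows "max_likelihood_estimator plane_dens \<Theta> T"
  unfolding max_likelihood_estimator_def
proof (intro allI conjI ballI)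
  fix n show "T n \<in> borel_measurable (\<Pi>\<^sub>M i\<in>{..n}. borel)" using assms by (simp add: mle_def)
  fix x assume x: "x \<in> {..n} \<rightarrow>\<^sub>E {0..1::real}"
  have T: "T n x \<in> \<Theta>" "\<And>q. q \<in> \<Theta> \<Longrightarrow> likelihood n x q \<le> likelihood n x (T n x)" using mleD(2,3)[OF assms x] by blast+
  show "T n x \<in> \<Theta>" by (rule T)
  fix q assume q: "q \<in> \<Theta>"
  show "log_likelihood plane_dens n x q \<le> log_likelihood plane_dens n x (T n x)"
    unfolding log_likelihood_eq_ln_ext[OF x q] log_likelihood_eq_ln_ext[OF x T(1)] by (rule ln_ext_mono[OF T(2)[OF q]])
qed

lemma mle_plane_dens_pos:
  assumes "mle T" "i < n"
  shows "0 < plane_dens (T n x) (x i) (x (Suc i))"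
proof (cases "x \<in> {..n} \<rightarrow>\<^sub>E {0..1}")
  case True
  then have T: "T n x \<in> \<Theta>" "\<And>q. q \<in> \<Theta> \<Longrightarrow> likelihood n x q \<le> likelihood n x (T n x)" using mleD(2,3)[OF assms(1) True] by blast+
  have "plane_dens (T n x) (x i) (x (Suc i)) = dens (T n x) (x i) (x (Suc i))"
    by (rule plane_dens_eq_dens) (use True \<open>i < n\<close> in \<open>auto simp: PiE_def Pi_def\<close>)
  then show ?thesis using likelihood_maximizer(1)[OF T assms(2)] by simp
next
  case False
  then have "T n x = 0" using mleD(4)[OF assms(1)] by blast
  then show ?thesis by (simp add: plane_dens_def)
qed

end

section \<open>Score and information\<close>

lemma norm_power2_vec: "(norm x)\<^sup>2 = (\<Sum>k\<in>UNIV. (x $ k)\<^sup>2)" for x :: "real^'n"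
  unfolding power2_norm_eq_inner inner_vec_def by (simp add: power2_eq_square)

lemma norm_matrix_le_sum:
  fixes A :: "real^'n^'m"
  shows "norm A \<le> (\<Sum>i\<in>UNIV. \<Sum>j\<in>UNIV. \<bar>A $ i $ j\<bar>)"
proof -
  have "norm A \<le> (\<Sum>i\<in>UNIV. norm (A $ i))"
    unfolding norm_vec_def[of A] by (rule L2_set_le_sum) simp
  also have "\<dots> \<le> (\<Sum>i\<in>UNIV. \<Sum>j\<in>UNIV. \<bar>A $ i $ j\<bar>)" by (intro sum_mono norm_le_l1_cart)
  finally show ?thesis .
qed

lemma norm_matrix_vector_le:
  fixes A :: "real^'n^'m"
  shows "norm (A *v x) \<le> norm A * norm x"
proof -
  have "norm (A *v x) = L2_set (\<lambda>i. norm ((A *v x) $ i)) UNIV" by (rule norm_vec_def)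
  also have "\<dots> \<le> L2_set (\<lambda>i. norm (A $ i) * norm x) UNIV"
  proof (rule L2_set_mono)
    fix i
    have "(A *v x) $ i = A $ i \<bullet> x" by (simp add: matrix_vector_mult_def inner_vec_def)
    then show "norm ((A *v x) $ i) \<le> norm (A $ i) * norm x" by (simp add: Cauchy_Schwarz_ineq2)
  qed simp
  also have "\<dots> = norm A * norm x" unfolding norm_vec_def[of A] by (rule L2_set_left_distrib[symmetric]) simp
  finally show ?thesis .
qed

lemma (in prob_space) whp_finite_Ball:
  assumes "finite K" "\<And>k. k \<in> K \<Longrightarrow> whp M (P k)"
  shows "whp M (\<lambda>n \<omega>. \<forall>k\<in>K. P k n \<omega>)"
  using assms
proof (induction rule: finite_induct)
  case empty
  show ?case by (rule whp_AE) simp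
next
  case (insert x F)
  have "whp M (\<lambda>n \<omega>. P x n \<omega> \<and> (\<forall>k\<in>F. P k n \<omega>))"
    using insert by (intro whp_conj) auto
  then show ?case by simp
qed

lemma (in prob_space) prob_eventually_whp:
  assumes "prob_eventually M \<epsilon> P" "whp M Q" "0 < \<epsilon>'"
  shows "prob_eventually M (\<epsilon> + \<epsilon>') (\<lambda>n \<omega>. P n \<omega> \<and> Q n \<omega>)"
  using assms unfolding whp_def by (intro prob_eventually_conj) auto

text \<open>
  Bounded in probability times vanishing in probability: it suffices to argue for each bound \<open>R\<close>
  separately.
\<close>

lemma (in prob_space) whp_tight:
  assumes "tight_seq M X" "\<And>R. 0 < R \<Longrightarrow> whp M (Q R)"
    and "\<And>R n \<omega>. 0 < R \<Longrightarrow> norm (X n \<omega>) \<le> R \<Longrightarrow> Q R n \<omega> \<Longrightarrow> P n \<omega>"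
  shows "whp M P"
  unfolding whp_def
proof (intro allI impI)
  fix \<epsilon> :: real assume \<epsilon>: "0 < \<epsilon>"
  then obtain R where R: "prob_eventually M (\<epsilon>/2) (\<lambda>n \<omega>. norm (X n \<omega>) \<le> R)"
    using assms(1) unfolding tight_seq_def by (meson half_gt_zero)
  define R' where "R' = max 1 R"
  have "prob_eventually M (\<epsilon>/2 + \<epsilon>/2) (\<lambda>n \<omega>. norm (X n \<omega>) \<le> R \<and> Q R' n \<omega>)"
    using \<epsilon> by (intro prob_eventually_whp[OF R] assms(2)) (auto simp: R'_def)
  then have "prob_eventually M (\<epsilon>/2 + \<epsilon>/2) P"
  proof (rule prob_eventually_mono[where N = 0])
    fix n \<omega> assume "norm (X n \<omega>) \<le> R \<and> Q R' n \<omega>"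
    then show "P n \<omega>" by (intro assms(3)[of R']) (auto simp: R'_def)
  qed
  then show "prob_eventually M \<epsilon> P" by simp
qed

lemma (in prob_space) tight_dominated:
  assumes "tight_seq M X" "whp M (\<lambda>n \<omega>. norm (Y n \<omega>) \<le> C * norm (X n \<omega>))" "0 \<le> C"
  shows "tight_seq M Y"
  unfolding tight_seq_def
proof (intro allI impI)
  fix \<epsilon> :: real assume \<epsilon>: "0 < \<epsilon>"
  then obtain R where R: "prob_eventually M (\<epsilon>/2) (\<lambda>n \<omega>. norm (X n \<omega>) \<le> R)"
    using assms(1) unfolding tight_seq_def by (meson half_gt_zero)
  have "prob_eventually M (\<epsilon>/2 + \<epsilon>/2) (\<lambda>n \<omega>. norm (X n \<omega>) \<le> R \<and> norm (Y n \<omega>) \<le> C * norm (X n \<omega>))"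
    using \<epsilon> by (intro prob_eventually_whp[OF R] assms(2)) auto
  then have "prob_eventually M (\<epsilon>/2 + \<epsilon>/2) (\<lambda>n \<omega>. norm (Y n \<omega>) \<le> C * R)"
    by (rule prob_eventually_mono[where N = 0]) (use assms(3) in \<open>auto intro: order_trans mult_left_mono\<close>)
  then show "\<exists>R. prob_eventually M \<epsilon> (\<lambda>n \<omega>. norm (Y n \<omega>) \<le> R)" by auto
qed

context finite_rank_chain begin

lemma expectation_pair:
  assumes k: "(\<lambda>(u, v). k u v) \<in> borel_measurable (borel \<Otimes>\<^sub>M borel)" and bd: "\<And>u v. \<bar>k u v :: real\<bar> \<le> K"
  shows "(\<integral>\<omega>. k (U 0 \<omega>) (U 1 \<omega>) \<partial>M) = dens_mean k"
proof -
  have mm: "(\<lambda>z. k (fst z 0) (snd z)) \<in> borel_measurable ((\<Pi>\<^sub>M i\<in>{..0::nat}. borel) \<Otimes>\<^sub>M (borel :: real measure))"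
  proof -
    have "(\<lambda>z. (fst z 0, snd z)) \<in> measurable ((\<Pi>\<^sub>M i\<in>{..0::nat}. borel) \<Otimes>\<^sub>M (borel :: real measure)) (borel \<Otimes>\<^sub>M (borel :: real measure))"
      by measurable
    from measurable_compose[OF this k] show ?thesis by simp
  qed
  have ku: "k u \<in> borel_measurable borel" for u using measurable_Pair2[OF k, of u] by simp
  have [measurable]: "(\<lambda>u. \<integral>v. dens L u v * k u v \<partial>unif01) \<in> borel_measurable borel"
    using k by measurable
  have s0: "sample U 0 \<omega> 0 = U 0 \<omega>" for \<omega> by (simp add: sample_def)
  define F where "F = (\<lambda>z :: (nat \<Rightarrow> real) \<times> real. complex_of_real (k (fst z 0) (snd z)))"
  have "complex_of_real (\<integral>\<omega>. k (U 0 \<omega>) (U 1 \<omega>) \<partial>M) = (\<integral>\<omega>. F (sample U 0 \<omega>, U (Suc 0) \<omega>) \<partial>M)"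
    by (simp add: F_def s0)
  also have "\<dots> = (\<integral>\<omega>. (\<integral>v. dens L (U 0 \<omega>) v *\<^sub>R F (sample U 0 \<omega>, v) \<partial>unif01) \<partial>M)"
    by (rule transition[where K = K]) (use mm bd in \<open>auto simp: F_def\<close>)
  also have "\<dots> = (\<integral>\<omega>. complex_of_real (\<integral>v. dens L (U 0 \<omega>) v * k (U 0 \<omega>) v \<partial>unif01) \<partial>M)"
    by (simp only: F_def fst_conv snd_conv s0 scaleR_conv_of_real of_real_mult[symmetric] integral_complex_of_real)
  also have "\<dots> = complex_of_real (\<integral>\<omega>. (\<integral>v. dens L (U 0 \<omega>) v * k (U 0 \<omega>) v \<partial>unif01) \<partial>M)"
    by (rule integral_complex_of_real)
  also have "(\<integral>\<omega>. (\<integral>v. dens L (U 0 \<omega>) v * k (U 0 \<omega>) v \<partial>unif01) \<partial>M) =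
      (\<integral>u. (\<integral>v. dens L u v * k u v \<partial>unif01) \<partial>distr M borel (U 0))"
    by (subst integral_distr) auto
  finally show ?thesis by (simp add: dens_mean_def U_distr)
qed

definition score :: "real \<Rightarrow> real \<Rightarrow> real^'s" where
  "score u v = (1 / dens L u v) *\<^sub>R feature u v"


definition fisher_info :: "real^'s^'s" where
  "fisher_info = (\<chi> i j. dens_mean (\<lambda>u v. score u v $ i * score u v $ j))"

lemma score_measurable[measurable (raw)]:
  assumes [measurable]: "g \<in> borel_measurable N" "h \<in> borel_measurable N"
  shows "(\<lambda>x. score (g x) (h x)) \<in> borel_measurable N"
  unfolding score_def by measurable

lemma norm_score: "norm (score u v) \<le> \<beta> / \<delta>"
proof -
  have "norm (score u v) = norm (feature u v) / dens L u v"
    using dens_L_pos[of u v] by (simp add: score_def)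
  also have "\<dots> \<le> \<beta> / \<delta>" using norm_feature dens_L_ge \<delta>_pos \<beta>_ge_1 by (intro frac_le) auto
  finally show ?thesis .
qed

lemma score_nth_bound: "\<bar>score u v $ k\<bar> \<le> \<beta> / \<delta>"
  using component_le_norm_cart norm_score by (rule order_trans)

lemma inner_score_bound: "\<bar>a \<bullet> score u v\<bar> \<le> norm a * (\<beta> / \<delta>)"
  by (rule order_trans[OF Cauchy_Schwarz_ineq2]) (intro mult_left_mono norm_score norm_ge_zero)

lemma inner_score_measurable: "(\<lambda>(u, v). a \<bullet> score u v) \<in> borel_measurable (borel \<Otimes>\<^sub>M borel)"
  unfolding split_beta' by measurable

lemma score_nth_measurable[measurable (raw)]:
  assumes "g \<in> borel_measurable N" "h \<in> borel_measurable N"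
  shows "(\<lambda>x. score (g x) (h x) $ k) \<in> borel_measurable N"
  using measurable_compose[OF score_measurable[OF assms], of "\<lambda>x. axis k 1 \<bullet> x" borel]
  by (simp add: inner_axis')

lemma score_product_measurable:
  "(\<lambda>(u, v). score u v $ i * score u v $ j) \<in> borel_measurable (borel \<Otimes>\<^sub>M borel)"
  unfolding split_beta' by measurable

lemma score_product_bound: "\<bar>score u v $ i * score u v $ j\<bar> \<le> (\<beta> / \<delta>)\<^sup>2"
  unfolding abs_mult power2_eq_square using \<beta>_ge_1 \<delta>_pos by (intro mult_mono score_nth_bound) auto

lemma score_mean_zero: "(\<integral>v. dens L u v * (a \<bullet> score u v) \<partial>unif01) = 0"
proof -
  have "dens L u v * (a \<bullet> score u v) = (\<Sum>k\<in>UNIV. a $ k * f k u * f k v)" for v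
    using dens_L_pos[of u v] by (simp add: score_def feature_def inner_vec_def sum_distrib_left mult_ac)
  moreover have "integrable unif01 (f k)" for k
    by (rule integrable_unif01[where K = "sqrt (b k)"]) (use f_abs in auto)
  ultimately show ?thesis by (simp add: f_mean)
qed

lemma fisher_info_inner: "a \<bullet> (fisher_info *v a') = dens_mean (\<lambda>u v. (a \<bullet> score u v) * (a' \<bullet> score u v))"
proof -
  have i: "integrable M (\<lambda>\<omega>. score (U 0 \<omega>) (U 1 \<omega>) $ i * score (U 0 \<omega>) (U 1 \<omega>) $ j)" for i j
    by (rule integrable_const_bound[where B = "(\<beta> / \<delta>)\<^sup>2"]) (use score_product_bound in auto)
  have S: "fisher_info $ i $ j = (\<integral>\<omega>. score (U 0 \<omega>) (U 1 \<omega>) $ i * score (U 0 \<omega>) (U 1 \<omega>) $ j \<partial>M)" for i j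
    unfolding fisher_info_def vec_lambda_beta
    by (rule expectation_pair[OF score_product_measurable score_product_bound, symmetric])
  have "dens_mean (\<lambda>u v. (a \<bullet> score u v) * (a' \<bullet> score u v)) =
      (\<integral>\<omega>. (a \<bullet> score (U 0 \<omega>) (U 1 \<omega>)) * (a' \<bullet> score (U 0 \<omega>) (U 1 \<omega>)) \<partial>M)"
  proof (rule expectation_pair[symmetric])
    show "(\<lambda>(u, v). (a \<bullet> score u v) * (a' \<bullet> score u v)) \<in> borel_measurable (borel \<Otimes>\<^sub>M borel)"
      unfolding split_beta' by measurable
    show "\<bar>(a \<bullet> score u v) * (a' \<bullet> score u v)\<bar> \<le> (norm a * (\<beta> / \<delta>)) * (norm a' * (\<beta> / \<delta>))" for u v
      unfolding abs_mult using \<beta>_ge_1 \<delta>_pos by (intro mult_mono inner_score_bound) auto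
  qed
  also have "\<dots> = (\<integral>\<omega>. (\<Sum>i\<in>UNIV. \<Sum>j\<in>UNIV. a $ i * a' $ j * (score (U 0 \<omega>) (U 1 \<omega>) $ i * score (U 0 \<omega>) (U 1 \<omega>) $ j)) \<partial>M)"
    by (intro Bochner_Integration.integral_cong refl) (simp add: inner_vec_def sum_product mult_ac)
  also have "\<dots> = (\<Sum>i\<in>UNIV. \<Sum>j\<in>UNIV. a $ i * a' $ j * fisher_info $ i $ j)"
    using i by (simp add: S)
  also have "\<dots> = a \<bullet> (fisher_info *v a')"
    by (simp add: inner_vec_def matrix_vector_mult_def sum_distrib_left mult_ac)
  finally show ?thesis by simp
qed

text \<open>
  Since \<open>dens L \<le> 2\<close>, the quadratic form dominates one half of the integral of \<open>(x \<bullet> feature)\<^sup>2\<close>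
  over the unit square, which is one half of \<open>|x|\<^sup>2\<close> by orthonormality.
\<close>

lemma fisher_info_lower_bound: "(norm x)\<^sup>2 / 2 \<le> x \<bullet> (fisher_info *v x)"
proof -
  define K where "K = (norm x * (\<beta> / \<delta>))\<^sup>2"
  define q where "q u v = (x \<bullet> score u v)\<^sup>2" for u v
  have qm: "(\<lambda>(u, v). q u v) \<in> borel_measurable (borel \<Otimes>\<^sub>M borel)" unfolding split_beta' q_def by measurable
  have qu[measurable]: "q u \<in> borel_measurable borel" for u using measurable_Pair2[OF qm, of u] by simp
  have qK: "\<bar>q u v\<bar> \<le> K" for u v
    using inner_score_bound[of x u v] \<beta>_ge_1 \<delta>_pos by (simp add: q_def K_def abs_le_square_iff[symmetric])
  have pm: "(\<lambda>u. \<integral>v. dens L u v * q u v \<partial>unif01) \<in> borel_measurable borel" using qm by measurable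
  have ffi: "integrable unif01 (\<lambda>v. f k v * f j v)" for k j
  proof (rule integrable_unif01[where K = "sqrt (b k) * sqrt (b j)"])
    show "norm (f k v * f j v) \<le> sqrt (b k) * sqrt (b j)" for v
      unfolding real_norm_def abs_mult using b_ge_1 by (intro mult_mono f_abs) (auto intro: order_trans[OF zero_le_one])
  qed measurable
  have inner: "(\<Sum>k\<in>UNIV. (x $ k)\<^sup>2 * (f k u * f k u)) / 2 \<le> (\<integral>v. dens L u v * q u v \<partial>unif01)" for u
  proof -
    have sq: "(x \<bullet> feature u v)\<^sup>2 = (\<Sum>k\<in>UNIV. \<Sum>j\<in>UNIV. (x $ k * f k u) * (x $ j * f j u) * (f k v * f j v))" for v
      by (simp add: feature_def inner_vec_def power2_eq_square sum_product mult_ac)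
    have "(\<integral>v. (x \<bullet> feature u v)\<^sup>2 \<partial>unif01) = (\<Sum>k\<in>UNIV. \<Sum>j\<in>UNIV. (x $ k * f k u) * (x $ j * f j u) * (if k = j then 1 else 0))"
      unfolding sq using ffi by (simp add: f_orth)
    also have "\<dots> = (\<Sum>k\<in>UNIV. (x $ k)\<^sup>2 * (f k u * f k u))"
      by (simp add: if_distrib sum.delta power2_eq_square mult_ac cong: if_cong)
    finally have e: "(\<integral>v. (x \<bullet> feature u v)\<^sup>2 \<partial>unif01) = (\<Sum>k\<in>UNIV. (x $ k)\<^sup>2 * (f k u * f k u))" .
    have fi: "integrable unif01 (\<lambda>v. (x \<bullet> feature u v)\<^sup>2)" unfolding sq using ffi by (intro Bochner_Integration.integrable_sum) simp
    have "(\<integral>v. (x \<bullet> feature u v)\<^sup>2 / 2 \<partial>unif01) \<le> (\<integral>v. dens L u v * q u v \<partial>unif01)"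
    proof (rule integral_mono)
      show "integrable unif01 (\<lambda>v. (x \<bullet> feature u v)\<^sup>2 / 2)" using fi by simp
      show "integrable unif01 (\<lambda>v. dens L u v * q u v)" by (rule dens_L_integrable[OF qu qK])
      fix v
      have "dens L u v * q u v = (x \<bullet> feature u v)\<^sup>2 / dens L u v"
        using dens_L_pos[of u v] by (simp add: q_def score_def power2_eq_square)
      also have "\<dots> \<ge> (x \<bullet> feature u v)\<^sup>2 / 2"
        using dens_L_pos[of u v] dens_L_le[of u v] by (intro divide_left_mono) auto
      finally show "(x \<bullet> feature u v)\<^sup>2 / 2 \<le> dens L u v * q u v" .
    qed
    then show ?thesis using e by simp
  qed
  have "(norm x)\<^sup>2 / 2 = (\<integral>u. (\<Sum>k\<in>UNIV. (x $ k)\<^sup>2 * (f k u * f k u)) / 2 \<partial>unif01)"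
    using ffi by (simp add: f_orth norm_power2_vec)
  also have "\<dots> \<le> (\<integral>u. (\<integral>v. dens L u v * q u v \<partial>unif01) \<partial>unif01)"
  proof (rule integral_mono[OF _ _ inner])
    show "integrable unif01 (\<lambda>u. (\<Sum>k\<in>UNIV. (x $ k)\<^sup>2 * (f k u * f k u)) / 2)" using ffi by simp
    show "integrable unif01 (\<lambda>u. \<integral>v. dens L u v * q u v \<partial>unif01)"
    proof (rule integrable_unif01[OF pm])
      fix u
      have "norm (\<integral>v. dens L u v * q u v \<partial>unif01) \<le> (\<integral>v. norm (dens L u v * q u v) \<partial>unif01)" by (rule integral_norm_bound)
      also have "\<dots> \<le> (\<integral>v. 2 * K \<partial>unif01)"
      proof (rule integral_mono)
        show "integrable unif01 (\<lambda>v. norm (dens L u v * q u v))" using dens_L_integrable[OF qu qK] by (rule integrable_norm)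
        show "norm (dens L u v * q u v) \<le> 2 * K" for v
          unfolding real_norm_def abs_mult using dens_L_le[of u v] dens_L_pos[of u v] qK by (intro mult_mono) auto
      qed simp
      finally show "norm (\<integral>v. dens L u v * q u v \<partial>unif01) \<le> 2 * K" by (simp add: unif01.prob_space)
    qed
  qed
  also have "\<dots> = x \<bullet> (fisher_info *v x)" unfolding fisher_info_inner dens_mean_def q_def power2_eq_square ..
  finally show ?thesis .
qed

lemma pos_def_fisher_info: "pos_def_matrix fisher_info"
  unfolding pos_def_matrix_def
proof (intro conjI allI impI)
  show "transpose fisher_info = fisher_info" by (simp add: fisher_info_def transpose_def vec_eq_iff mult.commute)
  fix x :: "real^'s" assume "x \<noteq> 0"
  then have "0 < (norm x)\<^sup>2 / 2" by simp
  then show "0 < x \<bullet> (fisher_info *v x)" using fisher_info_lower_bound by (rule less_le_trans)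
qed

definition score_sum :: "nat \<Rightarrow> 'w \<Rightarrow> real^'s" where
  "score_sum n \<omega> = (\<Sum>i<n. score (U i \<omega>) (U (Suc i) \<omega>))"

text \<open>
  Normalized by the sample size, and taken at the true parameter.
\<close>

definition sample_info :: "nat \<Rightarrow> 'w \<Rightarrow> real^'s^'s" where
  "sample_info n \<omega> = (\<chi> k j. (\<Sum>i<n. score (U i \<omega>) (U (Suc i) \<omega>) $ k * score (U i \<omega>) (U (Suc i) \<omega>) $ j) / n)"

lemma score_sum_measurable[measurable]: "score_sum n \<in> borel_measurable M" unfolding score_sum_def by measurable

lemma inner_score_sum: "a \<bullet> score_sum n \<omega> = (\<Sum>i<n. a \<bullet> score (U i \<omega>) (U (Suc i) \<omega>))"
  by (simp add: score_sum_def inner_sum_right)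

lemma score_clt:
  "(\<lambda>n. \<integral>\<omega>. iexp (a \<bullet> ((1 / sqrt n) *\<^sub>R score_sum n \<omega>)) \<partial>M) \<longlonglongrightarrow> of_real (exp (- (a \<bullet> (fisher_info *v a)) / 2))"
proof -
  have "dens_mean (\<lambda>u v. (a \<bullet> score u v)\<^sup>2) = a \<bullet> (fisher_info *v a)"
    unfolding fisher_info_inner power2_eq_square ..
  then show ?thesis
    using char_function_limit[OF inner_score_measurable inner_score_bound score_mean_zero, of a]
    by (simp add: inner_score_sum)
qed

lemma score_tight: "tight_seq M (\<lambda>n \<omega>. (1 / sqrt n) *\<^sub>R score_sum n \<omega>)"
proof (rule tight_second_moment)
  show "(\<lambda>\<omega>. (1 / sqrt (real n)) *\<^sub>R score_sum n \<omega>) \<in> borel_measurable M" for n by measurable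
  have comp: "norm (score_sum n \<omega>) \<le> n * (\<beta> / \<delta>)" for n \<omega>
    unfolding score_sum_def using sum_bounded_above[of "{..<n}" "\<lambda>i. norm (score (U i \<omega>) (U (Suc i) \<omega>))" "\<beta> / \<delta>"] norm_score
    by (intro order_trans[OF norm_sum]) auto
  have iS: "integrable M (\<lambda>\<omega>. (score_sum n \<omega> $ k)\<^sup>2)" for n k
  proof (rule integrable_const_bound[where B = "(n * (\<beta> / \<delta>))\<^sup>2"])
    have m: "(\<lambda>\<omega>. score_sum n \<omega> $ k) = (\<lambda>\<omega>. axis k 1 \<bullet> score_sum n \<omega>)" by (simp add: inner_axis')
    show "(\<lambda>\<omega>. (score_sum n \<omega> $ k)\<^sup>2) \<in> borel_measurable M" unfolding fun_cong[OF m] by measurable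
    have "\<bar>score_sum n \<omega> $ k\<bar> \<le> n * (\<beta> / \<delta>)" for \<omega> using component_le_norm_cart comp by (rule order_trans)
    then have "(score_sum n \<omega> $ k)\<^sup>2 \<le> (n * (\<beta> / \<delta>))\<^sup>2" for \<omega>
      by (intro abs_le_square_iff[THEN iffD1]) (rule order_trans[OF _ abs_ge_self])
    then show "AE \<omega> in M. norm ((score_sum n \<omega> $ k)\<^sup>2) \<le> (n * (\<beta> / \<delta>))\<^sup>2"
      by (intro AE_I2) simp
  qed
  have n2: "(norm ((1 / sqrt (real n)) *\<^sub>R score_sum n \<omega>))\<^sup>2 = (\<Sum>k\<in>UNIV. (score_sum n \<omega> $ k)\<^sup>2 / n)" for n \<omega>
    by (simp add: norm_power2_vec power_divide sum_divide_distrib)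
  show "integrable M (\<lambda>\<omega>. (norm ((1 / sqrt (real n)) *\<^sub>R score_sum n \<omega>))\<^sup>2)" for n
    unfolding n2 using iS by simp
  show "(\<integral>\<omega>. (norm ((1 / sqrt (real n)) *\<^sub>R score_sum n \<omega>))\<^sup>2 \<partial>M) \<le> real CARD('s) * (\<beta> / \<delta>)\<^sup>2" for n
  proof -
    have "(\<integral>\<omega>. (norm ((1 / sqrt (real n)) *\<^sub>R score_sum n \<omega>))\<^sup>2 \<partial>M) = (\<Sum>k\<in>UNIV. (\<integral>\<omega>. (score_sum n \<omega> $ k)\<^sup>2 \<partial>M) / n)"
      unfolding n2 using iS by simp
    also have "\<dots> \<le> (\<Sum>k\<in>(UNIV :: 's set). (\<beta> / \<delta>)\<^sup>2)"
    proof (rule sum_mono)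
      fix k :: 's
      have "(\<integral>\<omega>. (\<Sum>i<n. axis k 1 \<bullet> score (U i \<omega>) (U (Suc i) \<omega>))\<^sup>2 \<partial>M) \<le> n * (norm (axis k 1 :: real^'s) * (\<beta> / \<delta>))\<^sup>2"
        by (rule martingale_second_moment[OF inner_score_measurable inner_score_bound score_mean_zero])
      then have "(\<integral>\<omega>. (score_sum n \<omega> $ k)\<^sup>2 \<partial>M) \<le> n * (\<beta> / \<delta>)\<^sup>2"
        by (simp add: score_sum_def inner_axis')
      then show "(\<integral>\<omega>. (score_sum n \<omega> $ k)\<^sup>2 \<partial>M) / n \<le> (\<beta> / \<delta>)\<^sup>2"
        by (cases "n = 0") (auto simp: field_simps)
    qed
    finally show ?thesis by simp
  qed
qed

lemma sample_info_lln:
  assumes "0 < \<eta>"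
  shows "whp M (\<lambda>n \<omega>. norm (sample_info n \<omega> - fisher_info) \<le> \<eta>)"
proof -
  define c where "c = real CARD('s) * real CARD('s)"
  have c: "0 < c" unfolding c_def by simp
  have ent: "whp M (\<lambda>n \<omega>. \<bar>(\<Sum>i<n. score (U i \<omega>) (U (Suc i) \<omega>) $ k * score (U i \<omega>) (U (Suc i) \<omega>) $ j) / n - fisher_info $ k $ j\<bar> < \<eta> / c)" for k j
  proof (rule whp_second_moment)
    define Kb where "Kb = (\<beta> / \<delta>)\<^sup>2"
    note m = score_product_measurable[of k j] and bd = score_product_bound[of _ _ k j, folded Kb_def]
    obtain C where C: "\<And>n. n \<ge> 1 \<Longrightarrow>
      (\<integral>\<omega>. ((\<Sum>i<n. score (U i \<omega>) (U (Suc i) \<omega>) $ k * score (U i \<omega>) (U (Suc i) \<omega>) $ j) / n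
         - dens_mean (\<lambda>u v. score u v $ k * score u v $ j))\<^sup>2 \<partial>M) \<le> C / n"
      by (rule law_of_large_numbers[OF m bd]) blast
    have Sg: "fisher_info $ k $ j = dens_mean (\<lambda>u v. score u v $ k * score u v $ j)" by (simp add: fisher_info_def)
    let ?X = "\<lambda>n \<omega>. (\<Sum>i<n. score (U i \<omega>) (U (Suc i) \<omega>) $ k * score (U i \<omega>) (U (Suc i) \<omega>) $ j) / n - fisher_info $ k $ j"
    show meas: "?X n \<in> borel_measurable M" for n by measurable
    have bX: "\<bar>?X n \<omega>\<bar> \<le> Kb + \<bar>fisher_info $ k $ j\<bar>" for n \<omega>
    proof -
      have "\<bar>\<Sum>i<n. score (U i \<omega>) (U (Suc i) \<omega>) $ k * score (U i \<omega>) (U (Suc i) \<omega>) $ j\<bar> \<le> n * Kb"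
        using sum_bounded_above[of "{..<n}" "\<lambda>i. \<bar>score (U i \<omega>) (U (Suc i) \<omega>) $ k * score (U i \<omega>) (U (Suc i) \<omega>) $ j\<bar>" Kb] bd
        by (intro order_trans[OF sum_abs]) auto
      then have "\<bar>(\<Sum>i<n. score (U i \<omega>) (U (Suc i) \<omega>) $ k * score (U i \<omega>) (U (Suc i) \<omega>) $ j) / n\<bar> \<le> Kb"
        by (cases "n = 0") (auto simp: Kb_def field_simps)
      then show ?thesis by linarith
    qed
    show "integrable M (\<lambda>\<omega>. (?X n \<omega>)\<^sup>2)" for n
    proof (rule integrable_const_bound[where B = "(Kb + \<bar>fisher_info $ k $ j\<bar>)\<^sup>2"])
      show "AE \<omega> in M. norm ((?X n \<omega>)\<^sup>2) \<le> (Kb + \<bar>fisher_info $ k $ j\<bar>)\<^sup>2"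
      proof (rule AE_I2)
        fix \<omega>
        have "(?X n \<omega>)\<^sup>2 \<le> (Kb + \<bar>fisher_info $ k $ j\<bar>)\<^sup>2"
          by (intro abs_le_square_iff[THEN iffD1]) (rule order_trans[OF bX abs_ge_self])
        then show "norm ((?X n \<omega>)\<^sup>2) \<le> (Kb + \<bar>fisher_info $ k $ j\<bar>)\<^sup>2" by simp
      qed
    qed (use meas in measurable)
    show "(\<lambda>n. \<integral>\<omega>. (?X n \<omega>)\<^sup>2 \<partial>M) \<longlonglongrightarrow> 0"
    proof (rule Lim_null_comparison)
      show "\<forall>\<^sub>F n in sequentially. norm (\<integral>\<omega>. (?X n \<omega>)\<^sup>2 \<partial>M) \<le> C / n"
        using eventually_ge_at_top[of 1]
      proof eventually_elim
        case (elim n)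
        have "0 \<le> (\<integral>\<omega>. (?X n \<omega>)\<^sup>2 \<partial>M)" by simp
        then show ?case using C[OF elim] unfolding Sg by (simp only: real_norm_def abs_of_nonneg)
      qed
      show "(\<lambda>n. C / real n) \<longlonglongrightarrow> 0" by real_asymp
    qed
    show "0 < \<eta> / c" using assms c by simp
  qed
  have "whp M (\<lambda>n \<omega>. \<forall>kj\<in>(UNIV :: ('s \<times> 's) set).
      \<bar>(\<Sum>i<n. score (U i \<omega>) (U (Suc i) \<omega>) $ fst kj * score (U i \<omega>) (U (Suc i) \<omega>) $ snd kj) / n - fisher_info $ fst kj $ snd kj\<bar> < \<eta> / c)"
    by (rule whp_finite_Ball) (auto intro: ent)
  then show ?thesis
  proof (rule whp_mono[where N = 0])
    fix n \<omega> assume *: "\<forall>kj\<in>(UNIV :: ('s \<times> 's) set).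
      \<bar>(\<Sum>i<n. score (U i \<omega>) (U (Suc i) \<omega>) $ fst kj * score (U i \<omega>) (U (Suc i) \<omega>) $ snd kj) / n - fisher_info $ fst kj $ snd kj\<bar> < \<eta> / c"
    have "norm (sample_info n \<omega> - fisher_info) \<le> (\<Sum>k\<in>UNIV. \<Sum>j\<in>UNIV. \<bar>(sample_info n \<omega> - fisher_info) $ k $ j\<bar>)" by (rule norm_matrix_le_sum)
    also have "\<dots> \<le> (\<Sum>k\<in>(UNIV :: 's set). \<Sum>j\<in>(UNIV :: 's set). \<eta> / c)"
    proof (intro sum_mono)
      fix k j :: 's
      show "\<bar>(sample_info n \<omega> - fisher_info) $ k $ j\<bar> \<le> \<eta> / c" using bspec[OF *, of "(k, j)"] by (simp add: sample_info_def)
    qed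
    also have "\<dots> = \<eta>" using c by (simp add: c_def)
    finally show "norm (sample_info n \<omega> - fisher_info) \<le> \<eta>" .
  qed
qed

end

section \<open>Asymptotics of the estimator\<close>

lemma (in prob_space) whp_eventually:
  assumes "\<forall>\<^sub>F n in sequentially. \<forall>\<omega>. P n \<omega>"
  shows "whp M P"
  unfolding whp_def prob_eventually_def
proof (intro allI impI)
  fix \<epsilon> :: real assume "0 < \<epsilon>"
  show "\<forall>\<^sub>F n in sequentially. \<exists>A\<in>events. prob (space M - A) \<le> \<epsilon> \<and> (\<forall>\<omega>\<in>A. P n \<omega>)"
    using assms by eventually_elim (use \<open>0 < \<epsilon>\<close> in \<open>auto intro!: bexI[of _ "space M"]\<close>)
qed

lemma reciprocal_expansion:
  fixes c t x :: real
  assumes "c \<noteq> 0" "t \<noteq> 0" "t = c + x"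
  shows "x / c\<^sup>2 - 1 / c + 1 / t = x\<^sup>2 / (c\<^sup>2 * t)"
proof -
  have x: "x = t - c" using assms by simp
  show ?thesis unfolding x using assms(1,2) by (simp add: field_simps power2_eq_square)
qed

lemma reciprocal_square_difference:
  fixes a c t x :: real
  assumes "c \<noteq> 0" "t \<noteq> 0" "t = c + x"
  shows "a / t\<^sup>2 - a / c\<^sup>2 = a * ((- x) * (c + t)) / (c\<^sup>2 * t\<^sup>2)"
proof -
  have x: "x = t - c" using assms by simp
  show ?thesis unfolding x using assms(1,2) by (simp add: field_simps power2_eq_square)
qed

text \<open>
  The estimator satisfies the first-order conditions of a maximizer: the variational inequality in
  the direction of the true parameter and, in the interior, the likelihood equations.
\<close>

locale chain_estimator = finite_rank_chain f b M U L
  for f :: "'s::finite \<Rightarrow> real \<Rightarrow> real" and b :: "'s \<Rightarrow> real" and M :: "'w measure" and U L +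
  fixes T :: "nat \<Rightarrow> 'w \<Rightarrow> real^'s"
  assumes T_meas[measurable]: "\<And>n. T n \<in> borel_measurable M"
    and T_opt: "\<And>n. AE \<omega> in M. T n \<omega> \<in> \<Theta> \<and> (\<forall>i<n. 0 < dens (T n \<omega>) (U i \<omega>) (U (Suc i) \<omega>)) \<and>
      (\<Sum>i<n. ((L - T n \<omega>) \<bullet> feature (U i \<omega>) (U (Suc i) \<omega>)) / dens (T n \<omega>) (U i \<omega>) (U (Suc i) \<omega>)) \<le> 0 \<and>
      (weight (T n \<omega>) < 1 \<longrightarrow>
        (\<Sum>i<n. (1 / dens (T n \<omega>) (U i \<omega>) (U (Suc i) \<omega>)) *\<^sub>R feature (U i \<omega>) (U (Suc i) \<omega>)) = 0)"
begin

definition likelihood_conditions :: "nat \<Rightarrow> 'w \<Rightarrow> bool" where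
  "likelihood_conditions n \<omega> \<longleftrightarrow> T n \<omega> \<in> \<Theta> \<and> (\<forall>i<n. 0 < dens (T n \<omega>) (U i \<omega>) (U (Suc i) \<omega>)) \<and>
      (\<Sum>i<n. ((L - T n \<omega>) \<bullet> feature (U i \<omega>) (U (Suc i) \<omega>)) / dens (T n \<omega>) (U i \<omega>) (U (Suc i) \<omega>)) \<le> 0 \<and>
      (weight (T n \<omega>) < 1 \<longrightarrow>
        (\<Sum>i<n. (1 / dens (T n \<omega>) (U i \<omega>) (U (Suc i) \<omega>)) *\<^sub>R feature (U i \<omega>) (U (Suc i) \<omega>)) = 0)"

definition err :: "nat \<Rightarrow> 'w \<Rightarrow> real^'s" where "err n \<omega> = T n \<omega> - L"
definition scaled_err :: "nat \<Rightarrow> 'w \<Rightarrow> real^'s" where "scaled_err n \<omega> = sqrt n *\<^sub>R (T n \<omega> - L)"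
definition scaled_score :: "nat \<Rightarrow> 'w \<Rightarrow> real^'s" where "scaled_score n \<omega> = (1 / sqrt n) *\<^sub>R score_sum n \<omega>"
text \<open>
  The information at the estimator instead of the true parameter.
\<close>

definition plug_in_info :: "nat \<Rightarrow> 'w \<Rightarrow> real^'s^'s" where
  "plug_in_info n \<omega> = (\<chi> k j. (\<Sum>i<n. feature (U i \<omega>) (U (Suc i) \<omega>) $ k * feature (U i \<omega>) (U (Suc i) \<omega>) $ j /
      (dens (T n \<omega>) (U i \<omega>) (U (Suc i) \<omega>))\<^sup>2) / n)"

lemma scaled_err_measurable[measurable]: "scaled_err n \<in> borel_measurable M" unfolding scaled_err_def by measurable
lemma scaled_score_measurable[measurable]: "scaled_score n \<in> borel_measurable M" unfolding scaled_score_def by measurable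

lemma whp_likelihood_conditions: "whp M likelihood_conditions" unfolding likelihood_conditions_def by (rule whp_AE) (rule T_opt)

lemma dens_T: "dens (T n \<omega>) u v = dens L u v + err n \<omega> \<bullet> feature u v"
  by (simp add: dens_def err_def inner_diff_left)

lemma err_score: "err n \<omega> \<bullet> score u v = (err n \<omega> \<bullet> feature u v) / dens L u v"
  by (simp add: score_def)

lemma sample_info_mult: "sample_info n \<omega> *v x = (1 / n) *\<^sub>R (\<Sum>i<n. (score (U i \<omega>) (U (Suc i) \<omega>) \<bullet> x) *\<^sub>R score (U i \<omega>) (U (Suc i) \<omega>))"
proof -
  have "(sample_info n \<omega> *v x) $ k = (\<Sum>i<n. (score (U i \<omega>) (U (Suc i) \<omega>) \<bullet> x) * score (U i \<omega>) (U (Suc i) \<omega>) $ k) / n" for k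
  proof -
    have "(sample_info n \<omega> *v x) $ k = (\<Sum>j\<in>UNIV. (\<Sum>i<n. score (U i \<omega>) (U (Suc i) \<omega>) $ k * score (U i \<omega>) (U (Suc i) \<omega>) $ j * x $ j)) / n"
      by (simp add: sample_info_def matrix_vector_mult_def sum_divide_distrib sum_distrib_right)
    also have "(\<Sum>j\<in>UNIV. (\<Sum>i<n. score (U i \<omega>) (U (Suc i) \<omega>) $ k * score (U i \<omega>) (U (Suc i) \<omega>) $ j * x $ j)) =
       (\<Sum>i<n. \<Sum>j\<in>UNIV. score (U i \<omega>) (U (Suc i) \<omega>) $ k * score (U i \<omega>) (U (Suc i) \<omega>) $ j * x $ j)"
      by (rule sum.swap)
    finally show ?thesis by (simp add: inner_vec_def sum_distrib_left mult_ac)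
  qed
  then show ?thesis by (simp add: vec_eq_iff)
qed

lemma sample_info_quadratic: "x \<bullet> (sample_info n \<omega> *v x) = (\<Sum>i<n. (x \<bullet> score (U i \<omega>) (U (Suc i) \<omega>))\<^sup>2) / n"
  by (simp add: sample_info_mult inner_sum_right power2_eq_square inner_commute)

text \<open>
  With \<open>\<psi> = feature\<close> and \<open>h = err\<close>, each summand satisfies
  \<open>h \<bullet> \<psi> / c\<^sub>L = h \<bullet> \<psi> / c\<^sub>T + (h \<bullet> \<psi>)\<^sup>2 / (c\<^sub>L c\<^sub>T)\<close>. The first terms have a nonnegative sum by the
  variational inequality, and \<open>c\<^sub>T \<le> 2 \<le> 2 c\<^sub>L / \<delta>\<close> bounds the second ones from below.
\<close>

lemma score_inequality:
  assumes "likelihood_conditions n \<omega>"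
  shows "\<delta> / 2 * (\<Sum>i<n. (err n \<omega> \<bullet> score (U i \<omega>) (U (Suc i) \<omega>))\<^sup>2) \<le> err n \<omega> \<bullet> score_sum n \<omega>"
proof -
  let ?\<psi> = "\<lambda>i. err n \<omega> \<bullet> feature (U i \<omega>) (U (Suc i) \<omega>)"
  let ?c = "\<lambda>i. dens L (U i \<omega>) (U (Suc i) \<omega>)"
  let ?t = "\<lambda>i. dens (T n \<omega>) (U i \<omega>) (U (Suc i) \<omega>)"
  have T: "T n \<omega> \<in> \<Theta>" and pos: "\<And>i. i < n \<Longrightarrow> 0 < ?t i"
    and foc: "(\<Sum>i<n. ((L - T n \<omega>) \<bullet> feature (U i \<omega>) (U (Suc i) \<omega>)) / ?t i) \<le> 0"
    using assms by (auto simp: likelihood_conditions_def)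
  have "(\<Sum>i<n. ((L - T n \<omega>) \<bullet> feature (U i \<omega>) (U (Suc i) \<omega>)) / ?t i) = - (\<Sum>i<n. ?\<psi> i / ?t i)"
    by (simp add: err_def inner_diff_left sum_negf[symmetric] minus_divide_left)
  with foc have foc': "0 \<le> (\<Sum>i<n. ?\<psi> i / ?t i)" by simp
  have "(\<Sum>i<n. ?\<psi> i / ?t i + \<delta> / 2 * (err n \<omega> \<bullet> score (U i \<omega>) (U (Suc i) \<omega>))\<^sup>2) \<le> (\<Sum>i<n. err n \<omega> \<bullet> score (U i \<omega>) (U (Suc i) \<omega>))"
  proof (rule sum_mono)
    fix i assume "i \<in> {..<n}"
    then have t: "0 < ?t i" using pos by simp
    have c: "0 < ?c i" by (rule dens_L_pos)
    have tc: "?t i = ?c i + ?\<psi> i" by (rule dens_T)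
    have "\<delta> / 2 * ?t i \<le> ?c i"
    proof -
      have "\<delta> * ?t i \<le> \<delta> * 2" using dens_le_2[OF T] \<delta>_pos by (intro mult_left_mono) auto
      then show ?thesis using dens_L_ge[of "U i \<omega>" "U (Suc i) \<omega>"] by linarith
    qed
    then have "\<delta> / 2 / (?c i)\<^sup>2 \<le> 1 / (?c i * ?t i)" using c t by (simp add: field_simps power2_eq_square)
    then have "\<delta> / 2 / (?c i)\<^sup>2 * (?\<psi> i)\<^sup>2 \<le> 1 / (?c i * ?t i) * (?\<psi> i)\<^sup>2" by (rule mult_right_mono) simp
    moreover have "?\<psi> i / ?c i = ?\<psi> i / ?t i + 1 / (?c i * ?t i) * (?\<psi> i)\<^sup>2"
      using c t tc by (simp add: divide_simps) (simp add: power2_eq_square algebra_simps)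
    ultimately show "?\<psi> i / ?t i + \<delta> / 2 * (err n \<omega> \<bullet> score (U i \<omega>) (U (Suc i) \<omega>))\<^sup>2 \<le> err n \<omega> \<bullet> score (U i \<omega>) (U (Suc i) \<omega>)"
      unfolding err_score power_divide by simp
  qed
  then show ?thesis using foc' by (simp add: inner_score_sum sum.distrib sum_distrib_left)
qed

text \<open>
  On the event that the sample information is near \<open>\<Sigma> \<ge> 1/2\<close>, the score inequality compares a
  multiple of \<open>n |h|\<^sup>2\<close> with \<open>|h|\<close> times the norm of the score.
\<close>

lemma root_n_rate:
  assumes o: "likelihood_conditions n \<omega>" and J: "norm (sample_info n \<omega> - fisher_info) \<le> 1/4" and n: "n \<ge> 1"
  shows "norm (scaled_err n \<omega>) \<le> 8 / \<delta> * norm (scaled_score n \<omega>)"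
proof -
  have "\<bar>err n \<omega> \<bullet> ((sample_info n \<omega> - fisher_info) *v err n \<omega>)\<bar> \<le> norm (err n \<omega>) * (1/4 * norm (err n \<omega>))"
    using J by (intro order_trans[OF Cauchy_Schwarz_ineq2] mult_left_mono order_trans[OF norm_matrix_vector_le] mult_right_mono) auto
  then have "- (norm (err n \<omega>) * (1/4 * norm (err n \<omega>))) \<le> err n \<omega> \<bullet> ((sample_info n \<omega> - fisher_info) *v err n \<omega>)" by linarith
  then have "- ((norm (err n \<omega>))\<^sup>2 / 4) \<le> err n \<omega> \<bullet> (sample_info n \<omega> *v err n \<omega>) - err n \<omega> \<bullet> (fisher_info *v err n \<omega>)"
    by (simp add: matrix_vector_mult_diff_rdistrib inner_diff_right power2_eq_square)
  then have "(norm (err n \<omega>))\<^sup>2 / 4 \<le> err n \<omega> \<bullet> (sample_info n \<omega> *v err n \<omega>)"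
    using fisher_info_lower_bound[of "err n \<omega>"] by linarith
  then have "n * (norm (err n \<omega>))\<^sup>2 / 4 \<le> (\<Sum>i<n. (err n \<omega> \<bullet> score (U i \<omega>) (U (Suc i) \<omega>))\<^sup>2)"
    using n unfolding sample_info_quadratic by (simp add: field_simps)
  then have "\<delta> / 2 * (n * (norm (err n \<omega>))\<^sup>2 / 4) \<le> \<delta> / 2 * (\<Sum>i<n. (err n \<omega> \<bullet> score (U i \<omega>) (U (Suc i) \<omega>))\<^sup>2)"
    using \<delta>_pos by (intro mult_left_mono) auto
  also have "\<dots> \<le> err n \<omega> \<bullet> score_sum n \<omega>" by (rule score_inequality[OF o])
  also have "\<dots> \<le> norm (err n \<omega>) * norm (score_sum n \<omega>)" by (rule norm_cauchy_schwarz)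
  finally have *: "norm (err n \<omega>) * (\<delta> / 8 * n * norm (err n \<omega>)) \<le> norm (err n \<omega>) * norm (score_sum n \<omega>)"
    by (simp add: power2_eq_square mult_ac)
  have "\<delta> / 8 * n * norm (err n \<omega>) \<le> norm (score_sum n \<omega>)"
  proof (cases "norm (err n \<omega>) = 0")
    case False
    then have "0 < norm (err n \<omega>)" by simp
    with * show ?thesis by (rule mult_left_le_imp_le)
  qed simp
  moreover have "sqrt n * (\<delta> / 8 * norm (scaled_err n \<omega>)) = \<delta> / 8 * n * norm (err n \<omega>)"
  proof -
    have "norm (scaled_err n \<omega>) = sqrt n * norm (err n \<omega>)" by (simp add: scaled_err_def err_def)
    then have "sqrt n * (\<delta> / 8 * norm (scaled_err n \<omega>)) = (sqrt n * sqrt n) * (\<delta> / 8 * norm (err n \<omega>))"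
      by (simp only: mult_ac)
    then show ?thesis by simp
  qed
  ultimately have "sqrt n * (\<delta> / 8 * norm (scaled_err n \<omega>)) \<le> norm (score_sum n \<omega>)" by linarith
  then have "\<delta> / 8 * norm (scaled_err n \<omega>) \<le> norm (score_sum n \<omega>) / sqrt n" using n by (simp add: field_simps)
  also have "\<dots> = norm (scaled_score n \<omega>)" by (simp add: scaled_score_def)
  finally show ?thesis using \<delta>_pos by (simp add: field_simps)
qed

lemma interior_estimate:
  assumes h: "norm (err n \<omega>) \<le> \<delta> / (2 * \<beta>)"
  shows "weight (T n \<omega>) < 1" "\<delta> / 2 \<le> dens (T n \<omega>) u v"
proof -
  have "weight (T n \<omega>) \<le> weight L + \<beta> * norm (err n \<omega>)" unfolding err_def by (rule weight_lipschitz)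
  also have "\<beta> * norm (err n \<omega>) \<le> \<beta> * (\<delta> / (2 * \<beta>))" using h \<beta>_ge_1 by (intro mult_left_mono) auto
  also have "\<dots> = \<delta> / 2" using \<beta>_ge_1 by simp
  finally have w: "weight (T n \<omega>) \<le> 1 - \<delta> / 2" by (simp add: \<delta>_def field_simps)
  then show "weight (T n \<omega>) < 1" using \<delta>_pos by simp
  show "\<delta> / 2 \<le> dens (T n \<omega>) u v" using dens_ge[of "T n \<omega>" u v] w by linarith
qed

text \<open>
  The likelihood equations read \<open>score_sum = \<Sum> \<psi> (h \<bullet> \<psi>) / (c\<^sub>L c\<^sub>T)\<close>. Replacing \<open>c\<^sub>T\<close> by \<open>c\<^sub>L\<close> on the
  right gives \<open>n\<close> times the sample information applied to \<open>h\<close>, at the price of a term that is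
  quadratic in \<open>h\<close>.
\<close>

lemma linearization:
  assumes o: "likelihood_conditions n \<omega>" and h: "norm (err n \<omega>) \<le> \<delta> / (2 * \<beta>)" and n: "n \<ge> 1"
  shows "norm (sample_info n \<omega> *v scaled_err n \<omega> - scaled_score n \<omega>) \<le> 2 * \<beta>^3 / \<delta>^3 * norm (err n \<omega>) * norm (scaled_err n \<omega>)"
proof -
  let ?f = "\<lambda>i. feature (U i \<omega>) (U (Suc i) \<omega>)"
  let ?\<psi> = "\<lambda>i. err n \<omega> \<bullet> ?f i"
  let ?c = "\<lambda>i. dens L (U i \<omega>) (U (Suc i) \<omega>)"
  let ?t = "\<lambda>i. dens (T n \<omega>) (U i \<omega>) (U (Suc i) \<omega>)"
  note ie = interior_estimate[OF h]
  have t0: "0 < ?t i" for i using ie(2)[of "U i \<omega>" "U (Suc i) \<omega>"] \<delta>_pos by linarith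
  have foc: "(\<Sum>i<n. (1 / ?t i) *\<^sub>R ?f i) = 0" using o ie(1) by (simp add: likelihood_conditions_def)
  have summand: "(?\<psi> i / (?c i)\<^sup>2) *\<^sub>R ?f i - (1 / ?c i) *\<^sub>R ?f i + (1 / ?t i) *\<^sub>R ?f i = ((?\<psi> i)\<^sup>2 / ((?c i)\<^sup>2 * ?t i)) *\<^sub>R ?f i" for i
  proof -
    have c: "0 < ?c i" by (rule dens_L_pos)
    have tc: "?t i = ?c i + ?\<psi> i" by (rule dens_T)
    have "?\<psi> i / (?c i)\<^sup>2 - 1 / ?c i + 1 / ?t i = (?\<psi> i)\<^sup>2 / ((?c i)\<^sup>2 * ?t i)"
      using c t0[of i] tc by (intro reciprocal_expansion) auto
    then show ?thesis by (simp only: scaleR_left_diff_distrib[symmetric] scaleR_left_distrib[symmetric])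
  qed
  have "n *\<^sub>R (sample_info n \<omega> *v err n \<omega>) - score_sum n \<omega> = (\<Sum>i<n. (?\<psi> i / (?c i)\<^sup>2) *\<^sub>R ?f i) - (\<Sum>i<n. (1 / ?c i) *\<^sub>R ?f i)"
    using n unfolding sample_info_mult score_sum_def score_def by (simp add: inner_commute power2_eq_square)
  also have "\<dots> = (\<Sum>i<n. (?\<psi> i / (?c i)\<^sup>2) *\<^sub>R ?f i) - (\<Sum>i<n. (1 / ?c i) *\<^sub>R ?f i) + (\<Sum>i<n. (1 / ?t i) *\<^sub>R ?f i)"
    by (simp add: foc)
  also have "\<dots> = (\<Sum>i<n. ((?\<psi> i)\<^sup>2 / ((?c i)\<^sup>2 * ?t i)) *\<^sub>R ?f i)"
    by (simp only: sum_subtractf[symmetric] sum.distrib[symmetric] summand)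
  finally have eq: "n *\<^sub>R (sample_info n \<omega> *v err n \<omega>) - score_sum n \<omega> = (\<Sum>i<n. ((?\<psi> i)\<^sup>2 / ((?c i)\<^sup>2 * ?t i)) *\<^sub>R ?f i)" .
  define E where "E = (\<beta> * norm (err n \<omega>))\<^sup>2 / (\<delta>\<^sup>2 * (\<delta> / 2)) * \<beta>"
  have "norm (\<Sum>i<n. ((?\<psi> i)\<^sup>2 / ((?c i)\<^sup>2 * ?t i)) *\<^sub>R ?f i) \<le> (\<Sum>i<n. E)"
  proof (rule sum_norm_le)
    fix i
    have "norm (((?\<psi> i)\<^sup>2 / ((?c i)\<^sup>2 * ?t i)) *\<^sub>R ?f i) = (?\<psi> i)\<^sup>2 / ((?c i)\<^sup>2 * ?t i) * norm (?f i)"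
      using t0[of i] by simp
    also have "\<dots> \<le> E" unfolding E_def
    proof (intro mult_mono frac_le norm_feature)
      have "\<bar>?\<psi> i\<bar> \<le> norm (err n \<omega>) * \<beta>" by (rule order_trans[OF Cauchy_Schwarz_ineq2]) (intro mult_left_mono norm_feature norm_ge_zero)
      then show "(?\<psi> i)\<^sup>2 \<le> (\<beta> * norm (err n \<omega>))\<^sup>2"
        using \<beta>_ge_1 by (intro abs_le_square_iff[THEN iffD1]) (simp add: abs_mult mult.commute)
      show "\<delta>\<^sup>2 \<le> (?c i)\<^sup>2" using dens_L_ge \<delta>_pos by (intro power_mono) auto
      show "\<delta> / 2 \<le> ?t i" by (rule ie(2))
    qed (use \<delta>_pos t0[of i] \<beta>_ge_1 in auto)
    finally show "norm (((?\<psi> i)\<^sup>2 / ((?c i)\<^sup>2 * ?t i)) *\<^sub>R ?f i) \<le> E" .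
  qed
  then have b: "norm (n *\<^sub>R (sample_info n \<omega> *v err n \<omega>) - score_sum n \<omega>) \<le> n * E" unfolding eq by simp
  have "sample_info n \<omega> *v scaled_err n \<omega> - scaled_score n \<omega> = (1 / sqrt n) *\<^sub>R (n *\<^sub>R (sample_info n \<omega> *v err n \<omega>) - score_sum n \<omega>)"
    using n by (simp add: scaled_err_def scaled_score_def err_def[symmetric] matrix_vector_mult_scaleR scaleR_diff_right real_div_sqrt)
  then have "norm (sample_info n \<omega> *v scaled_err n \<omega> - scaled_score n \<omega>) = (1 / sqrt n) * norm (n *\<^sub>R (sample_info n \<omega> *v err n \<omega>) - score_sum n \<omega>)"
    by simp
  also have "\<dots> \<le> (1 / sqrt n) * (n * E)" by (rule mult_left_mono[OF b]) simp
  also have "\<dots> = sqrt n * E"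
  proof -
    have "(1 / sqrt n) * (n * E) = (real n / sqrt n) * E" by (simp only: times_divide_eq_left times_divide_eq_right mult_1)
    then show ?thesis by (simp only: real_div_sqrt of_nat_0_le_iff)
  qed
  also have "\<dots> = 2 * \<beta>^3 / \<delta>^3 * norm (err n \<omega>) * norm (scaled_err n \<omega>)"
    by (simp add: E_def scaled_err_def err_def[symmetric] power2_eq_square power3_eq_cube)
  finally show ?thesis .
qed

lemma plug_in_info_close:
  assumes h: "norm (err n \<omega>) \<le> \<delta> / (2 * \<beta>)"
  shows "norm (plug_in_info n \<omega> - sample_info n \<omega>) \<le> real CARD('s) * real CARD('s) * (16 * \<beta>^3 / \<delta>^4 * norm (err n \<omega>))"
proof -
  let ?f = "\<lambda>i. feature (U i \<omega>) (U (Suc i) \<omega>)"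
  let ?c = "\<lambda>i. dens L (U i \<omega>) (U (Suc i) \<omega>)"
  let ?t = "\<lambda>i. dens (T n \<omega>) (U i \<omega>) (U (Suc i) \<omega>)"
  note ie = interior_estimate[OF h]
  define E where "E = 16 * \<beta>^3 / \<delta>^4 * norm (err n \<omega>)"
  have E0: "0 \<le> E" using \<beta>_ge_1 \<delta>_pos by (simp add: E_def)
  have ent: "\<bar>?f i $ k * ?f i $ j / (?t i)\<^sup>2 - ?f i $ k * ?f i $ j / (?c i)\<^sup>2\<bar> \<le> E" for i k j
  proof -
    have c: "0 < ?c i" by (rule dens_L_pos)
    have t: "\<delta> / 2 \<le> ?t i" by (rule ie(2))
    then have t0: "0 < ?t i" using \<delta>_pos by linarith
    have tc: "?t i = ?c i + err n \<omega> \<bullet> ?f i" by (rule dens_T)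
    have w: "T n \<omega> \<in> \<Theta>" using ie(1) by (simp add: \<Theta>_def)
    have hb: "\<bar>err n \<omega> \<bullet> ?f i\<bar> \<le> norm (err n \<omega>) * \<beta>"
      by (rule order_trans[OF Cauchy_Schwarz_ineq2]) (intro mult_left_mono norm_feature norm_ge_zero)
    have "?f i $ k * ?f i $ j / (?t i)\<^sup>2 - ?f i $ k * ?f i $ j / (?c i)\<^sup>2 =
       (?f i $ k * ?f i $ j) * ((- (err n \<omega> \<bullet> ?f i)) * (?c i + ?t i)) / ((?c i)\<^sup>2 * (?t i)\<^sup>2)"
      using c t0 tc by (intro reciprocal_square_difference) auto
    then have "\<bar>?f i $ k * ?f i $ j / (?t i)\<^sup>2 - ?f i $ k * ?f i $ j / (?c i)\<^sup>2\<bar> =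
       \<bar>(?f i $ k * ?f i $ j) * ((- (err n \<omega> \<bullet> ?f i)) * (?c i + ?t i)) / ((?c i)\<^sup>2 * (?t i)\<^sup>2)\<bar>"
      by (rule arg_cong)
    also have "\<dots> = (\<bar>?f i $ k\<bar> * \<bar>?f i $ j\<bar>) * (\<bar>err n \<omega> \<bullet> ?f i\<bar> * (?c i + ?t i)) / ((?c i)\<^sup>2 * (?t i)\<^sup>2)"
    proof -
      have "\<bar>?c i + ?t i\<bar> = ?c i + ?t i" "\<bar>(?c i)\<^sup>2 * (?t i)\<^sup>2\<bar> = (?c i)\<^sup>2 * (?t i)\<^sup>2" using c t0 by simp_all
      then show ?thesis by (simp only: abs_mult abs_divide abs_minus_cancel)
    qed
    also have "\<dots> \<le> (\<beta> * \<beta>) * ((norm (err n \<omega>) * \<beta>) * (2 + 2)) / (\<delta>\<^sup>2 * (\<delta> / 2)\<^sup>2)"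
    proof (rule frac_le)
      have fb: "\<bar>?f i $ l\<bar> \<le> \<beta>" for l using component_le_norm_cart norm_feature by (rule order_trans)
      have "?c i + ?t i \<le> 2 + 2" using dens_L_le dens_le_2[OF w] by (rule add_mono)
      with hb have hct: "\<bar>err n \<omega> \<bullet> ?f i\<bar> * (?c i + ?t i) \<le> (norm (err n \<omega>) * \<beta>) * (2 + 2)"
        by (rule mult_mono) (use c t0 \<beta>_ge_1 in auto)
      have "\<bar>?f i $ k\<bar> * \<bar>?f i $ j\<bar> \<le> \<beta> * \<beta>" using fb fb by (rule mult_mono) (use \<beta>_ge_1 in auto)
      moreover note hct
      ultimately show "\<bar>?f i $ k\<bar> * \<bar>?f i $ j\<bar> * (\<bar>err n \<omega> \<bullet> ?f i\<bar> * (?c i + ?t i)) \<le> \<beta> * \<beta> * (norm (err n \<omega>) * \<beta> * (2 + 2))"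
        by (rule mult_mono) (use c t0 \<beta>_ge_1 in auto)
      have "\<delta>\<^sup>2 \<le> (?c i)\<^sup>2" using dens_L_ge \<delta>_pos by (intro power_mono) auto
      moreover have "(\<delta> / 2)\<^sup>2 \<le> (?t i)\<^sup>2" using t \<delta>_pos by (intro power_mono) auto
      ultimately show "\<delta>\<^sup>2 * (\<delta> / 2)\<^sup>2 \<le> (?c i)\<^sup>2 * (?t i)\<^sup>2" by (rule mult_mono) auto
      show "0 < \<delta>\<^sup>2 * (\<delta> / 2)\<^sup>2" using \<delta>_pos by simp
      show "0 \<le> \<beta> * \<beta> * (norm (err n \<omega>) * \<beta> * (2 + 2))" using \<beta>_ge_1 by simp
    qed
    also have "\<dots> = E" using \<delta>_pos by (simp add: E_def power2_eq_square power3_eq_cube power4_eq_xxxx mult_ac)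
    finally show ?thesis .
  qed
  have "\<bar>(plug_in_info n \<omega> - sample_info n \<omega>) $ k $ j\<bar> \<le> E" for k j
  proof -
    have sc: "score (U i \<omega>) (U (Suc i) \<omega>) $ k * score (U i \<omega>) (U (Suc i) \<omega>) $ j = ?f i $ k * ?f i $ j / (?c i)\<^sup>2" for i
      by (simp add: score_def power2_eq_square)
    have "(plug_in_info n \<omega> - sample_info n \<omega>) $ k $ j =
        (\<Sum>i<n. ?f i $ k * ?f i $ j / (?t i)\<^sup>2) / n - (\<Sum>i<n. ?f i $ k * ?f i $ j / (?c i)\<^sup>2) / n"
      by (simp only: plug_in_info_def sample_info_def sc vector_minus_component vec_lambda_beta)
    then have eq: "(plug_in_info n \<omega> - sample_info n \<omega>) $ k $ j = (\<Sum>i<n. ?f i $ k * ?f i $ j / (?t i)\<^sup>2 - ?f i $ k * ?f i $ j / (?c i)\<^sup>2) / n"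
      by (simp only: sum_subtractf diff_divide_distrib)
    have "\<bar>\<Sum>i<n. ?f i $ k * ?f i $ j / (?t i)\<^sup>2 - ?f i $ k * ?f i $ j / (?c i)\<^sup>2\<bar> \<le> (\<Sum>i<n. E)"
      by (rule order_trans[OF sum_abs]) (intro sum_mono ent)
    then have "\<bar>(plug_in_info n \<omega> - sample_info n \<omega>) $ k $ j\<bar> \<le> (\<Sum>i<n. E) / n"
      unfolding eq abs_divide abs_of_nat by (rule divide_right_mono) simp
    also have "\<dots> \<le> E" using E0 by simp
    finally show ?thesis .
  qed
  then have "norm (plug_in_info n \<omega> - sample_info n \<omega>) \<le> (\<Sum>k\<in>(UNIV :: 's set). \<Sum>j\<in>(UNIV :: 's set). E)"
    by (intro order_trans[OF norm_matrix_le_sum] sum_mono)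
  then show ?thesis by (simp add: E_def)
qed

lemma tight_scaled_err: "tight_seq M scaled_err"
proof (rule tight_dominated)
  show "tight_seq M scaled_score" unfolding scaled_score_def by (rule score_tight)
  have "whp M (\<lambda>n \<omega>. likelihood_conditions n \<omega> \<and> norm (sample_info n \<omega> - fisher_info) \<le> 1/4)"
    by (intro whp_conj whp_likelihood_conditions sample_info_lln) simp
  then show "whp M (\<lambda>n \<omega>. norm (scaled_err n \<omega>) \<le> 8 / \<delta> * norm (scaled_score n \<omega>))"
    by (rule whp_mono[where N = 1]) (use root_n_rate in blast)
qed (use \<delta>_pos in simp)

lemma err_small:
  assumes "0 < \<eta>"
  shows "whp M (\<lambda>n \<omega>. norm (err n \<omega>) \<le> \<eta>)"
proof (rule whp_tight[OF tight_scaled_err])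
  fix R :: real assume R: "0 < R"
  have "(\<lambda>n. R / sqrt (real n)) \<longlonglongrightarrow> 0" by real_asymp
  then have "\<forall>\<^sub>F n in sequentially. R / sqrt (real n) < \<eta>" using assms by (rule order_tendstoD)
  then have "\<forall>\<^sub>F n in sequentially. 1 \<le> n \<and> R / sqrt (real n) < \<eta>"
    using eventually_ge_at_top[of 1] by eventually_elim simp
  then show "whp M (\<lambda>n _. 1 \<le> n \<and> R / sqrt (real n) < \<eta>)" by (intro whp_eventually) simp
next
  fix R n \<omega> assume *: "norm (scaled_err n \<omega>) \<le> R" "1 \<le> n \<and> R / sqrt (real n) < \<eta>"
  have "norm (err n \<omega>) = norm (scaled_err n \<omega>) / sqrt n" using * by (simp add: scaled_err_def err_def)
  also have "\<dots> \<le> R / sqrt n" using * by (intro divide_right_mono) auto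
  finally show "norm (err n \<omega>) \<le> \<eta>" using * by linarith
qed

lemma asymptotic_linearity:
  assumes \<eta>: "0 < \<eta>"
  shows "whp M (\<lambda>n \<omega>. norm (fisher_info *v scaled_err n \<omega> - scaled_score n \<omega>) \<le> \<eta>)"
proof (rule whp_tight[OF tight_scaled_err])
  fix R :: real assume R: "0 < R"
  have pos: "0 < \<eta> * \<delta>^3 / (4 * \<beta>^3 * R)" "0 < \<delta> / (2 * \<beta>)" "0 < \<eta> / (2 * R)"
    using \<eta> R \<delta>_pos \<beta>_ge_1 by (auto intro!: divide_pos_pos mult_pos_pos)
  have "whp M (\<lambda>n \<omega>. 1 \<le> n)" by (intro whp_eventually) (use eventually_ge_at_top[of "1::nat"] in simp)
  then show "whp M (\<lambda>n \<omega>. 1 \<le> n \<and> likelihood_conditions n \<omega> \<and> norm (sample_info n \<omega> - fisher_info) \<le> \<eta> / (2 * R) \<and>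
      norm (err n \<omega>) \<le> \<delta> / (2 * \<beta>) \<and> norm (err n \<omega>) \<le> \<eta> * \<delta>^3 / (4 * \<beta>^3 * R))"
    by (intro whp_conj whp_likelihood_conditions sample_info_lln err_small pos)
next
  fix R n \<omega> assume R: "0 < R" and yR: "norm (scaled_err n \<omega>) \<le> R"
    and *: "1 \<le> n \<and> likelihood_conditions n \<omega> \<and> norm (sample_info n \<omega> - fisher_info) \<le> \<eta> / (2 * R) \<and>
      norm (err n \<omega>) \<le> \<delta> / (2 * \<beta>) \<and> norm (err n \<omega>) \<le> \<eta> * \<delta>^3 / (4 * \<beta>^3 * R)"
  have "fisher_info *v scaled_err n \<omega> - scaled_score n \<omega> = (sample_info n \<omega> *v scaled_err n \<omega> - scaled_score n \<omega>) - (sample_info n \<omega> - fisher_info) *v scaled_err n \<omega>"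
    by (simp add: matrix_vector_mult_diff_rdistrib)
  then have "norm (fisher_info *v scaled_err n \<omega> - scaled_score n \<omega>) \<le> norm (sample_info n \<omega> *v scaled_err n \<omega> - scaled_score n \<omega>) + norm ((sample_info n \<omega> - fisher_info) *v scaled_err n \<omega>)"
    by (simp only: norm_triangle_ineq4)
  also have "norm ((sample_info n \<omega> - fisher_info) *v scaled_err n \<omega>) \<le> \<eta> / (2 * R) * R"
    using * yR R \<eta> by (intro order_trans[OF norm_matrix_vector_le] mult_mono) auto
  also have "\<eta> / (2 * R) * R = \<eta> / 2" using R by simp
  also have "norm (sample_info n \<omega> *v scaled_err n \<omega> - scaled_score n \<omega>) \<le> 2 * \<beta>^3 / \<delta>^3 * norm (err n \<omega>) * norm (scaled_err n \<omega>)"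
    using * by (intro linearization) auto
  also have "\<dots> \<le> 2 * \<beta>^3 / \<delta>^3 * (\<eta> * \<delta>^3 / (4 * \<beta>^3 * R)) * R"
    using * yR R \<delta>_pos \<beta>_ge_1 \<eta> by (intro mult_mono) (auto intro!: divide_nonneg_nonneg mult_nonneg_nonneg)
  also have "\<dots> = \<eta> / 2" using R \<delta>_pos \<beta>_ge_1 by (simp add: field_simps)
  finally show "norm (fisher_info *v scaled_err n \<omega> - scaled_score n \<omega>) \<le> \<eta>" by simp
qed

lemma fisher_info_invertible: "invertible fisher_info"
  by (rule pos_def_invertible[OF pos_def_fisher_info])

text \<open>
  The scaled error is asymptotically \<open>\<Sigma>\<^sup>-\<^sup>1\<close> times the scaled score, whose limit has covariance \<open>\<Sigma>\<close>.
\<close>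

lemma scaled_err_char_limit:
  "(\<lambda>n. \<integral>\<omega>. iexp (a \<bullet> scaled_err n \<omega>) \<partial>M) \<longlonglongrightarrow> of_real (exp (- (a \<bullet> (matrix_inv fisher_info *v a)) / 2))"
proof (rule char_slutsky[where X = "\<lambda>n \<omega>. matrix_inv fisher_info *v scaled_score n \<omega>"])
  define V where "V = matrix_inv fisher_info"
  have V: "fisher_info ** V = mat 1" "V ** fisher_info = mat 1" using matrix_inv_mult[OF fisher_info_invertible] by (auto simp: V_def)
  have SV: "fisher_info *v (V *v x) = x" "V *v (fisher_info *v x) = x" for x by (simp_all add: matrix_vector_mul_assoc V)
  have sym: "x \<bullet> (fisher_info *v z) = z \<bullet> (fisher_info *v x)" for x z
    using pos_def_fisher_info by (intro sym_matrix_inner) (simp add: pos_def_matrix_def)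
  have "(\<lambda>x. V *v x) \<in> borel_measurable borel"
    by (intro borel_measurable_continuous_onI continuous_intros)
  then show "(\<lambda>\<omega>. matrix_inv fisher_info *v scaled_score n \<omega>) \<in> borel_measurable M" for n
    unfolding V_def by measurable
  show "scaled_err n \<in> borel_measurable M" for n by measurable
  show "whp M (\<lambda>n \<omega>. norm (matrix_inv fisher_info *v scaled_score n \<omega> - scaled_err n \<omega>) \<le> \<eta>)" if \<eta>: "0 < \<eta>" for \<eta>
  proof -
    have p: "0 < \<eta> / (norm V + 1)" using \<eta> by (intro divide_pos_pos add_nonneg_pos) auto
    show ?thesis
    proof (rule whp_mono[OF asymptotic_linearity[OF p], where N = 0])
      fix n \<omega> assume *: "norm (fisher_info *v scaled_err n \<omega> - scaled_score n \<omega>) \<le> \<eta> / (norm V + 1)"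
      have "matrix_inv fisher_info *v scaled_score n \<omega> - scaled_err n \<omega> = - (V *v (fisher_info *v scaled_err n \<omega> - scaled_score n \<omega>))"
        by (simp add: V_def[symmetric] matrix_vector_mult_diff_distrib SV)
      then have "norm (matrix_inv fisher_info *v scaled_score n \<omega> - scaled_err n \<omega>) \<le> norm V * norm (fisher_info *v scaled_err n \<omega> - scaled_score n \<omega>)"
        by (simp add: norm_matrix_vector_le)
      also have "\<dots> \<le> (norm V + 1) * (\<eta> / (norm V + 1))" using * by (intro mult_mono) auto
      also have "\<dots> = \<eta>"
      proof -
        have "norm V + 1 \<noteq> 0" using norm_ge_zero[of V] by linarith
        then show ?thesis by (subst times_divide_eq_right) (rule nonzero_mult_div_cancel_left)
      qed
      finally show "norm (matrix_inv fisher_info *v scaled_score n \<omega> - scaled_err n \<omega>) \<le> \<eta>" .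
    qed
  qed
  have "a \<bullet> (V *v x) = (V *v a) \<bullet> x" for x
    using sym[of "V *v a" "V *v x"] by (simp add: SV inner_commute)
  moreover have "(V *v a) \<bullet> (fisher_info *v (V *v a)) = a \<bullet> (V *v a)" by (simp add: SV inner_commute)
  ultimately show "(\<lambda>n. \<integral>\<omega>. iexp (a \<bullet> (matrix_inv fisher_info *v scaled_score n \<omega>)) \<partial>M) \<longlonglongrightarrow> of_real (exp (- (a \<bullet> (matrix_inv fisher_info *v a)) / 2))"
    using score_clt[of "V *v a"] by (simp add: V_def[symmetric] scaled_score_def)
qed

lemma plug_in_info_limit:
  assumes \<eta>: "0 < \<eta>"
  shows "whp M (\<lambda>n \<omega>. norm (plug_in_info n \<omega> - fisher_info) \<le> \<eta>)"
proof -
  define C where "C = real CARD('s) * real CARD('s) * (16 * \<beta>^3 / \<delta>^4)"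
  have C: "0 < C" unfolding C_def using \<beta>_ge_1 \<delta>_pos by (intro mult_pos_pos divide_pos_pos) auto
  have pos: "0 < \<eta> / 2" "0 < \<delta> / (2 * \<beta>)" "0 < \<eta> / (2 * C)" using \<eta> C \<delta>_pos \<beta>_ge_1 by auto
  have "whp M (\<lambda>n \<omega>. norm (sample_info n \<omega> - fisher_info) \<le> \<eta> / 2 \<and> norm (err n \<omega>) \<le> \<delta> / (2 * \<beta>) \<and> norm (err n \<omega>) \<le> \<eta> / (2 * C))"
    by (intro whp_conj sample_info_lln err_small pos)
  then show ?thesis
  proof (rule whp_mono[where N = 0])
    fix n \<omega> assume *: "norm (sample_info n \<omega> - fisher_info) \<le> \<eta> / 2 \<and> norm (err n \<omega>) \<le> \<delta> / (2 * \<beta>) \<and> norm (err n \<omega>) \<le> \<eta> / (2 * C)"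
    have "norm (plug_in_info n \<omega> - sample_info n \<omega>) \<le> C * norm (err n \<omega>)"
      using plug_in_info_close[of n \<omega>] * by (simp add: C_def mult_ac)
    also have "\<dots> \<le> C * (\<eta> / (2 * C))" using * C by (intro mult_left_mono) auto
    also have "\<dots> = \<eta> / 2" using C by simp
    finally have "norm (plug_in_info n \<omega> - sample_info n \<omega>) \<le> \<eta> / 2" .
    then have "norm ((plug_in_info n \<omega> - sample_info n \<omega>) + (sample_info n \<omega> - fisher_info)) \<le> \<eta> / 2 + \<eta> / 2"
      using * by (intro order_trans[OF norm_triangle_ineq] add_mono) auto
    then show "norm (plug_in_info n \<omega> - fisher_info) \<le> \<eta>" by simp
  qed
qed

end

section \<open>Confidence intervals\<close>

lemma std_normal_singleton: "measure std_normal_distribution {x} = 0"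
proof -
  have "{x} \<in> null_sets lborel" by (rule null_setsI) simp_all
  then have "{x} \<in> null_sets std_normal_distribution"
    by (intro absolutely_continuousI_density[unfolded absolutely_continuous_def, THEN subsetD]) auto
  then show ?thesis by (simp add: measure_def null_sets_def)
qed

lemma std_normal_symmetric: "measure std_normal_distribution {..<-z} = measure std_normal_distribution {z<..}"
proof -
  have "emeasure std_normal_distribution {..<-z} = (\<integral>\<^sup>+x. ennreal (std_normal_density x) * indicator {..<-z} x \<partial>lborel)"
    by (simp add: emeasure_density)
  also have "\<dots> = (\<integral>\<^sup>+x. ennreal (std_normal_density x) * indicator {..<-z} x \<partial>distr lborel borel uminus)"
    by (simp add: lborel_distr_uminus)
  also have "\<dots> = (\<integral>\<^sup>+x. ennreal (std_normal_density (- x)) * indicator {..<-z} (- x) \<partial>lborel)"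
    by (rule nn_integral_distr) auto
  also have "\<dots> = (\<integral>\<^sup>+x. ennreal (std_normal_density x) * indicator {z<..} x \<partial>lborel)"
    by (intro nn_integral_cong) (auto simp: std_normal_density_def indicator_def)
  also have "\<dots> = emeasure std_normal_distribution {z<..}" by (simp add: emeasure_density)
  finally show ?thesis by (simp add: measure_def)
qed

lemma std_normal_interval_pos:
  assumes "a < b"
  shows "0 < measure std_normal_distribution {a<..b}"
proof (rule ccontr)
  interpret N: real_distribution std_normal_distribution by (rule real_dist_normal_dist)
  assume "\<not> 0 < measure std_normal_distribution {a<..b}"
  then have "{a<..b} \<in> null_sets std_normal_distribution"
    by (auto simp: null_sets_def N.emeasure_eq_measure intro: antisym[OF _ measure_nonneg])
  then have "AE x in lborel. x \<in> {a<..b} \<longrightarrow> ennreal (std_normal_density x) = 0"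
    by (simp add: null_sets_density_iff)
  then have "AE x in lborel. x \<notin> {a<..b}"
  proof eventually_elim
    case (elim x)
    then show ?case using normal_density_pos[of 1 0 x] by (auto simp: ennreal_eq_0_iff)
  qed
  then have "emeasure lborel {a<..b} = 0"
    by (subst (asm) AE_iff_measurable[of "{a<..b}"]) auto
  then show False using assms by simp
qed

text \<open>
  The upper tail is continuous and strictly decreasing, equals \<open>1/2\<close> at \<open>0\<close> and vanishes at
  infinity; since \<open>\<alpha>/2 < 1/2\<close>, the quantile is positive.
\<close>

lemma std_normal_upper_quantile:
  assumes \<alpha>: "0 < \<alpha>" "\<alpha> < 1"
  defines "z \<equiv> std_normal_upper_quantile (\<alpha> / 2)"
  shows "0 < z" "measure std_normal_distribution {-z<..<z} = 1 - \<alpha>"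
proof -
  let ?N = std_normal_distribution
  interpret N: real_distribution ?N by (rule real_dist_normal_dist)
  define G where "G x = measure ?N {x<..}" for x
  have G_cdf: "G x = 1 - cdf ?N x" for x
  proof -
    have "measure ?N (space ?N - {..x}) = 1 - measure ?N {..x}" by (rule N.prob_compl) simp
    moreover have "space ?N - {..x} = {x<..}" by auto
    ultimately show ?thesis by (simp add: G_def cdf_def)
  qed
  have strict: "G w < G x" if "x < w" for x w
  proof -
    have "{x<..} = {x<..w} \<union> {w<..}" using that by auto
    moreover have "measure ?N ({x<..w} \<union> {w<..}) = measure ?N {x<..w} + measure ?N {w<..}"
      by (rule N.finite_measure_Union) auto
    ultimately show ?thesis using std_normal_interval_pos[OF that] by (simp add: G_def)
  qed
  have cont: "isCont G x" for x
  proof -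
    have "isCont (cdf ?N) x" by (simp add: N.isCont_cdf std_normal_singleton)
    then have "isCont (\<lambda>x. 1 - cdf ?N x) x" by (intro continuous_intros)
    then show ?thesis by (simp add: G_cdf[abs_def])
  qed
  have tot: "measure ?N {-x<..<x} = 1 - 2 * G x" if "0 \<le> x" for x
  proof -
    have "1 = measure ?N UNIV" using N.prob_space by simp
    also have "UNIV = ({..<-x} \<union> {-x}) \<union> ({-x<..<x} \<union> ({x} \<union> {x<..}) - {-x})" using that by auto
    also have "measure ?N \<dots> = measure ?N ({..<-x} \<union> {-x}) + measure ?N ({-x<..<x} \<union> ({x} \<union> {x<..}) - {-x})"
      by (rule N.finite_measure_Union) (use that in auto)
    also have "measure ?N ({..<-x} \<union> {-x}) = measure ?N {..<-x} + measure ?N {-x}"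
      by (rule N.finite_measure_Union) auto
    also have "measure ?N ({-x<..<x} \<union> ({x} \<union> {x<..}) - {-x}) = measure ?N ({-x<..<x} \<union> ({x} \<union> {x<..}))"
      by (rule measure_Diff_null_set) (auto simp: null_sets_def N.emeasure_eq_measure std_normal_singleton)
    also have "\<dots> = measure ?N {-x<..<x} + measure ?N ({x} \<union> {x<..})"
      by (rule N.finite_measure_Union) auto
    also have "measure ?N ({x} \<union> {x<..}) = measure ?N {x} + measure ?N {x<..}"
      by (rule N.finite_measure_Union) auto
    finally show ?thesis by (simp add: std_normal_singleton std_normal_symmetric G_def)
  qed
  have G0: "G 0 = 1 / 2" using tot[of 0] by simp
  have "(cdf ?N \<longlongrightarrow> 1) at_top" by (rule N.cdf_lim_at_top_prob)
  then have "\<forall>\<^sub>F x in at_top. 1 - \<alpha> / 2 < cdf ?N x" using \<alpha> by (intro order_tendstoD) auto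
  then have "\<forall>\<^sub>F x in at_top. 0 \<le> x \<and> G x < \<alpha> / 2"
    using eventually_ge_at_top[of 0] by eventually_elim (simp add: G_cdf)
  then obtain b where b: "0 \<le> b" "G b < \<alpha> / 2" by (auto simp: eventually_at_top_linorder)
  have "\<exists>x. 0 \<le> x \<and> x \<le> b \<and> G x = \<alpha> / 2"
    by (rule IVT2) (use b G0 \<alpha> cont in auto)
  then obtain x where x: "0 \<le> x" "G x = \<alpha> / 2" by blast
  have "z = x" unfolding z_def std_normal_upper_quantile_def
  proof (rule the_equality)
    show "measure ?N {x<..} = \<alpha> / 2" using x by (simp add: G_def)
    fix w assume "measure ?N {w<..} = \<alpha> / 2"
    then have "G w = G x" using x by (simp add: G_def)
    then show "w = x" using strict[of w x] strict[of x w] by linarith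
  qed
  moreover have "x \<noteq> 0" using x G0 \<alpha> by auto
  ultimately show "0 < z" "measure ?N {-z<..<z} = 1 - \<alpha>" using x tot[of x] by auto
qed

text \<open>
  The matrix of Cramer's rule for the \<open>k\<close>-th diagonal entry of the inverse.
\<close>

definition bordered :: "'n \<Rightarrow> real^'n^'n \<Rightarrow> real^'n^'n" where
  "bordered k A = (\<chi> i j. if j = k then axis k 1 $ i else A $ i $ j)"

lemma matrix_inv_diagonal:
  fixes A :: "real^'n^'n"
  assumes "det A \<noteq> 0"
  shows "matrix_inv A $ k $ k = det (bordered k A) / det A"
proof -
  have inv: "invertible A" using assms by (simp add: invertible_det_nz)
  define x where "x = matrix_inv A *v axis k 1"
  have "A *v x = axis k 1" by (simp add: x_def matrix_vector_mul_assoc matrix_inv_mult[OF inv])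
  then have "x = (\<chi> k'. det (\<chi> i j. if j = k' then axis k 1 $ i else A $ i $ j) / det A)"
    using cramer[OF assms] by blast
  then have "x $ k = det (bordered k A) / det A" by (simp add: bordered_def)
  moreover have "x $ k = matrix_inv A $ k $ k" by (simp add: x_def matrix_vector_mult_basis column_def)
  ultimately show ?thesis by simp
qed

text \<open>
  The choice that defines the inverse is then made from the empty set, so all singular matrices share one
  value. This keeps entries of the inverse measurable.
\<close>

lemma matrix_inv_singular:
  fixes A :: "real^'n^'n"
  assumes "det A = 0"
  shows "matrix_inv A = (SOME A'. False)"
proof -
  have "\<not> invertible A" using assms by (simp add: invertible_det_nz)
  then have "(A ** A' = mat 1 \<and> A' ** A = mat 1) = False" for A'
    by (auto simp: invertible_def)
  then show ?thesis unfolding matrix_inv_def by (intro arg_cong[where f = Eps] ext)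
qed

lemma measurable_det:
  fixes A :: "'w \<Rightarrow> real^'n^'n"
  assumes [measurable]: "\<And>i j. (\<lambda>\<omega>. A \<omega> $ i $ j) \<in> borel_measurable M"
  shows "(\<lambda>\<omega>. det (A \<omega>)) \<in> borel_measurable M"
  unfolding det_def by measurable

lemma measurable_matrix_inv_diagonal:
  fixes A :: "'w \<Rightarrow> real^'n^'n"
  assumes m: "\<And>i j. (\<lambda>\<omega>. A \<omega> $ i $ j) \<in> borel_measurable M"
  shows "(\<lambda>\<omega>. matrix_inv (A \<omega>) $ k $ k) \<in> borel_measurable M"
proof -
  have [measurable]: "(\<lambda>\<omega>. det (A \<omega>)) \<in> borel_measurable M" by (rule measurable_det[OF m])
  have [measurable]: "(\<lambda>\<omega>. det (bordered k (A \<omega>))) \<in> borel_measurable M"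
    by (rule measurable_det) (use m in \<open>simp add: bordered_def\<close>)
  have "matrix_inv (A \<omega>) $ k $ k =
     (if det (A \<omega>) = 0 then (SOME A'::real^'n^'n. False) $ k $ k else det (bordered k (A \<omega>)) / det (A \<omega>))" for \<omega>
    by (simp add: matrix_inv_diagonal matrix_inv_singular)
  then show ?thesis by simp
qed

lemma matrix_inv_diagonal_continuous:
  fixes S :: "real^'n^'n"
  assumes S: "invertible S" and \<eta>: "0 < \<eta>"
  obtains \<kappa> where "0 < \<kappa>" "\<And>A. norm (A - S) \<le> \<kappa> \<Longrightarrow> invertible A \<and> \<bar>matrix_inv A $ k $ k - matrix_inv S $ k $ k\<bar> \<le> \<eta>"
proof -
  have d: "det S \<noteq> 0" using S by (simp add: invertible_det_nz)
  have c1: "isCont (\<lambda>A::real^'n^'n. det A) S" unfolding det_def by (intro continuous_intros)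
  have c2: "isCont (\<lambda>A::real^'n^'n. det (bordered k A)) S"
    unfolding det_def bordered_def vec_lambda_beta
  proof (intro continuous_intros)
    fix p :: "'n \<Rightarrow> 'n" and i
    show "isCont (\<lambda>A::real^'n^'n. if p i = k then axis k 1 $ i else A $ i $ p i) S"
      by (cases "p i = k") (auto intro: continuous_intros)
  qed
  have c3: "isCont (\<lambda>A::real^'n^'n. det (bordered k A) / det A) S"
    using c1 c2 d by (intro continuous_intros)
  have "\<forall>\<^sub>F A in nhds S. det A \<noteq> 0"
    using c1 d by (intro tendsto_imp_eventually_ne) (auto simp: isCont_def tendsto_at_iff_tendsto_nhds)
  moreover have "\<forall>\<^sub>F A in nhds S. dist (det (bordered k A) / det A) (det (bordered k S) / det S) < \<eta>"
    using tendsto_at_iff_tendsto_nhds[of "\<lambda>A. det (bordered k A) / det A" S] c3 \<eta>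
    by (intro tendstoD) (simp_all add: isCont_def)
  ultimately have "\<forall>\<^sub>F A in nhds S. det A \<noteq> 0 \<and> dist (det (bordered k A) / det A) (det (bordered k S) / det S) < \<eta>"
    by (rule eventually_conj)
  then obtain \<kappa> where \<kappa>: "0 < \<kappa>" "\<And>A. dist A S < \<kappa> \<Longrightarrow> det A \<noteq> 0 \<and> dist (det (bordered k A) / det A) (det (bordered k S) / det S) < \<eta>"
    unfolding eventually_nhds_metric by blast
  show ?thesis
  proof
    show "0 < \<kappa> / 2" using \<kappa> by simp
    fix A assume "norm (A - S) \<le> \<kappa> / 2"
    then have "dist A S < \<kappa>" using \<kappa>(1) by (simp add: dist_norm)
    from \<kappa>(2)[OF this] show "invertible A \<and> \<bar>matrix_inv A $ k $ k - matrix_inv S $ k $ k\<bar> \<le> \<eta>"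
      using d by (simp add: invertible_det_nz matrix_inv_diagonal dist_real_def)
  qed
qed

lemma (in prob_space) whp_measure_tendsto:
  assumes P: "\<And>n. {\<omega> \<in> space M. P n \<omega>} \<in> events" and Q: "\<And>n. {\<omega> \<in> space M. Q n \<omega>} \<in> events"
    and eq: "whp M (\<lambda>n \<omega>. P n \<omega> \<longleftrightarrow> Q n \<omega>)"
    and lim: "(\<lambda>n. prob {\<omega> \<in> space M. P n \<omega>}) \<longlonglongrightarrow> l"
  shows "(\<lambda>n. prob {\<omega> \<in> space M. Q n \<omega>}) \<longlonglongrightarrow> l"
proof -
  have "(\<lambda>n. prob {\<omega> \<in> space M. P n \<omega>} - prob {\<omega> \<in> space M. Q n \<omega>}) \<longlonglongrightarrow> 0"
  proof (rule LIMSEQ_I, goal_cases)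
    case (1 r)
    then have "prob_eventually M (r / 2) (\<lambda>n \<omega>. P n \<omega> \<longleftrightarrow> Q n \<omega>)" using eq by (simp add: whp_def)
    then have "\<forall>\<^sub>F n in sequentially. norm (prob {\<omega> \<in> space M. P n \<omega>} - prob {\<omega> \<in> space M. Q n \<omega>}) < r"
      unfolding prob_eventually_def
    proof eventually_elim
      case (elim n)
      then obtain A where A: "A \<in> events" "prob (space M - A) \<le> r / 2" "\<forall>\<omega>\<in>A. P n \<omega> \<longleftrightarrow> Q n \<omega>" by blast
      have le: "prob X \<le> prob Y + r / 2" if "X \<in> events" "Y \<in> events" "X \<subseteq> Y \<union> (space M - A)" for X Y
      proof -
        have "prob X \<le> prob (Y \<union> (space M - A))" using that A by (intro finite_measure_mono) auto
        also have "\<dots> \<le> prob Y + prob (space M - A)" using that A by (intro measure_Un_le) auto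
        finally show ?thesis using A(2) by simp
      qed
      have "prob {\<omega> \<in> space M. P n \<omega>} \<le> prob {\<omega> \<in> space M. Q n \<omega>} + r / 2"
        by (rule le[OF P Q]) (use A(3) in auto)
      moreover have "prob {\<omega> \<in> space M. Q n \<omega>} \<le> prob {\<omega> \<in> space M. P n \<omega>} + r / 2"
        by (rule le[OF Q P]) (use A(3) in auto)
      ultimately show ?case using 1 unfolding real_norm_def abs_less_iff by linarith
    qed
    then show ?case by (simp add: eventually_sequentially)
  qed
  from tendsto_diff[OF lim this] show ?thesis by simp
qed

text \<open>
  Dividing by the square root of \<open>V\<close> instead of \<open>v\<close> does not change the limit law, by Slutsky's
  argument. The limit is continuous, so the endpoints of the interval have no mass.
\<close>

lemma (in prob_space) studentized_interval:
  fixes X V :: "nat \<Rightarrow> 'a \<Rightarrow> real"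
  assumes X[measurable]: "\<And>n. X n \<in> borel_measurable M" and V[measurable]: "\<And>n. V n \<in> borel_measurable M"
    and tight: "tight_seq M X" and v: "0 < v"
    and chf: "\<And>t. (\<lambda>n. \<integral>\<omega>. iexp (t * X n \<omega>) \<partial>M) \<longlonglongrightarrow> of_real (exp (- (v * t\<^sup>2) / 2))"
    and close: "\<And>\<eta>. 0 < \<eta> \<Longrightarrow> whp M (\<lambda>n \<omega>. \<bar>V n \<omega> - v\<bar> \<le> \<eta>)"
    and z: "0 < z"
  shows "(\<lambda>n. prob {\<omega> \<in> space M. \<bar>X n \<omega>\<bar> < z * sqrt (V n \<omega>)}) \<longlonglongrightarrow> measure std_normal_distribution {-z<..<z}"
proof -
  \<comment> \<open>The truncation keeps the denominator away from zero; it has no effect with high probability.\<close>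
  define W where "W n \<omega> = max (v / 2) (V n \<omega>)" for n \<omega>
  define Q where "Q n \<omega> = X n \<omega> / sqrt (W n \<omega>)" for n \<omega>
  have [measurable]: "Q n \<in> borel_measurable M" for n unfolding Q_def W_def by measurable
  have W: "v / 2 \<le> W n \<omega>" "0 < W n \<omega>" for n \<omega> using v by (auto simp: W_def)
  have Wclose: "whp M (\<lambda>n \<omega>. \<bar>1 / sqrt v - 1 / sqrt (W n \<omega>)\<bar> \<le> \<eta>)" if \<eta>: "0 < \<eta>" for \<eta>
  proof -
    have "isCont (\<lambda>w. 1 / sqrt (max (v / 2) w)) v" using v by (intro continuous_intros) auto
    then obtain d where d: "0 < d" "\<And>w. dist w v < d \<Longrightarrow> dist (1 / sqrt (max (v / 2) w)) (1 / sqrt (max (v / 2) v)) < \<eta>"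
      using \<eta> unfolding continuous_at_eps_delta by (metis dist_real_def)
    have "max (v / 2) v = v" using v by simp
    note d' = d(2)[unfolded this]
    show ?thesis
    proof (rule whp_mono[OF close[of "d / 2"], where N = 0])
      fix n \<omega> assume "\<bar>V n \<omega> - v\<bar> \<le> d / 2"
      then have "dist (V n \<omega>) v < d" using d(1) by (simp add: dist_real_def)
      from d'[OF this] show "\<bar>1 / sqrt v - 1 / sqrt (W n \<omega>)\<bar> \<le> \<eta>"
        unfolding dist_real_def W_def by linarith
    qed (use d in simp)
  qed
  have slut: "whp M (\<lambda>n \<omega>. norm (X n \<omega> / sqrt v - Q n \<omega>) \<le> \<eta>)" if \<eta>: "0 < \<eta>" for \<eta>
  proof (rule whp_tight[OF tight])
    fix R :: real assume "0 < R"
    then show "whp M (\<lambda>n \<omega>. \<bar>1 / sqrt v - 1 / sqrt (W n \<omega>)\<bar> \<le> \<eta> / R)" using \<eta> by (intro Wclose) simp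
  next
    fix R n \<omega> assume R: "0 < R" and *: "norm (X n \<omega>) \<le> R" "\<bar>1 / sqrt v - 1 / sqrt (W n \<omega>)\<bar> \<le> \<eta> / R"
    have "X n \<omega> / sqrt v - Q n \<omega> = X n \<omega> * (1 / sqrt v - 1 / sqrt (W n \<omega>))"
      by (simp add: Q_def algebra_simps)
    then have "norm (X n \<omega> / sqrt v - Q n \<omega>) = norm (X n \<omega>) * \<bar>1 / sqrt v - 1 / sqrt (W n \<omega>)\<bar>"
      by (simp only: abs_mult real_norm_def)
    also have "\<dots> \<le> R * (\<eta> / R)" using * R by (intro mult_mono) auto
    finally show "norm (X n \<omega> / sqrt v - Q n \<omega>) \<le> \<eta>" using R by simp
  qed
  have Qchf: "(\<lambda>n. \<integral>\<omega>. iexp (t * Q n \<omega>) \<partial>M) \<longlonglongrightarrow> of_real (exp (- t\<^sup>2 / 2))" for t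
  proof -
    have "(\<lambda>n. \<integral>\<omega>. iexp (t \<bullet> Q n \<omega>) \<partial>M) \<longlonglongrightarrow> of_real (exp (- t\<^sup>2 / 2))"
    proof (rule char_slutsky[OF _ _ slut])
      have "v * (t / sqrt v)\<^sup>2 = t\<^sup>2" using v by (simp add: power_divide)
      then show "(\<lambda>n. \<integral>\<omega>. iexp (t \<bullet> (X n \<omega> / sqrt v)) \<partial>M) \<longlonglongrightarrow> of_real (exp (- t\<^sup>2 / 2))"
        using chf[of "t / sqrt v"] by simp
    qed auto
    then show ?thesis by simp
  qed
  interpret N: real_distribution std_normal_distribution by (rule real_dist_normal_dist)
  have rd: "real_distribution (distr M borel (Q n))" for n by (rule real_distribution_distr) measurable
  have wc: "weak_conv_m (\<lambda>n. distr M borel (Q n)) std_normal_distribution"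
  proof (rule levy_continuity[OF rd N.real_distribution_axioms])
    fix t
    have "char (distr M borel (Q n)) t = (\<integral>\<omega>. iexp (t * Q n \<omega>) \<partial>M)" for n
      unfolding char_def by (subst integral_distr) auto
    then show "(\<lambda>n. char (distr M borel (Q n)) t) \<longlonglongrightarrow> char std_normal_distribution t"
      using Qchf[of t] by (simp add: char_std_normal_distribution)
  qed
  have fr: "frontier {-z<..<z} = {-z, z}" using z
    by (simp add: frontier_def interior_open closure_greaterThanLessThan)
  have "(\<lambda>n. measure (distr M borel (Q n)) {-z<..<z}) \<longlonglongrightarrow> measure std_normal_distribution {-z<..<z}"
  proof (rule weak_conv_imp_continuity_set_conv[OF rd N.real_distribution_axioms wc])
    have "measure std_normal_distribution ({-z} \<union> {z}) = measure std_normal_distribution {-z} + measure std_normal_distribution {z}"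
      by (rule N.finite_measure_Union) (use z in auto)
    then show "emeasure std_normal_distribution (frontier {-z<..<z}) = 0"
      unfolding fr by (simp add: N.emeasure_eq_measure std_normal_singleton insert_commute)
  qed simp
  moreover have "measure (distr M borel (Q n)) {-z<..<z} = prob {\<omega> \<in> space M. Q n \<omega> \<in> {-z<..<z}}" for n
    by (subst measure_distr) (auto intro: arg_cong[where f = prob])
  ultimately have lim: "(\<lambda>n. prob {\<omega> \<in> space M. Q n \<omega> \<in> {-z<..<z}}) \<longlonglongrightarrow> measure std_normal_distribution {-z<..<z}"
    by simp
  show ?thesis
  proof (rule whp_measure_tendsto[OF _ _ _ lim])
    have v2: "0 < v / 2" using v by simp
    show "whp M (\<lambda>n \<omega>. (Q n \<omega> \<in> {-z<..<z}) \<longleftrightarrow> (\<bar>X n \<omega>\<bar> < z * sqrt (V n \<omega>)))"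
    proof (rule whp_mono[OF close[OF v2], where N = 0])
      fix n \<omega> assume "\<bar>V n \<omega> - v\<bar> \<le> v / 2"
      then have "v / 2 \<le> V n \<omega>" by linarith
      then have VW: "W n \<omega> = V n \<omega>" by (simp add: W_def)
      have "0 < sqrt (V n \<omega>)" using W(2)[of n \<omega>] VW by simp
      then show "(Q n \<omega> \<in> {-z<..<z}) \<longleftrightarrow> (\<bar>X n \<omega>\<bar> < z * sqrt (V n \<omega>))"
        unfolding Q_def VW by (auto simp: field_simps abs_less_iff)
    qed
  qed measurable
qed

section \<open>The limit theorems for an affine family\<close>

context copula_family begin

lemma chain_AE_cube:
  assumes "copula_markov_chain M U C"
  shows "AE \<omega> in M. \<forall>i. U i \<omega> \<in> {0..1}"
proof -
  interpret prob_space M using assms by (simp add: copula_markov_chain_def)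
  have [measurable]: "U i \<in> borel_measurable M" for i using assms by (simp add: copula_markov_chain_def)
  have "AE \<omega> in M. U i \<omega> \<in> {0..1}" for i
  proof -
    have "distr M borel (U i) = unif01" using assms by (simp add: copula_markov_chain_def uniform_measure_Ioo_eq)
    then have "AE x in distr M borel (U i). x \<in> {0..1}" by (simp only: AE_unif01)
    then show ?thesis by (subst (asm) AE_distr_iff) auto
  qed
  then show ?thesis by (simp add: AE_all_countable)
qed

lemma sample_in_cube: "\<forall>i. U i \<omega> \<in> {0..1} \<Longrightarrow> sample U n \<omega> \<in> {..n} \<rightarrow>\<^sub>E {0..1}"
  by (auto simp: sample_def)

lemma sample_nth: "i \<le> n \<Longrightarrow> sample U n \<omega> i = U i \<omega>"
  by (simp add: sample_def)

text \<open>
  Almost surely the sample lies in the cube, where the estimator is a maximizer.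
\<close>

lemma chain_estimator_mle:
  fixes M :: "'w measure"
  assumes T: "mle T" and L: "L \<in> interior \<Theta>"
    and C: "has_copula_density C (plane_dens L)" "copula_markov_chain M U C"
  shows "chain_estimator (\<lambda>k u. indicator {0..1} u * e k u) b M U L (\<lambda>n \<omega>. T n (sample U n \<omega>))"
proof -
  have L\<Theta>: "L \<in> \<Theta>" using L interior_subset by blast
  interpret prob_space M using C by (simp add: copula_markov_chain_def)
  interpret CC: copula_chain M U C "plane_dens L" "dens L" 2
  proof
    show "copula_markov_chain M U C" "has_copula_density C (plane_dens L)" by (rule C)+
    show "dens L u v = plane_dens L u v" if "u \<in> {0..1}" "v \<in> {0..1}" for u v
      using that by (rule plane_dens_eq_dens[symmetric])
    show "(\<lambda>(u, v). dens L u v) \<in> borel_measurable (borel \<Otimes>\<^sub>M borel)" unfolding split_beta' by measurable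
  qed (use L\<Theta> in \<open>auto intro: dens_nonneg dens_le_2\<close>)
  interpret FC: finite_rank_chain "\<lambda>k u. indicator {0..1} u * e k u" b M U L
  proof
    show "U i \<in> borel_measurable M" for i by (rule CC.chain_measurable)
    show "distr M borel (U i) = unif01" for i by (rule CC.chain_distr)
    show "weight L < 1" by (rule interior_\<Theta>[OF L])
  qed (rule CC.transition_expectation)
  show ?thesis
  proof
    show "(\<lambda>\<omega>. T n (sample U n \<omega>)) \<in> borel_measurable M" for n
      using measurable_compose[OF CC.sample_measurable mleD(1)[OF T]] .
    fix n
    show "AE \<omega> in M. T n (sample U n \<omega>) \<in> \<Theta> \<and>
           (\<forall>i<n. 0 < dens (T n (sample U n \<omega>)) (U i \<omega>) (U (Suc i) \<omega>)) \<and>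
           (\<Sum>i<n. ((L - T n (sample U n \<omega>)) \<bullet> feature (U i \<omega>) (U (Suc i) \<omega>)) / dens (T n (sample U n \<omega>)) (U i \<omega>) (U (Suc i) \<omega>)) \<le> 0 \<and>
           (weight (T n (sample U n \<omega>)) < 1 \<longrightarrow>
            (\<Sum>i<n. (1 / dens (T n (sample U n \<omega>)) (U i \<omega>) (U (Suc i) \<omega>)) *\<^sub>R feature (U i \<omega>) (U (Suc i) \<omega>)) = 0)"
      using chain_AE_cube[OF C(2)]
    proof eventually_elim
      case (elim \<omega>)
      note cube = sample_in_cube[of U \<omega> n, OF elim]
      have max: "likelihood n (sample U n \<omega>) q \<le> likelihood n (sample U n \<omega>) (T n (sample U n \<omega>))" if "q \<in> \<Theta>" for q
        using that by (rule mleD(3)[OF T cube])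
      note lm = likelihood_maximizer[where T = "T n (sample U n \<omega>)" and n = n and x = "sample U n \<omega>"]
      note T\<Theta> = mleD(2)[OF T cube]
      have nth: "sample U n \<omega> i = U i \<omega> \<and> sample U n \<omega> (Suc i) = U (Suc i) \<omega>" if "i < n" for i
        using that by (simp add: sample_nth)
      have 1: "0 < dens (T n (sample U n \<omega>)) (U i \<omega>) (U (Suc i) \<omega>)" if "i < n" for i
        using lm(1)[OF T\<Theta> _ that] max nth[OF that] by simp
      have 2: "(\<Sum>i<n. ((L - T n (sample U n \<omega>)) \<bullet> feature (U i \<omega>) (U (Suc i) \<omega>)) / dens (T n (sample U n \<omega>)) (U i \<omega>) (U (Suc i) \<omega>)) \<le> 0"
        using lm(2)[OF T\<Theta> _ L\<Theta>] max nth by simp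
      have 3: "(\<Sum>i<n. (1 / dens (T n (sample U n \<omega>)) (U i \<omega>) (U (Suc i) \<omega>)) *\<^sub>R feature (U i \<omega>) (U (Suc i) \<omega>)) = 0"
        if "weight (T n (sample U n \<omega>)) < 1"
        using lm(3)[OF T\<Theta> _ that] max nth by simp
      show ?case using mleD(2)[OF T cube] 1 2 3 by blast
    qed
  qed
qed

lemma mle_asymptotics:
  fixes M :: "'w measure"
  assumes T: "mle T" and L: "L \<in> interior \<Theta>"
    and C: "has_copula_density C (plane_dens L)" "copula_markov_chain M U C"
  defines "\<Sigma> \<equiv> Sigma_matrix M U plane_dens L"
  defines "Y \<equiv> \<lambda>n \<omega>. sqrt (real n) *\<^sub>R (T n (sample U n \<omega>) - L)"
  shows "consistent_estimator M U T L" and "pos_def_matrix \<Sigma>"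
    and "Y n \<in> borel_measurable M" and "tight_seq M Y"
    and "(\<lambda>n. \<integral>\<omega>. iexp (a \<bullet> Y n \<omega>) \<partial>M) \<longlonglongrightarrow> of_real (exp (- (a \<bullet> (matrix_inv \<Sigma> *v a)) / 2))"
    and "0 < \<alpha> \<Longrightarrow> \<alpha> < 1 \<Longrightarrow> (\<lambda>n. measure M {\<omega> \<in> space M.
               let x = sample U n \<omega>;
                   h = std_normal_upper_quantile (\<alpha> / 2) *
                       sqrt (matrix_inv (observed_information plane_dens n x (T n x)) $ k $ k)
               in L $ k \<in> {T n x $ k - h <..< T n x $ k + h}}) \<longlonglongrightarrow> 1 - \<alpha>"
proof -
  interpret CE: chain_estimator "\<lambda>k u. indicator {0..1} u * e k u" b M U L "\<lambda>n \<omega>. T n (sample U n \<omega>)"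
    by (rule chain_estimator_mle[OF T L C])
  have Y: "Y = CE.scaled_err" by (intro ext) (simp add: Y_def CE.scaled_err_def)
  have cube: "AE \<omega> in M. \<forall>i. U i \<omega> \<in> {0..1}" by (rule chain_AE_cube[OF C(2)])
  have \<Sigma>: "\<Sigma> = CE.fisher_info"
  proof -
    have "\<Sigma> $ i $ j = CE.fisher_info $ i $ j" for i j
    proof -
      have pm: "(\<lambda>\<omega>. partial_deriv i (\<lambda>L. ln (plane_dens L (U 0 \<omega>) (U 1 \<omega>))) L) \<in> borel_measurable M" for i
        by (rule CE.pair_fun_measurable[OF partial_deriv_ln_plane_dens_measurable])
      have "\<Sigma> $ i $ j = (\<integral>\<omega>. CE.score (U 0 \<omega>) (U 1 \<omega>) $ i * CE.score (U 0 \<omega>) (U 1 \<omega>) $ j \<partial>M)"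
        unfolding \<Sigma>_def Sigma_matrix_def vec_lambda_beta
      proof (rule integral_cong_AE)
        show "(\<lambda>\<omega>. partial_deriv i (\<lambda>L. ln (plane_dens L (U 0 \<omega>) (U 1 \<omega>))) L * partial_deriv j (\<lambda>L. ln (plane_dens L (U 0 \<omega>) (U 1 \<omega>))) L)
          \<in> borel_measurable M" by (intro borel_measurable_times pm)
        show "(\<lambda>\<omega>. CE.score (U 0 \<omega>) (U 1 \<omega>) $ i * CE.score (U 0 \<omega>) (U 1 \<omega>) $ j) \<in> borel_measurable M"
          by (intro borel_measurable_times CE.score_nth_measurable CE.U_meas)
        show "AE \<omega> in M. partial_deriv i (\<lambda>L. ln (plane_dens L (U 0 \<omega>) (U 1 \<omega>))) L * partial_deriv j (\<lambda>L. ln (plane_dens L (U 0 \<omega>) (U 1 \<omega>))) L =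
            CE.score (U 0 \<omega>) (U 1 \<omega>) $ i * CE.score (U 0 \<omega>) (U 1 \<omega>) $ j"
          using cube
        proof eventually_elim
          case (elim \<omega>)
          have u: "U 0 \<omega> \<in> {0..1}" "U 1 \<omega> \<in> {0..1}" using elim by blast+
          have "partial_deriv l (\<lambda>L. ln (plane_dens L (U 0 \<omega>) (U 1 \<omega>))) L = CE.score (U 0 \<omega>) (U 1 \<omega>) $ l" for l
            unfolding partial_deriv_ln_plane_dens unfolding plane_dens_eq_dens[OF u] plane_feature_eq_feature[OF u] CE.score_def
            using CE.dens_L_pos[of "U 0 \<omega>" "U 1 \<omega>"] by simp
          then show ?case by simp
        qed
      qed
      also have "\<dots> = CE.fisher_info $ i $ j" unfolding CE.fisher_info_def vec_lambda_beta
        by (rule CE.expectation_pair[OF CE.score_product_measurable CE.score_product_bound])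
      finally show ?thesis .
    qed
    then show ?thesis unfolding vec_eq_iff by blast
  qed
  show "consistent_estimator M U T L"
    unfolding consistent_estimator_def
  proof (intro allI impI)
    fix \<epsilon> :: real assume \<epsilon>: "0 < \<epsilon>"
    show "(\<lambda>n. measure M {\<omega> \<in> space M. dist (T n (sample U n \<omega>)) L > \<epsilon>}) \<longlonglongrightarrow> 0"
    proof (rule LIMSEQ_I, goal_cases)
      case (1 r)
      have "prob_eventually M (r / 2) (\<lambda>n \<omega>. norm (CE.err n \<omega>) \<le> \<epsilon>)"
        using CE.err_small[OF \<epsilon>] 1 unfolding whp_def by simp
      then have "\<forall>\<^sub>F n in sequentially. norm (measure M {\<omega> \<in> space M. dist (T n (sample U n \<omega>)) L > \<epsilon>} - 0) < r"
        unfolding prob_eventually_def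
      proof eventually_elim
        case (elim n)
        then obtain A where A: "A \<in> CE.events" "CE.prob (space M - A) \<le> r / 2" "\<forall>\<omega>\<in>A. norm (CE.err n \<omega>) \<le> \<epsilon>" by blast
        have "{\<omega> \<in> space M. dist (T n (sample U n \<omega>)) L > \<epsilon>} \<subseteq> space M - A"
          using A(3) by (auto simp: CE.err_def dist_norm not_less[symmetric])
        then have "CE.prob {\<omega> \<in> space M. dist (T n (sample U n \<omega>)) L > \<epsilon>} \<le> CE.prob (space M - A)"
          using A(1) by (intro CE.finite_measure_mono) auto
        then show ?case using A(2) 1 by simp
      qed
      then show ?case by (simp add: eventually_sequentially)
    qed
  qed
  show "pos_def_matrix \<Sigma>" unfolding \<Sigma> by (rule CE.pos_def_fisher_info)
  show "Y n \<in> borel_measurable M" unfolding Y by (rule CE.scaled_err_measurable)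
  show "tight_seq M Y" unfolding Y by (rule CE.tight_scaled_err)
  show "(\<lambda>n. \<integral>\<omega>. iexp (a \<bullet> Y n \<omega>) \<partial>M) \<longlonglongrightarrow> of_real (exp (- (a \<bullet> (matrix_inv \<Sigma> *v a)) / 2))"
    unfolding Y \<Sigma> by (rule CE.scaled_err_char_limit)
  assume \<alpha>: "0 < \<alpha>" "\<alpha> < 1"
  define z where "z = std_normal_upper_quantile (\<alpha> / 2)"
  note z = std_normal_upper_quantile[OF \<alpha>, folded z_def]
  define obs where "obs n \<omega> = observed_information plane_dens n (sample U n \<omega>) (T n (sample U n \<omega>))" for n \<omega>
  define X where "X n \<omega> = CE.scaled_err n \<omega> $ k" for n \<omega>
  define V where "V n \<omega> = real n * (matrix_inv (obs n \<omega>) $ k $ k)" for n \<omega>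
  define v where "v = matrix_inv CE.fisher_info $ k $ k"
  have obs_eq: "obs n \<omega> $ i $ j = (\<Sum>m<n. plane_feature (U m \<omega>) (U (Suc m) \<omega>) $ i * plane_feature (U m \<omega>) (U (Suc m) \<omega>) $ j /
      (plane_dens (T n (sample U n \<omega>)) (U m \<omega>) (U (Suc m) \<omega>))\<^sup>2)" for n \<omega> i j
  proof -
    have "obs n \<omega> $ i $ j = (\<Sum>m<n. plane_feature (sample U n \<omega> m) (sample U n \<omega> (Suc m)) $ i * plane_feature (sample U n \<omega> m) (sample U n \<omega> (Suc m)) $ j /
        (plane_dens (T n (sample U n \<omega>)) (sample U n \<omega> m) (sample U n \<omega> (Suc m)))\<^sup>2)"
      unfolding obs_def
      by (subst observed_information_plane_dens) (simp_all add: mle_plane_dens_pos[OF T])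
    also have "\<dots> = (\<Sum>m<n. plane_feature (U m \<omega>) (U (Suc m) \<omega>) $ i * plane_feature (U m \<omega>) (U (Suc m) \<omega>) $ j /
      (plane_dens (T n (sample U n \<omega>)) (U m \<omega>) (U (Suc m) \<omega>))\<^sup>2)"
      by (intro sum.cong refl) (simp add: sample_nth)
    finally show ?thesis .
  qed
  have obs_meas: "(\<lambda>\<omega>. obs n \<omega> $ i $ j) \<in> borel_measurable M" for n i j
  proof -
    have "(\<lambda>\<omega>. plane_feature (U m \<omega>) (U (Suc m) \<omega>) $ i) \<in> borel_measurable M" for m i
      unfolding plane_feature_def vec_lambda_beta by measurable
    moreover have "(\<lambda>\<omega>. plane_dens (T n (sample U n \<omega>)) (U m \<omega>) (U (Suc m) \<omega>)) \<in> borel_measurable M" for m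
      by (intro plane_dens_measurable CE.T_meas CE.U_meas)
    ultimately show ?thesis unfolding obs_eq
      by (intro borel_measurable_sum borel_measurable_divide borel_measurable_times borel_measurable_power)
  qed
  have V_meas: "V n \<in> borel_measurable M" for n
    unfolding V_def by (intro borel_measurable_times borel_measurable_const measurable_matrix_inv_diagonal obs_meas)
  have Xa: "X n \<omega> = axis k 1 \<bullet> CE.scaled_err n \<omega>" for n \<omega> by (simp add: X_def inner_axis')
  have X_meas: "X n \<in> borel_measurable M" for n
    unfolding Xa by measurable
  have X_tight: "tight_seq M X"
    by (rule CE.tight_dominated[OF CE.tight_scaled_err, where C = 1])
       (auto simp: X_def intro!: CE.whp_AE component_le_norm_cart)
  have quad: "(t *\<^sub>R axis k 1) \<bullet> (A *v (t *\<^sub>R axis k 1)) = A $ k $ k * t\<^sup>2" for t :: real and A :: "real^'s^'s"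
    by (simp add: matrix_vector_mult_scaleR matrix_vector_mult_basis column_def inner_axis' power2_eq_square)
  have v_pos: "0 < v"
  proof -
    define x where "x = matrix_inv CE.fisher_info *v axis k 1"
    have Sx: "CE.fisher_info *v x = axis k 1"
      by (simp add: x_def matrix_vector_mul_assoc matrix_inv_mult[OF CE.fisher_info_invertible])
    then have "x \<noteq> 0" by (metis axis_eq_0_iff matrix_vector_mult_0_right zero_neq_one)
    then have "0 < x \<bullet> (CE.fisher_info *v x)" using CE.pos_def_fisher_info by (simp add: pos_def_matrix_def)
    also have "x \<bullet> (CE.fisher_info *v x) = v" unfolding Sx
      by (simp add: x_def v_def inner_axis matrix_vector_mult_basis column_def)
    finally show ?thesis .
  qed
  have X_chf: "(\<lambda>n. \<integral>\<omega>. iexp (t * X n \<omega>) \<partial>M) \<longlonglongrightarrow> of_real (exp (- (v * t\<^sup>2) / 2))" for t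
    using CE.scaled_err_char_limit[of "t *\<^sub>R axis k 1"] unfolding quad v_def[symmetric] by (simp add: Xa)
  have V_close: "whp M (\<lambda>n \<omega>. \<bar>V n \<omega> - v\<bar> \<le> \<eta>)" if \<eta>: "0 < \<eta>" for \<eta>
  proof -
    obtain \<kappa> where \<kappa>: "0 < \<kappa>" "\<And>A. norm (A - CE.fisher_info) \<le> \<kappa> \<Longrightarrow> invertible A \<and> \<bar>matrix_inv A $ k $ k - matrix_inv CE.fisher_info $ k $ k\<bar> \<le> \<eta>"
      by (rule matrix_inv_diagonal_continuous[OF CE.fisher_info_invertible \<eta>, of k]) blast
    have "whp M (\<lambda>n \<omega>. (\<forall>i. U i \<omega> \<in> {0..1}) \<and> norm (CE.plug_in_info n \<omega> - CE.fisher_info) \<le> \<kappa>)"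
      by (intro CE.whp_conj CE.whp_AE CE.plug_in_info_limit cube \<kappa>)
    then show ?thesis
    proof (rule whp_mono[where N = 1])
      fix n \<omega> assume n: "1 \<le> n" and *: "(\<forall>i. U i \<omega> \<in> {0..1}) \<and> norm (CE.plug_in_info n \<omega> - CE.fisher_info) \<le> \<kappa>"
      have U: "U i \<omega> \<in> {0..1}" for i using * by blast
      have inv: "invertible (CE.plug_in_info n \<omega>)" and cl: "\<bar>matrix_inv (CE.plug_in_info n \<omega>) $ k $ k - v\<bar> \<le> \<eta>"
        using \<kappa>(2)[of "CE.plug_in_info n \<omega>"] * by (auto simp: v_def)
      \<comment> \<open>On the cube the observed information is \<open>n\<close> times the plug-in information.\<close>
      have "obs n \<omega> $ i $ j = (n *\<^sub>R CE.plug_in_info n \<omega>) $ i $ j" for i j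
        unfolding obs_eq using n by (simp add: CE.plug_in_info_def plane_dens_eq_dens[OF U U] plane_feature_eq_feature[OF U U])
      then have obs_info: "obs n \<omega> = n *\<^sub>R CE.plug_in_info n \<omega>" unfolding vec_eq_iff by blast
      have "(c *\<^sub>R A) ** ((1 / c) *\<^sub>R B) = A ** B" if "c \<noteq> 0" for c :: real and A B :: "real^'s^'s"
        using that by (simp add: matrix_matrix_mult_def vec_eq_iff)
      note sc = this[of "real n"]
      have nz: "real n \<noteq> 0" using n by simp
      have "obs n \<omega> ** ((1 / n) *\<^sub>R matrix_inv (CE.plug_in_info n \<omega>)) = mat 1"
        unfolding obs_info sc[OF nz] by (rule matrix_inv_mult(1)[OF inv])
      then have "matrix_inv (obs n \<omega>) = (1 / n) *\<^sub>R matrix_inv (CE.plug_in_info n \<omega>)" by (rule matrix_inv_eqI)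
      then have "V n \<omega> = matrix_inv (CE.plug_in_info n \<omega>) $ k $ k" using n by (simp add: V_def)
      then show "\<bar>V n \<omega> - v\<bar> \<le> \<eta>" using cl by simp
    qed
  qed
  have lim: "(\<lambda>n. CE.prob {\<omega> \<in> space M. \<bar>X n \<omega>\<bar> < z * sqrt (V n \<omega>)}) \<longlonglongrightarrow> 1 - \<alpha>"
    using CE.studentized_interval[OF X_meas V_meas X_tight v_pos X_chf V_close z(1)] unfolding z(2) .
  show "(\<lambda>n. measure M {\<omega> \<in> space M.
               let x = sample U n \<omega>;
                   h = std_normal_upper_quantile (\<alpha> / 2) *
                       sqrt (matrix_inv (observed_information plane_dens n x (T n x)) $ k $ k)
               in L $ k \<in> {T n x $ k - h <..< T n x $ k + h}}) \<longlonglongrightarrow> 1 - \<alpha>"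
  proof (rule Lim_transform_eventually[OF lim])
    show "\<forall>\<^sub>F n in sequentially. CE.prob {\<omega> \<in> space M. \<bar>X n \<omega>\<bar> < z * sqrt (V n \<omega>)} = CE.prob {\<omega> \<in> space M.
               let x = sample U n \<omega>;
                   h = std_normal_upper_quantile (\<alpha> / 2) *
                       sqrt (matrix_inv (observed_information plane_dens n x (T n x)) $ k $ k)
               in L $ k \<in> {T n x $ k - h <..< T n x $ k + h}}"
      using eventually_ge_at_top[of 1]
    proof eventually_elim
      case (elim n)
      have "(\<bar>X n \<omega>\<bar> < z * sqrt (V n \<omega>)) = (let x = sample U n \<omega>;
                   h = std_normal_upper_quantile (\<alpha> / 2) *
                       sqrt (matrix_inv (observed_information plane_dens n x (T n x)) $ k $ k)
               in L $ k \<in> {T n x $ k - h <..< T n x $ k + h})" for \<omega>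
      proof -
        define d where "d = T n (sample U n \<omega>) $ k - L $ k"
        define w where "w = z * sqrt (matrix_inv (obs n \<omega>) $ k $ k)"
        have n: "0 < sqrt (real n)" using elim by simp
        have "\<bar>X n \<omega>\<bar> = sqrt (real n) * \<bar>d\<bar>" by (simp add: X_def CE.scaled_err_def d_def abs_mult)
        moreover have "z * sqrt (V n \<omega>) = sqrt (real n) * w" by (simp add: V_def w_def real_sqrt_mult)
        ultimately have "(\<bar>X n \<omega>\<bar> < z * sqrt (V n \<omega>)) = (\<bar>d\<bar> < w)"
          using n by (simp only: mult_less_cancel_left_pos)
        also have "\<dots> = (L $ k \<in> {T n (sample U n \<omega>) $ k - w <..< T n (sample U n \<omega>) $ k + w})"
          by (auto simp: d_def)
        finally show ?thesis unfolding Let_def obs_def[symmetric] z_def[symmetric] w_def .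
      qed
      then show ?case by simp
    qed
  qed
qed

end

text \<open>
  The assertion about one family, with the type of the sample space made explicit.
\<close>

definition mle_theory_holds ::
  "'w itself \<Rightarrow> (real^'s::finite \<Rightarrow> real \<Rightarrow> real \<Rightarrow> real) \<Rightarrow> (real^'s) set \<Rightarrow> bool" where
  "mle_theory_holds _ c \<Theta> \<longleftrightarrow> (\<exists>T. max_likelihood_estimator c \<Theta> T \<and>
      (\<forall>(M :: 'w measure) U C. \<forall>\<Lambda> \<in> interior \<Theta>.
         has_copula_density C (c \<Lambda>) \<and> copula_markov_chain M U C \<longrightarrow>
         consistent_estimator M U T \<Lambda> \<and>
         invertible (Sigma_matrix M U c \<Lambda>) \<and>
         converges_in_distribution M (\<lambda>n \<omega>. sqrt (real n) *\<^sub>R (T n (sample U n \<omega>) - \<Lambda>))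
           (multivariate_normal 0 (matrix_inv (Sigma_matrix M U c \<Lambda>))) \<and>
         (\<forall>\<alpha>. 0 < \<alpha> \<and> \<alpha> < 1 \<longrightarrow> (\<forall>k.
            (\<lambda>n. measure M {\<omega> \<in> space M.
               let x = sample U n \<omega>;
                   h = std_normal_upper_quantile (\<alpha> / 2) *
                       sqrt (matrix_inv (observed_information c n x (T n x)) $ k $ k)
               in \<Lambda> $ k \<in> {T n x $ k - h <..< T n x $ k + h}}) \<longlonglongrightarrow> 1 - \<alpha>))))"

theorem copula_family_mle:
  fixes e :: "'s::{finite,wellorder} \<Rightarrow> real \<Rightarrow> real"
  assumes "copula_family e b"
    and c: "\<And>L u v. c L u v = 1 + (\<Sum>k\<in>UNIV. L $ k * (e k u * e k v))"
    and R: "R = {L. (\<Sum>k\<in>UNIV. b k * \<bar>L $ k\<bar>) \<le> 1}"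
  shows "mle_theory_holds TYPE('w) c R"
proof -
  interpret copula_family e b by fact
  have ceq: "c = plane_dens" by (intro ext) (simp add: c plane_dens_def plane_feature_def inner_vec_def)
  have Req: "R = \<Theta>" by (simp add: R \<Theta>_def weight_def)
  obtain T where T: "mle T" using mle_exists by blast
  show ?thesis unfolding mle_theory_holds_def ceq Req
  proof (intro exI[of _ T] conjI allI ballI impI; (elim conjE)?)
    show "max_likelihood_estimator plane_dens \<Theta> T" by (rule mle_max_likelihood_estimator[OF T])
    fix M :: "'w measure" and U C L
    assume L: "L \<in> interior \<Theta>" and C: "has_copula_density C (plane_dens L)" "copula_markov_chain M U C"
    note as = mle_asymptotics[OF T L C]
    interpret prob_space M using C by (simp add: copula_markov_chain_def)
    show "consistent_estimator M U T L" by (rule as(1))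
    show "invertible (Sigma_matrix M U plane_dens L)" by (rule pos_def_invertible[OF as(2)])
    show "converges_in_distribution M (\<lambda>n \<omega>. sqrt (real n) *\<^sub>R (T n (sample U n \<omega>) - L))
           (multivariate_normal 0 (matrix_inv (Sigma_matrix M U plane_dens L)))"
      by (rule continuity_theorem[OF as(3,4) multivariate_normal_char(1,2)[OF as(2)]])
         (simp only: multivariate_normal_char(3)[OF as(2)] as(5))
    fix \<alpha> :: real and k assume "0 < \<alpha>" "\<alpha> < 1"
    then show "(\<lambda>n. measure M {\<omega> \<in> space M.
               let x = sample U n \<omega>;
                   h = std_normal_upper_quantile (\<alpha> / 2) *
                       sqrt (matrix_inv (observed_information plane_dens n x (T n x)) $ k $ k)
               in L $ k \<in> {T n x $ k - h <..< T n x $ k + h}}) \<longlonglongrightarrow> 1 - \<alpha>"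
      by (rule as(6))
  qed
qed

section \<open>The sine, sine-cosine and Legendre copulas\<close>

lemma unif01_integral_FTC:
  fixes F :: "real \<Rightarrow> real"
  assumes F: "\<And>x. (F has_real_derivative h x) (at x)" and h: "continuous_on UNIV h"
  shows "(\<integral>u. h u \<partial>unif01) = F 1 - F 0"
proof -
  have [measurable]: "h \<in> borel_measurable borel" by (rule borel_measurable_continuous_onI[OF h])
  have eq: "unif01 = density lborel (\<lambda>x. ennreal (indicator {0..1} x))"
    unfolding unif01_eq_density by (intro density_cong) (auto simp: indicator_def)
  have "(\<integral>u. h u \<partial>unif01) = (\<integral>u. indicator {0..1} u *\<^sub>R h u \<partial>lborel)"
    unfolding eq by (rule integral_density) auto
  also have "\<dots> = (\<integral>u. h u * indicator {0..1} u \<partial>lborel)"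
    by (simp only: real_scaleR_def mult.commute)
  also have "\<dots> = F 1 - F 0"
  proof (rule integral_FTC_Icc_real)
    show "isCont h x" for x using h by (simp add: continuous_on_eq_continuous_at)
  qed (simp_all add: F)
  finally show ?thesis .
qed

lemma integral_cos_multiple:
  fixes m :: int
  shows "(\<integral>u. cos (of_int m * pi * u) \<partial>unif01) = (if m = 0 then 1 else 0)"
proof (cases "m = 0")
  case False
  have "(\<integral>u. cos (of_int m * pi * u) \<partial>unif01) = sin (of_int m * pi * 1) / (of_int m * pi) - sin (of_int m * pi * 0) / (of_int m * pi)"
    by (rule unif01_integral_FTC) (use False in \<open>auto intro!: derivative_eq_intros continuous_intros\<close>)
  then show ?thesis using False sin_npi_int[of m] by (simp add: mult.commute)
qed (simp add: unif01.prob_space)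

lemma integral_sin_even_multiple:
  fixes m :: int
  shows "(\<integral>u. sin (2 * of_int m * pi * u) \<partial>unif01) = 0"
proof (cases "m = 0")
  case False
  have "(\<integral>u. sin (2 * of_int m * pi * u) \<partial>unif01) = - cos (2 * of_int m * pi * 1) / (2 * of_int m * pi) - - cos (2 * of_int m * pi * 0) / (2 * of_int m * pi)"
    by (rule unif01_integral_FTC) (use False in \<open>auto intro!: derivative_eq_intros continuous_intros\<close>)
  moreover have "cos (2 * of_int m * pi) = 1" using cos_int_2pin[of m] by (simp only: mult_ac)
  ultimately show ?thesis by simp
qed simp

lemma integrable_trig: "integrable unif01 (\<lambda>u. cos (c * u))" "integrable unif01 (\<lambda>u. sin (c * u))"
  by (rule integrable_unif01[where K = 1]; simp)+

lemma integral_cos_cos: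
  fixes m n :: int
  assumes "0 < m" "0 < n"
  shows "(\<integral>u. cos (of_int m * pi * u) * cos (of_int n * pi * u) \<partial>unif01) = (if m = n then 1/2 else 0)"
proof -
  have "cos (of_int m * pi * u) * cos (of_int n * pi * u) = (1/2) * cos (of_int (m - n) * pi * u) + (1/2) * cos (of_int (m + n) * pi * u)" for u
    unfolding cos_times_cos by (simp add: left_diff_distrib distrib_right)
  then show ?thesis using assms integrable_trig(1)
    by (simp add: integral_cos_multiple del: of_int_add of_int_diff)
qed

lemma integral_sin_sin:
  fixes m n :: int
  assumes "0 < m" "0 < n"
  shows "(\<integral>u. sin (of_int m * pi * u) * sin (of_int n * pi * u) \<partial>unif01) = (if m = n then 1/2 else 0)"
proof -
  have "sin (of_int m * pi * u) * sin (of_int n * pi * u) = (1/2) * cos (of_int (m - n) * pi * u) - (1/2) * cos (of_int (m + n) * pi * u)" for u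
    unfolding sin_times_sin by (simp add: left_diff_distrib distrib_right)
  then show ?thesis using assms integrable_trig(1)
    by (simp add: integral_cos_multiple del: of_int_add of_int_diff)
qed

lemma integral_sin_cos_even:
  fixes m n :: int
  shows "(\<integral>u. sin (2 * of_int m * pi * u) * cos (2 * of_int n * pi * u) \<partial>unif01) = 0"
proof -
  have "sin (2 * of_int m * pi * u) * cos (2 * of_int n * pi * u) = (1/2) * sin (2 * of_int (m + n) * pi * u) + (1/2) * sin (2 * of_int (m - n) * pi * u)" for u
    unfolding sin_times_cos by (simp add: left_diff_distrib distrib_right distrib_left right_diff_distrib)
  then show ?thesis using integrable_trig(2)
    by (simp add: integral_sin_even_multiple del: of_int_add of_int_diff)
qed

lemma sqrt2_mult: "sqrt 2 * a * (sqrt 2 * b) = 2 * (a * b)" for a b :: real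
proof -
  have "sqrt 2 * a * (sqrt 2 * b) = (sqrt 2 * sqrt 2) * (a * b)" by (simp only: mult_ac)
  then show ?thesis by simp
qed

lemma sqrt2_bound: "\<bar>x\<bar> \<le> 1 \<Longrightarrow> (sqrt 2 * x)\<^sup>2 \<le> 2" for x :: real
  using abs_square_le_1[of x] by (simp add: power_mult_distrib)

definition sine_basis :: "2 \<Rightarrow> real \<Rightarrow> real" where
  "sine_basis k u = sqrt 2 * cos (of_int (if k = 1 then 1 else 2) * pi * u)"

lemma sine_family: "copula_family sine_basis (\<lambda>_. 2)"
proof
  fix k j :: 2 and u :: real
  show "continuous_on UNIV (sine_basis k)" unfolding sine_basis_def by (intro continuous_intros)
  show "(sine_basis k u)\<^sup>2 \<le> 2" unfolding sine_basis_def by (rule sqrt2_bound) simp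
  show "(\<integral>u. sine_basis k u \<partial>unif01) = 0"
    unfolding sine_basis_def by (simp only: integral_mult_right_zero integral_cos_multiple) simp
  show "(\<integral>u. sine_basis k u * sine_basis j u \<partial>unif01) = (if k = j then 1 else 0)"
    unfolding sine_basis_def sqrt2_mult integral_mult_right_zero
    by (subst integral_cos_cos) (use exhaust_2[of k] exhaust_2[of j] in auto)
qed

definition sine_cosine_basis :: "4 \<Rightarrow> real \<Rightarrow> real" where
  "sine_cosine_basis k u = sqrt 2 *
     (if k = 1 then cos (2 * of_int 1 * pi * u) else if k = 2 then cos (2 * of_int 2 * pi * u)
      else if k = 3 then sin (2 * of_int 1 * pi * u) else sin (2 * of_int 2 * pi * u))"

lemma sine_cosine_family: "copula_family sine_cosine_basis (\<lambda>_. 2)"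
proof
  fix k j :: 4 and u :: real
  have cc: "(\<integral>u. cos (2 * of_int m * pi * u) * cos (2 * of_int n * pi * u) \<partial>unif01) = (if m = n then 1/2 else 0)"
    if "0 < m" "0 < n" for m n :: int
    using integral_cos_cos[of "2 * m" "2 * n"] that by simp
  have ss: "(\<integral>u. sin (2 * of_int m * pi * u) * sin (2 * of_int n * pi * u) \<partial>unif01) = (if m = n then 1/2 else 0)"
    if "0 < m" "0 < n" for m n :: int
    using integral_sin_sin[of "2 * m" "2 * n"] that by simp
  have cs: "(\<integral>u. cos (2 * of_int m * pi * u) * sin (2 * of_int n * pi * u) \<partial>unif01) = 0" for m n :: int
    using integral_sin_cos_even[of n m] by (simp add: mult.commute)
  have c: "(\<integral>u. cos (2 * of_int m * pi * u) \<partial>unif01) = 0" if "0 < m" for m :: int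
    using integral_cos_multiple[of "2 * m"] that by simp
  have k: "k = 1 \<or> k = 2 \<or> k = 3 \<or> k = 4" and j: "j = 1 \<or> j = 2 \<or> j = 3 \<or> j = 4"
    using exhaust_4 by blast+
  show "continuous_on UNIV (sine_cosine_basis k)" unfolding sine_cosine_basis_def
    using k by (elim disjE) (auto intro!: continuous_intros)
  show "(sine_cosine_basis k u)\<^sup>2 \<le> 2" unfolding sine_cosine_basis_def by (rule sqrt2_bound) simp
  show "(\<integral>u. sine_cosine_basis k u \<partial>unif01) = 0"
    unfolding sine_cosine_basis_def integral_mult_right_zero
    using k by (elim disjE) (simp_all add: c integral_sin_even_multiple del: of_int_1 of_int_numeral)
  show "(\<integral>u. sine_cosine_basis k u * sine_cosine_basis j u \<partial>unif01) = (if k = j then 1 else 0)"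
    unfolding sine_cosine_basis_def sqrt2_mult integral_mult_right_zero
    using k j by (elim disjE) (simp_all add: cc ss cs integral_sin_cos_even del: of_int_1 of_int_numeral)
qed

definition legendre_basis :: "2 \<Rightarrow> real \<Rightarrow> real" where
  "legendre_basis k u = (if k = 1 then sqrt 3 * (2 * u - 1) else sqrt 5 * (6 * u\<^sup>2 - 6 * u + 1))"

text \<open>
  Normalized shifted Legendre polynomials of degrees one and two. The second is bounded by one
  before normalization because \<open>6 u\<^sup>2 - 6 u + 1 = (3 t\<^sup>2 - 1)/2\<close> with \<open>t = 2 u - 1 \<in> [-1, 1]\<close>.
\<close>

lemma legendre_family: "copula_family legendre_basis (\<lambda>k. if k = 1 then 3 else 5)"
proof
  fix k j :: 2 and u :: real
  have P: "(\<integral>u. p u \<partial>unif01) = P 1 - P 0" if "\<And>x. (P has_real_derivative p x) (at x)" "continuous_on UNIV p" for p P :: "real \<Rightarrow> real"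
    using that by (rule unif01_integral_FTC)
  have i1: "(\<integral>u. (2 * u - 1) \<partial>unif01) = 0"
    by (subst P[where P = "\<lambda>u. u^2 - u"]) (auto intro!: derivative_eq_intros continuous_intros)
  have i2: "(\<integral>u. (6 * u\<^sup>2 - 6 * u + 1) \<partial>unif01) = 0"
    by (subst P[where P = "\<lambda>u. 2 * u^3 - 3 * u^2 + u"]) (auto intro!: derivative_eq_intros continuous_intros)
  have i11: "(\<integral>u. (2 * u - 1) * (2 * u - 1) \<partial>unif01) = 1/3"
    by (subst P[where P = "\<lambda>u. 4/3 * u^3 - 2 * u^2 + u"])
       (auto intro!: derivative_eq_intros continuous_intros simp: power2_eq_square algebra_simps)
  have i12: "(\<integral>u. (2 * u - 1) * (6 * u\<^sup>2 - 6 * u + 1) \<partial>unif01) = 0"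
    by (subst P[where P = "\<lambda>u. 3 * u^4 - 6 * u^3 + 4 * u^2 - u"])
       (auto intro!: derivative_eq_intros continuous_intros simp: power2_eq_square power3_eq_cube algebra_simps)
  have i22: "(\<integral>u. (6 * u\<^sup>2 - 6 * u + 1) * (6 * u\<^sup>2 - 6 * u + 1) \<partial>unif01) = 1/5"
    by (subst P[where P = "\<lambda>u. 36/5 * u^5 - 18 * u^4 + 16 * u^3 - 6 * u^2 + u"])
       (auto intro!: derivative_eq_intros continuous_intros
          simp: power2_eq_square power3_eq_cube power4_eq_xxxx algebra_simps)
  have i21: "(\<integral>u. (6 * u\<^sup>2 - 6 * u + 1) * (2 * u - 1) \<partial>unif01) = 0"
    using i12 by (simp only: mult.commute)
  have sq: "sqrt c * a * (sqrt d * b) = sqrt c * sqrt d * (a * b)" for a b c d :: real by simp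
  have k: "k = 1 \<or> k = 2" and j: "j = 1 \<or> j = 2" using exhaust_2 by blast+
  show "continuous_on UNIV (legendre_basis k)" unfolding legendre_basis_def
    using k by (elim disjE) (auto intro!: continuous_intros)
  show "(\<integral>u. legendre_basis k u \<partial>unif01) = 0"
    unfolding legendre_basis_def using k by (elim disjE) (simp_all add: i1 i2)
  show "(\<integral>u. legendre_basis k u * legendre_basis j u \<partial>unif01) = (if k = j then 1 else 0)"
    unfolding legendre_basis_def using k j
    by (elim disjE) (simp_all add: sq i11 i12 i21 i22)
next
  fix k :: 2 and u :: real assume u: "u \<in> {0..1}"
  have k: "k = 1 \<or> k = 2" using exhaust_2 by blast
  have a: "(2 * u - 1)\<^sup>2 \<le> 1" using u by (simp add: abs_square_le_1 abs_le_iff)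
  have "6 * u\<^sup>2 - 6 * u + 1 = 3/2 * (2 * u - 1)\<^sup>2 - 1/2" by (simp add: power2_eq_square algebra_simps)
  then have "\<bar>6 * u\<^sup>2 - 6 * u + 1\<bar> \<le> 1" using a zero_le_power2[of "2 * u - 1"] by linarith
  then have b: "(6 * u\<^sup>2 - 6 * u + 1)\<^sup>2 \<le> 1" by (simp add: abs_square_le_1)
  show "(legendre_basis k u)\<^sup>2 \<le> (if k = 1 then 3 else 5)"
    unfolding legendre_basis_def using k a b by (elim disjE) (simp_all add: power_mult_distrib)
qed

lemma sine_theory: "mle_theory_holds TYPE('w) sine_density sine_region"
proof (rule copula_family_mle[OF sine_family])
  show "sine_density L u v = 1 + (\<Sum>k\<in>UNIV. L $ k * (sine_basis k u * sine_basis k v))" for L u v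
    by (simp add: sine_density_def sine_basis_def sqrt2_mult sum_2)
  show "sine_region = {L. (\<Sum>k\<in>UNIV. 2 * \<bar>L $ k\<bar>) \<le> 1}"
    by (auto simp: sine_region_def sum_2)
qed

lemma sine_cosine_theory: "mle_theory_holds TYPE('w) sine_cosine_density sine_cosine_region"
proof (rule copula_family_mle[OF sine_cosine_family])
  show "sine_cosine_density L u v = 1 + (\<Sum>k\<in>UNIV. L $ k * (sine_cosine_basis k u * sine_cosine_basis k v))" for L u v
    by (simp add: sine_cosine_density_def sine_cosine_basis_def sqrt2_mult sum_4)
  show "sine_cosine_region = {L. (\<Sum>k\<in>UNIV. 2 * \<bar>L $ k\<bar>) \<le> 1}"
    by (auto simp: sine_cosine_region_def sum_4)
qed

lemma legendre_theory: "mle_theory_holds TYPE('w) legendre_density legendre_region"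
proof (rule copula_family_mle[OF legendre_family])
  have sq: "sqrt c * a * (sqrt c * b) = c * (a * b)" if "0 \<le> c" for a b c :: real
    using that by (metis mult.assoc mult.left_commute real_sqrt_mult_self abs_of_nonneg)
  show "legendre_density L u v = 1 + (\<Sum>k\<in>UNIV. L $ k * (legendre_basis k u * legendre_basis k v))" for L u v
  proof -
    have "legendre_basis k u * legendre_basis k v = (if k = 1 then 3 * ((2 * u - 1) * (2 * v - 1))
        else 5 * ((6 * u\<^sup>2 - 6 * u + 1) * (6 * v\<^sup>2 - 6 * v + 1)))" for k
      by (simp add: legendre_basis_def sq)
    then show ?thesis by (simp add: legendre_density_def sum_2 algebra_simps)
  qed
  show "legendre_region = {L. (\<Sum>k\<in>UNIV. (if k = 1 then 3 else 5) * \<bar>L $ k\<bar>) \<le> 1}"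
    by (auto simp: legendre_region_def sum_2)
qed

theorem theorem4p2:
  shows
   "(\<exists>T. max_likelihood_estimator sine_density sine_region T \<and>
      (\<forall>(M :: 'w measure) U C. \<forall>\<Lambda> \<in> interior sine_region.
         has_copula_density C (sine_density \<Lambda>) \<and> copula_markov_chain M U C \<longrightarrow>
         consistent_estimator M U T \<Lambda> \<and>
         invertible (Sigma_matrix M U sine_density \<Lambda>) \<and>
         converges_in_distribution M (\<lambda>n \<omega>. sqrt (real n) *\<^sub>R (T n (sample U n \<omega>) - \<Lambda>))
           (multivariate_normal 0 (matrix_inv (Sigma_matrix M U sine_density \<Lambda>))) \<and>
         (\<forall>\<alpha>. 0 < \<alpha> \<and> \<alpha> < 1 \<longrightarrow> (\<forall>k.
            (\<lambda>n. measure M {\<omega> \<in> space M.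
               let x = sample U n \<omega>;
                   h = std_normal_upper_quantile (\<alpha> / 2) *
                       sqrt (matrix_inv (observed_information sine_density n x (T n x)) $ k $ k)
               in \<Lambda> $ k \<in> {T n x $ k - h <..< T n x $ k + h}}) \<longlonglongrightarrow> 1 - \<alpha>)))) \<and>
    (\<exists>T. max_likelihood_estimator sine_cosine_density sine_cosine_region T \<and>
      (\<forall>(M :: 'w measure) U C. \<forall>\<Lambda> \<in> interior sine_cosine_region.
         has_copula_density C (sine_cosine_density \<Lambda>) \<and> copula_markov_chain M U C \<longrightarrow>
         consistent_estimator M U T \<Lambda> \<and>
         invertible (Sigma_matrix M U sine_cosine_density \<Lambda>) \<and>
         converges_in_distribution M (\<lambda>n \<omega>. sqrt (real n) *\<^sub>R (T n (sample U n \<omega>) - \<Lambda>))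
           (multivariate_normal 0 (matrix_inv (Sigma_matrix M U sine_cosine_density \<Lambda>))) \<and>
         (\<forall>\<alpha>. 0 < \<alpha> \<and> \<alpha> < 1 \<longrightarrow> (\<forall>k.
            (\<lambda>n. measure M {\<omega> \<in> space M.
               let x = sample U n \<omega>;
                   h = std_normal_upper_quantile (\<alpha> / 2) *
                       sqrt (matrix_inv (observed_information sine_cosine_density n x (T n x)) $ k $ k)
               in \<Lambda> $ k \<in> {T n x $ k - h <..< T n x $ k + h}}) \<longlonglongrightarrow> 1 - \<alpha>)))) \<and>
    (\<exists>T. max_likelihood_estimator legendre_density legendre_region T \<and>
      (\<forall>(M :: 'w measure) U C. \<forall>\<Lambda> \<in> interior legendre_region.
         has_copula_density C (legendre_density \<Lambda>) \<and> copula_markov_chain M U C \<longrightarrow>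
         consistent_estimator M U T \<Lambda> \<and>
         invertible (Sigma_matrix M U legendre_density \<Lambda>) \<and>
         converges_in_distribution M (\<lambda>n \<omega>. sqrt (real n) *\<^sub>R (T n (sample U n \<omega>) - \<Lambda>))
           (multivariate_normal 0 (matrix_inv (Sigma_matrix M U legendre_density \<Lambda>))) \<and>
         (\<forall>\<alpha>. 0 < \<alpha> \<and> \<alpha> < 1 \<longrightarrow> (\<forall>k.
            (\<lambda>n. measure M {\<omega> \<in> space M.
               let x = sample U n \<omega>;
                   h = std_normal_upper_quantile (\<alpha> / 2) *
                       sqrt (matrix_inv (observed_information legendre_density n x (T n x)) $ k $ k)
               in \<Lambda> $ k \<in> {T n x $ k - h <..< T n x $ k + h}}) \<longlonglongrightarrow> 1 - \<alpha>))))"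
  using sine_theory sine_cosine_theory legendre_theory
  unfolding mle_theory_holds_def by (intro conjI)

end
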